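(* Let $\mathcal{U}_{Q,\beta}(\mathfrak{g})$ be the 2-category attached (as in the context) to a simply-laced Cartan datum, a choice of scalars $Q=\{t_{ij}\}_{i\ne j}$ and bubble parameters $\beta=(\beta_i,\mathsf{c}^{+}_{i,\lambda},\mathsf{c}^{-}_{i,\lambda})$ compatible with $Q$. Let $\mathcal{U}^{cyc}_{Q}(\mathfrak{g})$ be the cyclic 2-category attached to the same Cartan datum and the same scalars $t_{ij}$ ($i\neq j$), with all $\beta_{i,\lambda}$ equal to $-1$, and compatible bubble parameters denoted $c_{i,\lambda}$ (value of the degree zero clockwise $i$-bubble in weight $\lambda$) and $c_{i,\lambda}^{-1}$ (value of the degree zero counterclockwise one). Then there is an isomorphism of graded additive $\Bbbk$-linear 2-categories $$\digamma\colon \mathcal{U}^{cyc}_{Q}(\mathfrak{g})\longrightarrow \mathcal{U}_{Q,\beta}(\mathfrak{g})$$ which acts as the identity on objects and 1-morphisms and is given on generating 2-morphisms, for all $i,j\in I$ and $\lambda\in X$, by $$\digamma(x_{i,\lambda})=x_{i,\lambda},\qquad \digamma(\psi_{ij,\lambda})=\psi_{ij,\lambda},$$ $$\digamma(\epsilon_{i,\lambda})=\begin{cases}\dfrac{c_{i,\lambda}}{\mathsf{c}^{+}_{i,\lambda}}\,\epsilon_{i,\lambda} & \text{if }\lambda_i\equiv 0\text{ or }1 \pmod 4,\\[2mm] c_{i,\lambda}\,\epsilon_{i,\lambda} & \text{otherwise,}\end{cases}\qquad \digamma(\epsilon'_{i,\lambda})=\begin{cases}\dfrac{1}{\mathsf{c}^{-}_{i,\lambda}}\,\epsilon'_{i,\lambda}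 & \text{if }\lambda_i\equiv 0\text{ or }1 \pmod 4,\\[2mm] \epsilon'_{i,\lambda} & \text{otherwise,}\end{cases}$$ $$\digamma(\eta'_{i,\lambda})=\begin{cases}\dfrac{1}{\mathsf{c}^{+}_{i,\lambda}}\,\eta'_{i,\lambda} & \text{if }\lambda_i\equiv 2\text{ or }3 \pmod 4,\\[2mm] \eta'_{i,\lambda} & \text{otherwise,}\end{cases}\qquad \digamma(\eta_{i,\lambda})=\begin{cases}\dfrac{c_{i,\lambda}^{-1}}{\mathsf{c}^{-}_{i,\lambda}}\,\eta_{i,\lambda} & \text{if }\lambda_i\equiv 2\text{ or }3 \pmod 4,\\[2mm] c_{i,\lambda}^{-1}\,\eta_{i,\lambda} & \text{otherwise.}\end{cases}$$
   Context: **Cartan data.** $\Bbbk$ is a field. A symmetric (simply-laced) Cartan datum consists of a free $\mathbb{Z}$-module $X$ (weight lattice), an index set $I$, elements $\alpha_i,\Lambda_i\in X$ and $h_i\in X^\vee=\mathrm{Hom}_{\mathbb{Z}}(X,\mathbb{Z})$ for $i\in I$, and a bilinear form $(\cdot,\cdot)$ on $X$ with $(\alpha_i,\alpha_i)=2$; $(\alpha_i,\alpha_j)\in\{0,-1\}$ for $i\neq j$; $\langle h_i,\lambda\rangle=(\alpha_i,\lambda)$; $\langle h_j,\Lambda_i\rangle=\delta_{ij}$. The matrix $a_{ij}=\langle h_i,\alpha_j\rangle=(\alpha_i,\alpha_j)$ is the Cartan matrix of $\mathfrak{g}$. Write $i\cdot j=(\alpha_i,\alpha_j)$ and $\lambda_i=\langle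 h_i,\lambda\rangle$. **Parameters.** A choice of scalars $Q$ is a family $t_{ij}\in\Bbbk^\times$ ($i\neq j$) with $t_{ij}=t_{ji}$ when $a_{ij}=0$. Bubble parameters $\beta$ consist of scalars $\beta_i=\beta_{i,\lambda}\in\Bbbk^\times$ (one scalar $\beta_i$ for each $i$, also written $\beta_{i,\lambda}$) and $\mathsf{c}^{+}_{i,\lambda},\mathsf{c}^{-}_{i,\lambda}\in\Bbbk^\times$ for $i\in I,\lambda\in X$. Put $t_{ii}:=-\beta_i$. They are compatible with $Q$ if for all $i,j\in I$ (including $i=j$) and $\lambda\in X$: $\mathsf{c}^{+}_{i,\lambda}\mathsf{c}^{-}_{i,\lambda}=-1/\beta_i=1/t_{ii}$, $\ \mathsf{c}^{+}_{i,\lambda+\alpha_j}=t_{ij}\mathsf{c}^{+}_{i,\lambda}$, $\ \mathsf{c}^{-}_{i,\lambda-\alpha_j}=t_{ij}\mathsf{c}^{-}_{i,\lambda}$. **The 2-category $\mathcal{U}_{Q,\beta}(\mathfrak{g})$** (for $\beta$ compatible with $Q$) is the graded additive $\Bbbk$-linear 2-category with: - Objects: $\lambda\in X$. - 1-morphisms: formal direct sums of grading shifts $\langle t\rangle$ of composites of $\mathbf{1}_\lambda$, $\mathcal{E}_i\mathbf{1}_\lambda=\mathbf{1}_{\lambda+\alpha_i}\mathcal{E}_i$, $\mathcal{F}_i\mathbf{1}_\lambda=\mathbf{1}_{\lambda-\alpha_i}\mathcal{F}_i$. - 2-morphisms: $\Bbbk$-linear combinations of vertical/horizontal composites of the following generators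 (with identities and shifts): dots $x_{i,\lambda}\colon\mathcal{E}_i\mathbf{1}_\lambda\to\mathcal{E}_i\mathbf{1}_\lambda\langle 2\rangle$; crossings $\psi_{ij,\lambda}\colon\mathcal{E}_i\mathcal{E}_j\mathbf{1}_\lambda\to\mathcal{E}_j\mathcal{E}_i\mathbf{1}_\lambda\langle -i\cdot j\rangle$; cups $\eta_{i,\lambda}\colon\mathbf{1}_\lambda\to\mathcal{F}_i\mathcal{E}_i\mathbf{1}_\lambda\langle 1+\lambda_i\rangle$ and $\eta'_{i,\lambda}\colon\mathbf{1}_\lambda\to\mathcal{E}_i\mathcal{F}_i\mathbf{1}_\lambda\langle 1-\lambda_i\rangle$; caps $\epsilon'_{i,\lambda}\colon\mathcal{F}_i\mathcal{E}_i\mathbf{1}_\lambda\to\mathbf{1}_\lambda\langle 1+\lambda_i\rangle$ and $\epsilon_{i,\lambda}\colon\mathcal{E}_i\mathcal{F}_i\mathbf{1}_\lambda\to\mathbf{1}_\lambda\langle 1-\lambda_i\rangle$. Horizontal composition with identity 2-morphisms of $\mathcal{E}_i,\mathcal{F}_i$ is written by juxtaposition; weight subscripts and shifts are suppressed when determined by the source. The relations (for all indices and weights) are: (1) Biadjointness: $(\epsilon_{i,\lambda+\alpha_i}\mathcal{E}_i)(\mathcal{E}_i\eta_{i,\lambda})=\mathrm{id}_{\mathcal{E}_i\mathbf{1}_\lambda}=(\mathcal{E}_i\epsilon'_{i,\lambda})(\eta'_{i,\lambda+\alpha_i}\mathcal{E}_i)$ and $(\mathcal{F}_i\epsilon_{i,\lambda+\alpha_i})(\eta_{i,\lambda}\mathcal{F}_i)=\mathrm{id}_{\mathcal{F}_i\mathbf{1}_{\lambda+\alpha_i}}=(\epsilon'_{i,\lambda}\mathcal{F}_i)(\mathcal{F}_i\eta'_{i,\lambda+\alpha_i})$.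 (2) Cyclicity: on $\mathcal{F}_i\mathbf{1}_{\lambda+\alpha_i}$, $(\epsilon'_i\mathcal{F}_i)(\mathcal{F}_ix_i\mathcal{F}_i)(\mathcal{F}_i\eta'_i)=(\mathcal{F}_i\epsilon_i)(\mathcal{F}_ix_i\mathcal{F}_i)(\eta_i\mathcal{F}_i)$ (this is the downward dot). As maps $\mathcal{F}_i\mathcal{F}_j\mathbf{1}_\lambda\to\mathcal{F}_j\mathcal{F}_i\mathbf{1}_\lambda\langle -i\cdot j\rangle$, the two composites $\mathcal{F}_i\mathcal{F}_j\xrightarrow{\eta_j}\mathcal{F}_j\mathcal{E}_j\mathcal{F}_i\mathcal{F}_j\xrightarrow{\eta_i}\mathcal{F}_j\mathcal{F}_i\mathcal{E}_i\mathcal{E}_j\mathcal{F}_i\mathcal{F}_j\xrightarrow{\psi_{ij}}\mathcal{F}_j\mathcal{F}_i\mathcal{E}_j\mathcal{E}_i\mathcal{F}_i\mathcal{F}_j\xrightarrow{\epsilon_i}\mathcal{F}_j\mathcal{F}_i\mathcal{E}_j\mathcal{F}_j\xrightarrow{\epsilon_j}\mathcal{F}_j\mathcal{F}_i$ and $\mathcal{F}_i\mathcal{F}_j\xrightarrow{\eta'_i}\mathcal{F}_i\mathcal{F}_j\mathcal{E}_i\mathcal{F}_i\xrightarrow{\eta'_j}\mathcal{F}_i\mathcal{F}_j\mathcal{E}_i\mathcal{E}_j\mathcal{F}_j\mathcal{F}_i\xrightarrow{\psi_{ij}}\mathcal{F}_i\mathcal{F}_j\mathcal{E}_j\mathcal{E}_i\mathcal{F}_j\mathcal{F}_i\xrightarrow{\epsilon'_j}\mathcal{F}_i\mathcal{E}_i\mathcal{F}_j\mathcal{F}_i\xrightarrow{\epsilon'_i}\mathcal{F}_j\mathcal{F}_i$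 are equal (this is the downward crossing). Sideways crossings are defined by $\sigma_{ij}:=(\mathcal{F}_j\mathcal{E}_i\epsilon_j)(\mathcal{F}_j\psi_{ji}\mathcal{F}_j)(\eta_j\mathcal{E}_i\mathcal{F}_j)\colon\mathcal{E}_i\mathcal{F}_j\mathbf{1}_\lambda\to\mathcal{F}_j\mathcal{E}_i\mathbf{1}_\lambda$ and $\sigma'_{ij}:=(\epsilon'_i\mathcal{E}_j\mathcal{F}_i)(\mathcal{F}_i\psi_{ji}\mathcal{F}_i)(\mathcal{F}_i\mathcal{E}_j\eta'_i)\colon\mathcal{F}_i\mathcal{E}_j\mathbf{1}_\lambda\to\mathcal{E}_j\mathcal{F}_i\mathbf{1}_\lambda$. (3) KLR relations: $\psi_{ji}\psi_{ij}=0$ if $i=j$; $=t_{ij}\,\mathrm{id}$ if $i\cdot j=0$; $=t_{ij}\,x_i\mathcal{E}_j+t_{ji}\,\mathcal{E}_ix_j$ if $i\cdot j=-1$. NilHecke: $\psi_{ii}(x_i\mathcal{E}_i)-(\mathcal{E}_ix_i)\psi_{ii}=\mathrm{id}=(x_i\mathcal{E}_i)\psi_{ii}-\psi_{ii}(\mathcal{E}_ix_i)$. For $i\neq j$: $\psi_{ij}(x_i\mathcal{E}_j)=(\mathcal{E}_jx_i)\psi_{ij}$ and $(x_j\mathcal{E}_i)\psi_{ij}=\psi_{ij}(\mathcal{E}_ix_j)$. Cubic: $(\psi_{jk}\mathcal{E}_i)(\mathcal{E}_j\psi_{ik})(\psi_{ij}\mathcal{E}_k)-(\mathcal{E}_k\psi_{ij})(\psi_{ik}\mathcal{E}_j)(\mathcal{E}_i\psi_{jk})$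 equals $t_{ij}\,\mathrm{id}$ if $i=k$ and $i\cdot j=-1$, and $0$ otherwise. (4) Mixed relations: for $i\neq j$, $\sigma_{ij}\sigma'_{ji}=\mathrm{id}_{\mathcal{F}_j\mathcal{E}_i\mathbf{1}_\lambda}$ and $\sigma'_{ji}\sigma_{ij}=\mathrm{id}_{\mathcal{E}_i\mathcal{F}_j\mathbf{1}_\lambda}$. (5) Bubbles: for $m\ge 0$ let $\circlearrowright_{i,\lambda}(m)=\epsilon_{i,\lambda}(x_i^m\mathcal{F}_i)\eta'_{i,\lambda}$ (clockwise) and $\circlearrowleft_{i,\lambda}(m)=\epsilon'_{i,\lambda}(\mathcal{F}_ix_i^m)\eta_{i,\lambda}$ (counterclockwise), endomorphisms of $\mathbf{1}_\lambda$. Then for $m\geq 0$: $\circlearrowright_{i,\lambda}(m)=0$ if $m<\lambda_i-1$; $\circlearrowleft_{i,\lambda}(m)=0$ if $m<-\lambda_i-1$; $\circlearrowright_{i,\lambda}(\lambda_i-1)=\mathsf{c}^{+}_{i,\lambda}\mathrm{id}$ if $\lambda_i\ge1$; $\circlearrowleft_{i,\lambda}(-\lambda_i-1)=\mathsf{c}^{-}_{i,\lambda}\mathrm{id}$ if $\lambda_i\le-1$. Fake bubbles (formal symbols with negative $m$) are defined by $\circlearrowright_{i,\lambda}(\lambda_i-1)=\mathsf{c}^{+}_{i,\lambda}\mathrm{id}$ for $\lambda_i\le0$; $\circlearrowleft_{i,\lambda}(-\lambda_i-1)=\mathsf{c}^{-}_{i,\lambda}\mathrm{id}$ for $\lambda_i\ge0$;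 for $\lambda_i<0$, $0<j<-\lambda_i+1$: $\circlearrowright_{i,\lambda}(\lambda_i-1+j)=-\frac1{\mathsf{c}^{-}_{i,\lambda}}\sum_{x+y=j,\,y\ge1}\circlearrowright_{i,\lambda}(\lambda_i-1+x)\circlearrowleft_{i,\lambda}(-\lambda_i-1+y)$; for $\lambda_i>0$, $0<j<\lambda_i+1$: $\circlearrowleft_{i,\lambda}(-\lambda_i-1+j)=-\frac1{\mathsf{c}^{+}_{i,\lambda}}\sum_{x+y=j,\,x\ge1}\circlearrowright_{i,\lambda}(\lambda_i-1+x)\circlearrowleft_{i,\lambda}(-\lambda_i-1+y)$; both are $0$ for $j<0$. (Here $x,y\geq 0$.) Equivalently, bubbles satisfy the infinite Grassmannian relation $\big(\sum_{r\ge0}\circlearrowright_{i,\lambda}(\lambda_i-1+r)t^r\big)\big(\sum_{s\ge0}\circlearrowleft_{i,\lambda}(-\lambda_i-1+s)t^s\big)=-1/\beta_{i,\lambda}$. (6) $\mathfrak{sl}_2$ relations (sums over $f_1,f_2,f_3\ge0$, empty if the total is negative): $\mathrm{id}_{\mathcal{E}_i\mathcal{F}_i\mathbf{1}_\lambda}=\beta_{i,\lambda}\,\sigma'_{ii}\sigma_{ii}-\beta_{i,\lambda}\sum_{f_1+f_2+f_3=\lambda_i-1}(x_i^{f_3}\mathcal{F}_i)\eta'_{i,\lambda}\circ\circlearrowleft_{i,\lambda}(-\lambda_i-1+f_2)\circ\epsilon_{i,\lambda}(x_i^{f_1}\mathcal{F}_i)$, $\mathrm{id}_{\mathcal{F}_i\mathcal{E}_i\mathbf{1}_\lambda}=\beta_{i,\lambda}\,\sigma_{ii}\sigma'_{ii}-\beta_{i,\lambda}\sum_{f_1+f_2+f_3=-\lambda_i-1}(\mathcal{F}_ix_i^{f_3})\eta_{i,\lambda}\circ\circlearrowright_{i,\lambda}(\lambda_i-1+f_2)\circ\epsilon'_{i,\lambda}(\mathcal{F}_ix_i^{f_1})$.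 **The cyclic 2-category $\mathcal{U}^{cyc}_Q(\mathfrak{g})$** is the 2-category $\mathcal{U}_{Q,\beta}(\mathfrak{g})$ (with its objects, 1-morphisms, generating 2-morphisms and relations (1)–(6)) in the special case where the bubble parameters $\beta$, compatible with $Q$, have $\beta_{i,\lambda}=-1$ for all $i\in I$ and $\lambda\in X$. Then $\mathsf{c}^-_{i,\lambda}=(\mathsf{c}^+_{i,\lambda})^{-1}$, and one writes $c_{i,\lambda}:=\mathsf{c}^+_{i,\lambda}$, $c_{i,\lambda}^{-1}=\mathsf{c}^-_{i,\lambda}$; compatibility says $c_{i,\lambda+\alpha_j}=t_{ij}c_{i,\lambda}$ for $i\neq j$ and $c_{i,\lambda+\alpha_i}=c_{i,\lambda}$. *)

theory Defs
  imports Complex_Main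
begin

section \<open>Graded additive linear 2-categories\<close>

text \<open>
  A strict 2-category with carriers: objects, 1-morphisms and 2-morphisms.
  \<^term>\<open>Comp1 C A B\<close>, \<^term>\<open>VComp C f g\<close> and \<^term>\<open>HComp C f g\<close> are written in the order of
  composition of functions, so the right-hand factor is applied first.
  \<^term>\<open>Shift1 C n A\<close> is the grading shift of \<^term>\<open>A\<close> by the integer \<^term>\<open>n\<close>; 2-morphisms are the
  morphisms of degree zero, and a 2-morphism of degree \<^term>\<open>n\<close> from \<^term>\<open>A\<close> to \<^term>\<open>B\<close> is
  an element of \<^term>\<open>hom2 C A (Shift1 C n B)\<close>.
\<close>

record ('o, 'a, 'b, 'k) two_cat =
  Obj :: "'o set"
  Mor1 :: "'a set"
  Mor2 :: "'b set"
  Src :: "'a \<Rightarrow> 'o"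
  Tgt :: "'a \<Rightarrow> 'o"
  Dom :: "'b \<Rightarrow> 'a"
  Cod :: "'b \<Rightarrow> 'a"
  Id1 :: "'o \<Rightarrow> 'a"
  Comp1 :: "'a \<Rightarrow> 'a \<Rightarrow> 'a"
  Id2 :: "'a \<Rightarrow> 'b"
  VComp :: "'b \<Rightarrow> 'b \<Rightarrow> 'b"
  HComp :: "'b \<Rightarrow> 'b \<Rightarrow> 'b"
  Zero2 :: "'a \<Rightarrow> 'a \<Rightarrow> 'b"
  Add2 :: "'b \<Rightarrow> 'b \<Rightarrow> 'b"
  Smult2 :: "'k \<Rightarrow> 'b \<Rightarrow> 'b"
  Shift1 :: "int \<Rightarrow> 'a \<Rightarrow> 'a"
  Shift2 :: "int \<Rightarrow> 'b \<Rightarrow> 'b"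

definition hom1 :: "('o, 'a, 'b, 'k) two_cat \<Rightarrow> 'o \<Rightarrow> 'o \<Rightarrow> 'a set" where
  "hom1 C x y = {A \<in> Mor1 C. Src C A = x \<and> Tgt C A = y}"

definition hom2 :: "('o, 'a, 'b, 'k) two_cat \<Rightarrow> 'a \<Rightarrow> 'a \<Rightarrow> 'b set" where
  "hom2 C A B = {f \<in> Mor2 C. Dom C f = A \<and> Cod C f = B}"

locale strict_two_category =
  fixes C :: "('o, 'a, 'b, 'k) two_cat"
  assumes src_tgt: "A \<in> Mor1 C \<Longrightarrow> Src C A \<in> Obj C \<and> Tgt C A \<in> Obj C"
    and dom_cod: "f \<in> Mor2 C \<Longrightarrow> Dom C f \<in> Mor1 C \<and> Cod C f \<in> Mor1 C \<and>
      Src C (Dom C f) = Src C (Cod C f) \<and> Tgt C (Dom C f) = Tgt C (Cod C f)"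
    and id1_hom: "x \<in> Obj C \<Longrightarrow> Id1 C x \<in> hom1 C x x"
    and comp1_hom: "A \<in> hom1 C y z \<Longrightarrow> B \<in> hom1 C x y \<Longrightarrow> Comp1 C A B \<in> hom1 C x z"
    and comp1_assoc: "A1 \<in> hom1 C y z \<Longrightarrow> A2 \<in> hom1 C x y \<Longrightarrow> A3 \<in> hom1 C w x \<Longrightarrow>
      Comp1 C (Comp1 C A1 A2) A3 = Comp1 C A1 (Comp1 C A2 A3)"
    and comp1_id_left: "A \<in> hom1 C x y \<Longrightarrow> Comp1 C (Id1 C y) A = A"
    and comp1_id_right: "A \<in> hom1 C x y \<Longrightarrow> Comp1 C A (Id1 C x) = A"
    and id2_hom: "A \<in> Mor1 C \<Longrightarrow> Id2 C A \<in> hom2 C A A"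
    and vcomp_hom: "f \<in> hom2 C B A' \<Longrightarrow> g \<in> hom2 C A B \<Longrightarrow> VComp C f g \<in> hom2 C A A'"
    and vcomp_assoc: "f \<in> hom2 C A3 A4 \<Longrightarrow> g \<in> hom2 C A2 A3 \<Longrightarrow> h \<in> hom2 C A1 A2 \<Longrightarrow>
      VComp C (VComp C f g) h = VComp C f (VComp C g h)"
    and vcomp_id_left: "f \<in> hom2 C A B \<Longrightarrow> VComp C (Id2 C B) f = f"
    and vcomp_id_right: "f \<in> hom2 C A B \<Longrightarrow> VComp C f (Id2 C A) = f"
    and hcomp_hom: "f \<in> hom2 C A A' \<Longrightarrow> g \<in> hom2 C B B' \<Longrightarrow> Src C A = Tgt C B \<Longrightarrow>
      HComp C f g \<in> hom2 C (Comp1 C A B) (Comp1 C A' B')"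
    and hcomp_assoc: "f \<in> Mor2 C \<Longrightarrow> g \<in> Mor2 C \<Longrightarrow> h \<in> Mor2 C \<Longrightarrow>
      Src C (Dom C f) = Tgt C (Dom C g) \<Longrightarrow> Src C (Dom C g) = Tgt C (Dom C h) \<Longrightarrow>
      HComp C (HComp C f g) h = HComp C f (HComp C g h)"
    and hcomp_id_left: "f \<in> Mor2 C \<Longrightarrow> HComp C (Id2 C (Id1 C (Tgt C (Dom C f)))) f = f"
    and hcomp_id_right: "f \<in> Mor2 C \<Longrightarrow> HComp C f (Id2 C (Id1 C (Src C (Dom C f)))) = f"
    and hcomp_id2: "A \<in> Mor1 C \<Longrightarrow> B \<in> Mor1 C \<Longrightarrow> Src C A = Tgt C B \<Longrightarrow>
      HComp C (Id2 C A) (Id2 C B) = Id2 C (Comp1 C A B)"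
    and interchange: "f \<in> hom2 C A2 A3 \<Longrightarrow> f' \<in> hom2 C A1 A2 \<Longrightarrow>
      g \<in> hom2 C B2 B3 \<Longrightarrow> g' \<in> hom2 C B1 B2 \<Longrightarrow> Src C A1 = Tgt C B1 \<Longrightarrow>
      HComp C (VComp C f f') (VComp C g g') = VComp C (HComp C f g) (HComp C f' g')"

locale linear_two_category = strict_two_category C
  for C :: "('o, 'a, 'b, 'k::field) two_cat" +
  assumes zero2_hom: "A \<in> hom1 C x y \<Longrightarrow> B \<in> hom1 C x y \<Longrightarrow> Zero2 C A B \<in> hom2 C A B"
    and add2_hom: "f \<in> hom2 C A B \<Longrightarrow> g \<in> hom2 C A B \<Longrightarrow> Add2 C f g \<in> hom2 C A B"
    and smult2_hom: "f \<in> hom2 C A B \<Longrightarrow> Smult2 C a f \<in> hom2 C A B"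
    and add2_assoc: "f \<in> hom2 C A B \<Longrightarrow> g \<in> hom2 C A B \<Longrightarrow> h \<in> hom2 C A B \<Longrightarrow>
      Add2 C (Add2 C f g) h = Add2 C f (Add2 C g h)"
    and add2_comm: "f \<in> hom2 C A B \<Longrightarrow> g \<in> hom2 C A B \<Longrightarrow> Add2 C f g = Add2 C g f"
    and add2_zero: "f \<in> hom2 C A B \<Longrightarrow> Add2 C f (Zero2 C A B) = f"
    and add2_neg: "f \<in> hom2 C A B \<Longrightarrow> Add2 C f (Smult2 C (- 1) f) = Zero2 C A B"
    and smult2_add2: "f \<in> hom2 C A B \<Longrightarrow> g \<in> hom2 C A B \<Longrightarrow>
      Smult2 C a (Add2 C f g) = Add2 C (Smult2 C a f) (Smult2 C a g)"
    and smult2_plus: "f \<in> hom2 C A B \<Longrightarrow>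
      Smult2 C (a + b) f = Add2 C (Smult2 C a f) (Smult2 C b f)"
    and smult2_times: "f \<in> hom2 C A B \<Longrightarrow> Smult2 C (a * b) f = Smult2 C a (Smult2 C b f)"
    and smult2_one: "f \<in> hom2 C A B \<Longrightarrow> Smult2 C 1 f = f"
    and vcomp_add_left: "f \<in> hom2 C B A' \<Longrightarrow> g \<in> hom2 C B A' \<Longrightarrow> h \<in> hom2 C A B \<Longrightarrow>
      VComp C (Add2 C f g) h = Add2 C (VComp C f h) (VComp C g h)"
    and vcomp_add_right: "f \<in> hom2 C B A' \<Longrightarrow> g \<in> hom2 C A B \<Longrightarrow> h \<in> hom2 C A B \<Longrightarrow>
      VComp C f (Add2 C g h) = Add2 C (VComp C f g) (VComp C f h)"
    and vcomp_smult_left: "f \<in> hom2 C B A' \<Longrightarrow> g \<in> hom2 C A B \<Longrightarrow>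
      VComp C (Smult2 C a f) g = Smult2 C a (VComp C f g)"
    and vcomp_smult_right: "f \<in> hom2 C B A' \<Longrightarrow> g \<in> hom2 C A B \<Longrightarrow>
      VComp C f (Smult2 C a g) = Smult2 C a (VComp C f g)"
    and hcomp_add_left: "f \<in> hom2 C A A' \<Longrightarrow> g \<in> hom2 C A A' \<Longrightarrow> h \<in> hom2 C B B' \<Longrightarrow>
      Src C A = Tgt C B \<Longrightarrow> HComp C (Add2 C f g) h = Add2 C (HComp C f h) (HComp C g h)"
    and hcomp_add_right: "f \<in> hom2 C A A' \<Longrightarrow> g \<in> hom2 C B B' \<Longrightarrow> h \<in> hom2 C B B' \<Longrightarrow>
      Src C A = Tgt C B \<Longrightarrow> HComp C f (Add2 C g h) = Add2 C (HComp C f g) (HComp C f h)"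
    and hcomp_smult_left: "f \<in> hom2 C A A' \<Longrightarrow> g \<in> hom2 C B B' \<Longrightarrow>
      Src C A = Tgt C B \<Longrightarrow> HComp C (Smult2 C a f) g = Smult2 C a (HComp C f g)"
    and hcomp_smult_right: "f \<in> hom2 C A A' \<Longrightarrow> g \<in> hom2 C B B' \<Longrightarrow>
      Src C A = Tgt C B \<Longrightarrow> HComp C f (Smult2 C a g) = Smult2 C a (HComp C f g)"

locale additive_two_category = linear_two_category C
  for C :: "('o, 'a, 'b, 'k::field) two_cat" +
  assumes zero_object: "x \<in> Obj C \<Longrightarrow> y \<in> Obj C \<Longrightarrow>
      \<exists>Z \<in> hom1 C x y. Id2 C Z = Zero2 C Z Z"
    and biproducts: "A \<in> hom1 C x y \<Longrightarrow> B \<in> hom1 C x y \<Longrightarrow>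
      \<exists>S \<in> hom1 C x y. \<exists>i \<in> hom2 C A S. \<exists>j \<in> hom2 C B S. \<exists>p \<in> hom2 C S A. \<exists>q \<in> hom2 C S B.
        VComp C p i = Id2 C A \<and> VComp C q j = Id2 C B \<and>
        VComp C p j = Zero2 C B A \<and> VComp C q i = Zero2 C A B \<and>
        Add2 C (VComp C i p) (VComp C j q) = Id2 C S"

text \<open>The shift is a linear automorphism of each Hom-category, compatible with composition.\<close>

locale graded_additive_two_category = additive_two_category C
  for C :: "('o, 'a, 'b, 'k::field) two_cat" +
  assumes shift1_hom: "A \<in> hom1 C x y \<Longrightarrow> Shift1 C n A \<in> hom1 C x y"
    and shift1_0: "A \<in> Mor1 C \<Longrightarrow> Shift1 C 0 A = A"
    and shift1_plus: "A \<in> Mor1 C \<Longrightarrow> Shift1 C (m + n) A = Shift1 C m (Shift1 C n A)"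
    and shift2_hom: "f \<in> hom2 C A B \<Longrightarrow> Shift2 C n f \<in> hom2 C (Shift1 C n A) (Shift1 C n B)"
    and shift2_0: "f \<in> Mor2 C \<Longrightarrow> Shift2 C 0 f = f"
    and shift2_plus: "f \<in> Mor2 C \<Longrightarrow> Shift2 C (m + n) f = Shift2 C m (Shift2 C n f)"
    and shift2_id2: "A \<in> Mor1 C \<Longrightarrow> Shift2 C n (Id2 C A) = Id2 C (Shift1 C n A)"
    and shift2_vcomp: "f \<in> hom2 C B A' \<Longrightarrow> g \<in> hom2 C A B \<Longrightarrow>
      Shift2 C n (VComp C f g) = VComp C (Shift2 C n f) (Shift2 C n g)"
    and shift2_add2: "f \<in> hom2 C A B \<Longrightarrow> g \<in> hom2 C A B \<Longrightarrow>
      Shift2 C n (Add2 C f g) = Add2 C (Shift2 C n f) (Shift2 C n g)"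
    and shift2_smult2: "f \<in> hom2 C A B \<Longrightarrow> Shift2 C n (Smult2 C a f) = Smult2 C a (Shift2 C n f)"
    and shift1_comp1: "A \<in> hom1 C y z \<Longrightarrow> B \<in> hom1 C x y \<Longrightarrow>
      Comp1 C (Shift1 C n A) B = Shift1 C n (Comp1 C A B) \<and>
      Comp1 C A (Shift1 C n B) = Shift1 C n (Comp1 C A B)"
    and shift2_hcomp: "f \<in> Mor2 C \<Longrightarrow> g \<in> Mor2 C \<Longrightarrow> Src C (Dom C f) = Tgt C (Dom C g) \<Longrightarrow>
      HComp C (Shift2 C n f) g = Shift2 C n (HComp C f g) \<and>
      HComp C f (Shift2 C n g) = Shift2 C n (HComp C f g)"

text \<open>
  Strict 2-functors that are linear on 2-morphisms and commute with the shifts.  Linearity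
  implies that biproducts are preserved.
\<close>

locale graded_additive_two_functor =
  C: graded_additive_two_category C + D: graded_additive_two_category D
  for C :: "('o, 'a, 'b, 'k::field) two_cat" and D :: "('p, 'c, 'd, 'k) two_cat" +
  fixes F0 :: "'o \<Rightarrow> 'p" and F1 :: "'a \<Rightarrow> 'c" and F2 :: "'b \<Rightarrow> 'd"
  assumes F0_obj: "x \<in> Obj C \<Longrightarrow> F0 x \<in> Obj D"
    and F1_hom: "A \<in> hom1 C x y \<Longrightarrow> F1 A \<in> hom1 D (F0 x) (F0 y)"
    and F2_hom: "f \<in> hom2 C A B \<Longrightarrow> F2 f \<in> hom2 D (F1 A) (F1 B)"
    and F1_id1: "x \<in> Obj C \<Longrightarrow> F1 (Id1 C x) = Id1 D (F0 x)"
    and F1_comp1: "A \<in> hom1 C y z \<Longrightarrow> B \<in> hom1 C x y \<Longrightarrow>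
      F1 (Comp1 C A B) = Comp1 D (F1 A) (F1 B)"
    and F2_id2: "A \<in> Mor1 C \<Longrightarrow> F2 (Id2 C A) = Id2 D (F1 A)"
    and F2_vcomp: "f \<in> hom2 C B A' \<Longrightarrow> g \<in> hom2 C A B \<Longrightarrow>
      F2 (VComp C f g) = VComp D (F2 f) (F2 g)"
    and F2_hcomp: "f \<in> Mor2 C \<Longrightarrow> g \<in> Mor2 C \<Longrightarrow> Src C (Dom C f) = Tgt C (Dom C g) \<Longrightarrow>
      F2 (HComp C f g) = HComp D (F2 f) (F2 g)"
    and F2_add2: "f \<in> hom2 C A B \<Longrightarrow> g \<in> hom2 C A B \<Longrightarrow> F2 (Add2 C f g) = Add2 D (F2 f) (F2 g)"
    and F2_smult2: "f \<in> hom2 C A B \<Longrightarrow> F2 (Smult2 C a f) = Smult2 D a (F2 f)"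
    and F1_shift1: "A \<in> Mor1 C \<Longrightarrow> F1 (Shift1 C n A) = Shift1 D n (F1 A)"
    and F2_shift2: "f \<in> Mor2 C \<Longrightarrow> F2 (Shift2 C n f) = Shift2 D n (F2 f)"

locale graded_additive_two_isomorphism = graded_additive_two_functor C D F0 F1 F2
  for C :: "('o, 'a, 'b, 'k::field) two_cat" and D :: "('p, 'c, 'd, 'k) two_cat"
    and F0 :: "'o \<Rightarrow> 'p" and F1 :: "'a \<Rightarrow> 'c" and F2 :: "'b \<Rightarrow> 'd" +
  assumes bij_obj: "bij_betw F0 (Obj C) (Obj D)"
    and bij_mor1: "bij_betw F1 (Mor1 C) (Mor1 D)"
    and bij_mor2: "bij_betw F2 (Mor2 C) (Mor2 D)"


section \<open>Cartan data, scalars and bubble parameters\<close>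

text \<open>
  The weight lattice is the whole type \<open>'x\<close> and the index set the whole type \<open>'i\<close>.
  The form is rational-valued: for the usual weight lattices the pairing
  of two fundamental weights need not be an integer.
\<close>

record ('i, 'x) cartan_data =
  simple_root :: "'i \<Rightarrow> 'x"
  fund_weight :: "'i \<Rightarrow> 'x"
  coroot :: "'i \<Rightarrow> 'x \<Rightarrow> int"
  form :: "'x \<Rightarrow> 'x \<Rightarrow> rat"

definition free_Z_module :: "'x::ab_group_add itself \<Rightarrow> bool" where
  "free_Z_module _ \<longleftrightarrow> (\<exists>scl :: int \<Rightarrow> 'x \<Rightarrow> 'x. module scl \<and>
     (\<exists>B. \<not> module.dependent scl B \<and> module.span scl B = UNIV))"

definition simply_laced_datum :: "('i, 'x::ab_group_add) cartan_data \<Rightarrow> bool" where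
  "simply_laced_datum D \<longleftrightarrow>
     free_Z_module TYPE('x) \<and>
     (\<forall>i \<mu> \<nu>. coroot D i (\<mu> + \<nu>) = coroot D i \<mu> + coroot D i \<nu>) \<and>
     (\<forall>\<mu> \<nu> \<rho>. form D (\<mu> + \<nu>) \<rho> = form D \<mu> \<rho> + form D \<nu> \<rho>) \<and>
     (\<forall>\<mu> \<nu> \<rho>. form D \<mu> (\<nu> + \<rho>) = form D \<mu> \<nu> + form D \<mu> \<rho>) \<and>
     (\<forall>i j. form D (simple_root D i) (simple_root D j) =
            form D (simple_root D j) (simple_root D i)) \<and>
     (\<forall>i. form D (simple_root D i) (simple_root D i) = 2) \<and>
     (\<forall>i j. i \<noteq> j \<longrightarrow> form D (simple_root D i) (simple_root D j) \<in> {0, - 1}) \<and>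
     (\<forall>i \<mu>. of_int (coroot D i \<mu>) = form D (simple_root D i) \<mu>) \<and>
     (\<forall>i j. coroot D j (fund_weight D i) = (if i = j then 1 else 0))"

text \<open>
  The entry \<open>a\<^sub>i\<^sub>j\<close> of the Cartan matrix, which is also the value \<open>i \<cdot> j\<close> of the form.
\<close>

definition cartan :: "('i, 'x) cartan_data \<Rightarrow> 'i \<Rightarrow> 'i \<Rightarrow> int" where
  "cartan D i j = coroot D i (simple_root D j)"

text \<open>Only the values of the scalars at distinct indices are used; the diagonal is irrelevant.\<close>

definition choice_of_scalars ::
  "('i, 'x) cartan_data \<Rightarrow> ('i \<Rightarrow> 'i \<Rightarrow> 'k::field) \<Rightarrow> bool" where
  "choice_of_scalars D t \<longleftrightarrow>
     (\<forall>i j. i \<noteq> j \<longrightarrow> t i j \<noteq> 0) \<and>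
     (\<forall>i j. i \<noteq> j \<longrightarrow> cartan D i j = 0 \<longrightarrow> t i j = t j i)"

record ('i, 'x, 'k) bubble_params =
  beta :: "'i \<Rightarrow> 'k"
  cplus :: "'i \<Rightarrow> 'x \<Rightarrow> 'k"
  cminus :: "'i \<Rightarrow> 'x \<Rightarrow> 'k"

definition full_scalars ::
  "('i \<Rightarrow> 'i \<Rightarrow> 'k::field) \<Rightarrow> ('i, 'x, 'k) bubble_params \<Rightarrow> 'i \<Rightarrow> 'i \<Rightarrow> 'k" where
  "full_scalars t P i j = (if i = j then - beta P i else t i j)"

definition compatible ::
  "('i, 'x::ab_group_add) cartan_data \<Rightarrow> ('i \<Rightarrow> 'i \<Rightarrow> 'k::field) \<Rightarrow>
   ('i, 'x, 'k) bubble_params \<Rightarrow> bool" where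
  "compatible D t P \<longleftrightarrow>
     (\<forall>i. beta P i \<noteq> 0) \<and>
     (\<forall>i \<mu>. cplus P i \<mu> \<noteq> 0 \<and> cminus P i \<mu> \<noteq> 0) \<and>
     (\<forall>i \<mu>. cplus P i \<mu> * cminus P i \<mu> = - 1 / beta P i) \<and>
     (\<forall>i j \<mu>. cplus P i (\<mu> + simple_root D j) = full_scalars t P i j * cplus P i \<mu>) \<and>
     (\<forall>i j \<mu>. cminus P i (\<mu> - simple_root D j) = full_scalars t P i j * cminus P i \<mu>)"

definition cyclic_params :: "('i \<Rightarrow> 'x \<Rightarrow> 'k::field) \<Rightarrow> ('i, 'x, 'k) bubble_params" where
  "cyclic_params c = \<lparr>beta = (\<lambda>i. - 1), cplus = c, cminus = (\<lambda>i \<mu>. inverse (c i \<mu>))\<rparr>"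


section \<open>Formal 2-morphisms between composites of the generating 1-morphisms\<close>

text \<open>
  The list \<open>[\<E> i, \<F> j, \<dots>]\<close>, together with a weight \<open>\<mu>\<close>, stands for the
  composite \<open>\<E>\<^sub>i \<F>\<^sub>j \<dots> \<one>\<^sub>\<mu>\<close>, so the last letter is applied first.
\<close>

datatype 'i letter = \<E> 'i | \<F> 'i

type_synonym 'i word = "'i letter list"

text \<open>The weight argument of a generator is the weight at the right of its source.\<close>

datatype ('i, 'x) generator =
  Dot 'i 'x           \<comment> \<open>\<open>x\<close>: \<open>\<E>\<^sub>i \<rightarrow> \<E>\<^sub>i\<close>\<close>
| Crossing 'i 'i 'x   \<comment> \<open>\<open>\<psi>\<close>: \<open>\<E>\<^sub>i \<E>\<^sub>j \<rightarrow> \<E>\<^sub>j \<E>\<^sub>i\<close>\<close>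
| Cup 'i 'x           \<comment> \<open>\<open>\<eta>\<close>: \<open>\<one> \<rightarrow> \<F>\<^sub>i \<E>\<^sub>i\<close>\<close>
| Cup' 'i 'x          \<comment> \<open>\<open>\<eta>'\<close>: \<open>\<one> \<rightarrow> \<E>\<^sub>i \<F>\<^sub>i\<close>\<close>
| Cap 'i 'x           \<comment> \<open>\<open>\<epsilon>\<close>: \<open>\<E>\<^sub>i \<F>\<^sub>i \<rightarrow> \<one>\<close>\<close>
| Cap' 'i 'x          \<comment> \<open>\<open>\<epsilon>'\<close>: \<open>\<F>\<^sub>i \<E>\<^sub>i \<rightarrow> \<one>\<close>\<close>

primrec gen_weight :: "('i, 'x) generator \<Rightarrow> 'x" where
  "gen_weight (Dot i \<mu>) = \<mu>"
| "gen_weight (Crossing i j \<mu>) = \<mu>"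
| "gen_weight (Cup i \<mu>) = \<mu>"
| "gen_weight (Cup' i \<mu>) = \<mu>"
| "gen_weight (Cap i \<mu>) = \<mu>"
| "gen_weight (Cap' i \<mu>) = \<mu>"

primrec gen_dom :: "('i, 'x) generator \<Rightarrow> 'i word" where
  "gen_dom (Dot i \<mu>) = [\<E> i]"
| "gen_dom (Crossing i j \<mu>) = [\<E> i, \<E> j]"
| "gen_dom (Cup i \<mu>) = []"
| "gen_dom (Cup' i \<mu>) = []"
| "gen_dom (Cap i \<mu>) = [\<E> i, \<F> i]"
| "gen_dom (Cap' i \<mu>) = [\<F> i, \<E> i]"

primrec gen_cod :: "('i, 'x) generator \<Rightarrow> 'i word" where
  "gen_cod (Dot i \<mu>) = [\<E> i]"
| "gen_cod (Crossing i j \<mu>) = [\<E> j, \<E> i]"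
| "gen_cod (Cup i \<mu>) = [\<F> i, \<E> i]"
| "gen_cod (Cup' i \<mu>) = [\<E> i, \<F> i]"
| "gen_cod (Cap i \<mu>) = []"
| "gen_cod (Cap' i \<mu>) = []"

primrec gen_deg :: "('i, 'x) cartan_data \<Rightarrow> ('i, 'x) generator \<Rightarrow> int" where
  "gen_deg D (Dot i \<mu>) = 2"
| "gen_deg D (Crossing i j \<mu>) = - cartan D i j"
| "gen_deg D (Cup i \<mu>) = 1 + coroot D i \<mu>"
| "gen_deg D (Cup' i \<mu>) = 1 - coroot D i \<mu>"
| "gen_deg D (Cap i \<mu>) = 1 - coroot D i \<mu>"
| "gen_deg D (Cap' i \<mu>) = 1 + coroot D i \<mu>"

text \<open>
  Formal expressions for homogeneous 2-morphisms between composites without shifts.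
  \<open>Ident \<mu> W\<close> is the identity of \<open>W \<one>\<^sub>\<mu>\<close> and \<open>Zer \<mu> W V d\<close> the zero 2-morphism
  \<open>W \<one>\<^sub>\<mu> \<rightarrow> V \<one>\<^sub>\<mu>\<close> of degree \<open>d\<close>; \<open>f \<circ>\<^sub>v g\<close> is vertical composition (first \<open>g\<close>) and \<open>HC f g\<close> is
  horizontal composition with \<open>f\<close> on the left.
\<close>

datatype ('i, 'x, 'k) tm =
  Ident 'x "'i word"
| Gen "('i, 'x) generator"
| VC "('i, 'x, 'k) tm" "('i, 'x, 'k) tm"  (infixr \<open>\<circ>\<^sub>v\<close> 70)
| HC "('i, 'x, 'k) tm" "('i, 'x, 'k) tm"
| Zer 'x "'i word" "'i word" int
| Add "('i, 'x, 'k) tm" "('i, 'x, 'k) tm"  (infixl \<open>+\<^sub>v\<close> 65)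
| Smul 'k "('i, 'x, 'k) tm"  (infixr \<open>\<cdot>\<^sub>v\<close> 68)

primrec tm_src :: "('i, 'x, 'k) tm \<Rightarrow> 'x" where
  "tm_src (Ident \<mu> W) = \<mu>"
| "tm_src (Gen g) = gen_weight g"
| "tm_src (f \<circ>\<^sub>v g) = tm_src g"
| "tm_src (HC f g) = tm_src g"
| "tm_src (Zer \<mu> W V d) = \<mu>"
| "tm_src (f +\<^sub>v g) = tm_src f"
| "tm_src (a \<cdot>\<^sub>v f) = tm_src f"

primrec tm_dom :: "('i, 'x, 'k) tm \<Rightarrow> 'i word" where
  "tm_dom (Ident \<mu> W) = W"
| "tm_dom (Gen g) = gen_dom g"
| "tm_dom (f \<circ>\<^sub>v g) = tm_dom g"
| "tm_dom (HC f g) = tm_dom f @ tm_dom g"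
| "tm_dom (Zer \<mu> W V d) = W"
| "tm_dom (f +\<^sub>v g) = tm_dom f"
| "tm_dom (a \<cdot>\<^sub>v f) = tm_dom f"

primrec tm_cod :: "('i, 'x, 'k) tm \<Rightarrow> 'i word" where
  "tm_cod (Ident \<mu> W) = W"
| "tm_cod (Gen g) = gen_cod g"
| "tm_cod (f \<circ>\<^sub>v g) = tm_cod f"
| "tm_cod (HC f g) = tm_cod f @ tm_cod g"
| "tm_cod (Zer \<mu> W V d) = V"
| "tm_cod (f +\<^sub>v g) = tm_cod f"
| "tm_cod (a \<cdot>\<^sub>v f) = tm_cod f"

context
  fixes D :: "('i, 'x::ab_group_add) cartan_data"
begin

primrec tm_deg :: "('i, 'x, 'k) tm \<Rightarrow> int" where
  "tm_deg (Ident \<mu> W) = 0"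
| "tm_deg (Gen g) = gen_deg D g"
| "tm_deg (f \<circ>\<^sub>v g) = tm_deg f + tm_deg g"
| "tm_deg (HC f g) = tm_deg f + tm_deg g"
| "tm_deg (Zer \<mu> W V d) = d"
| "tm_deg (f +\<^sub>v g) = tm_deg f"
| "tm_deg (a \<cdot>\<^sub>v f) = tm_deg f"

primrec letter_weight :: "'i letter \<Rightarrow> 'x" where
  "letter_weight (\<E> i) = simple_root D i"
| "letter_weight (\<F> i) = - simple_root D i"

definition word_weight :: "'i word \<Rightarrow> 'x" where
  "word_weight W = sum_list (map letter_weight W)"

definition tm_tgt :: "('i, 'x, 'k) tm \<Rightarrow> 'x" where
  "tm_tgt f = tm_src f + word_weight (tm_dom f)"

definition parallel :: "('i, 'x, 'k) tm \<Rightarrow> ('i, 'x, 'k) tm \<Rightarrow> bool" where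
  "parallel f g \<longleftrightarrow> 
     tm_src f = tm_src g \<and> tm_dom f = tm_dom g \<and> tm_cod f = tm_cod g \<and> tm_deg f = tm_deg g"

primrec wf_tm :: "('i, 'x, 'k) tm \<Rightarrow> bool" where
  "wf_tm (Ident \<mu> W) \<longleftrightarrow> True"
| "wf_tm (Gen g) \<longleftrightarrow> True"
| "wf_tm (f \<circ>\<^sub>v g) \<longleftrightarrow> wf_tm f \<and> wf_tm g \<and> tm_src f = tm_src g \<and> tm_dom f = tm_cod g"
| "wf_tm (HC f g) \<longleftrightarrow> wf_tm f \<and> wf_tm g \<and> tm_src f = tm_tgt g"
| "wf_tm (Zer \<mu> W V d) \<longleftrightarrow> word_weight W = word_weight V"
| "wf_tm (f +\<^sub>v g) \<longleftrightarrow> wf_tm f \<and> wf_tm g \<and> parallel f g"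
| "wf_tm (a \<cdot>\<^sub>v f) \<longleftrightarrow> wf_tm f"

definition zer :: "('i, 'x, 'k) tm \<Rightarrow> ('i, 'x, 'k) tm" where
  "zer f = Zer (tm_src f) (tm_dom f) (tm_cod f) (tm_deg f)"

text \<open>The 2-morphism \<open>U f V\<close>, with the weights of the two identities determined by \<open>f\<close>.\<close>

definition whisker :: "'i word \<Rightarrow> ('i, 'x, 'k) tm \<Rightarrow> 'i word \<Rightarrow> ('i, 'x, 'k) tm" where
  "whisker U f V = HC (Ident (tm_tgt f) U) (HC f (Ident (tm_src f - word_weight V) V))"

abbreviation diff_tm :: "('i, 'x, 'k::field) tm \<Rightarrow> ('i, 'x, 'k) tm \<Rightarrow> ('i, 'x, 'k) tm"
  (infixl \<open>-\<^sub>v\<close> 65) where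
  "f -\<^sub>v g \<equiv> f +\<^sub>v ((- 1) \<cdot>\<^sub>v g)"

text \<open>The first argument is the value of the empty sum, which records the type.\<close>

definition sum_tm :: "('i, 'x, 'k) tm \<Rightarrow> ('i, 'x, 'k) tm list \<Rightarrow> ('i, 'x, 'k) tm" where
  "sum_tm z fs = foldr Add fs z"

abbreviation "dot i \<mu> \<equiv> Gen (Dot i \<mu>)"
abbreviation "crossing i j \<mu> \<equiv> Gen (Crossing i j \<mu>)"
abbreviation "cup i \<mu> \<equiv> Gen (Cup i \<mu>)"
abbreviation "cup' i \<mu> \<equiv> Gen (Cup' i \<mu>)"
abbreviation "cap i \<mu> \<equiv> Gen (Cap i \<mu>)"
abbreviation "cap' i \<mu> \<equiv> Gen (Cap' i \<mu>)"
abbreviation rt :: "'i \<Rightarrow> 'x" where "rt i \<equiv> simple_root D i"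

primrec dots :: "'i \<Rightarrow> 'x \<Rightarrow> nat \<Rightarrow> ('i, 'x, 'k) tm" where
  "dots i \<mu> 0 = Ident \<mu> [\<E> i]"
| "dots i \<mu> (Suc m) = dot i \<mu> \<circ>\<^sub>v dots i \<mu> m"

text \<open>Sideways crossings \<open>\<E>\<^sub>i \<F>\<^sub>j \<one>\<^sub>\<mu> \<rightarrow> \<F>\<^sub>j \<E>\<^sub>i \<one>\<^sub>\<mu>\<close> and \<open>\<F>\<^sub>i \<E>\<^sub>j \<one>\<^sub>\<mu> \<rightarrow> \<E>\<^sub>j \<F>\<^sub>i \<one>\<^sub>\<mu>\<close>.\<close>

definition sigma :: "'i \<Rightarrow> 'i \<Rightarrow> 'x \<Rightarrow> ('i, 'x, 'k) tm" where
  "sigma i j \<mu> =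
     whisker [\<F> j, \<E> i] (cap j \<mu>) [] \<circ>\<^sub>v
     whisker [\<F> j] (crossing j i (\<mu> - rt j)) [\<F> j] \<circ>\<^sub>v
     whisker [] (cup j (\<mu> + rt i - rt j)) [\<E> i, \<F> j]"

definition sigma' :: "'i \<Rightarrow> 'i \<Rightarrow> 'x \<Rightarrow> ('i, 'x, 'k) tm" where
  "sigma' i j \<mu> =
     whisker [] (cap' i (\<mu> - rt i + rt j)) [\<E> j, \<F> i] \<circ>\<^sub>v
     whisker [\<F> i] (crossing j i (\<mu> - rt i)) [\<F> i] \<circ>\<^sub>v
     whisker [\<F> i, \<E> j] (cup' i \<mu>) []"

text \<open>Clockwise and counterclockwise bubbles with \<open>m\<close> dots.\<close>

definition cw_real :: "'i \<Rightarrow> 'x \<Rightarrow> nat \<Rightarrow> ('i, 'x, 'k) tm" where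
  "cw_real i \<mu> m = cap i \<mu> \<circ>\<^sub>v whisker [] (dots i (\<mu> - rt i) m) [\<F> i] \<circ>\<^sub>v cup' i \<mu>"

definition ccw_real :: "'i \<Rightarrow> 'x \<Rightarrow> nat \<Rightarrow> ('i, 'x, 'k) tm" where
  "ccw_real i \<mu> m = cap' i \<mu> \<circ>\<^sub>v whisker [\<F> i] (dots i \<mu> m) [] \<circ>\<^sub>v cup i \<mu>"

end

section \<open>The defining relations\<close>

context
  fixes D :: "('i, 'x::ab_group_add) cartan_data"
    and t :: "'i \<Rightarrow> 'i \<Rightarrow> 'k::field"
    and P :: "('i, 'x, 'k) bubble_params"
begin

text \<open>
  Fake bubbles, indexed by half their degree: \<open>cw_fake i \<mu> j\<close> is the clockwise bubble with
  \<open>\<mu>\<^sub>i - 1 + j\<close> dots.  It is only used if this number is negative; then every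
  counterclockwise bubble on the right-hand side is real.  Likewise for \<open>ccw_fake\<close>.
\<close>

fun cw_fake :: "'i \<Rightarrow> 'x \<Rightarrow> nat \<Rightarrow> ('i, 'x, 'k) tm" where
  "cw_fake i \<mu> j =
     (if j = 0 then cplus P i \<mu> \<cdot>\<^sub>v Ident \<mu> []
      else (- 1 / cminus P i \<mu>) \<cdot>\<^sub>v sum_tm (Zer \<mu> [] [] (2 * int j))
        (map (\<lambda>y. cw_fake i \<mu> (j - y) \<circ>\<^sub>v ccw_real D i \<mu> (nat (- coroot D i \<mu> - 1 + int y)))
          [1..<Suc j]))"

fun ccw_fake :: "'i \<Rightarrow> 'x \<Rightarrow> nat \<Rightarrow> ('i, 'x, 'k) tm" where
  "ccw_fake i \<mu> j =
     (if j = 0 then cminus P i \<mu> \<cdot>\<^sub>v Ident \<mu> []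
      else (- 1 / cplus P i \<mu>) \<cdot>\<^sub>v sum_tm (Zer \<mu> [] [] (2 * int j))
        (map (\<lambda>x. cw_real D i \<mu> (nat (coroot D i \<mu> - 1 + int x)) \<circ>\<^sub>v ccw_fake i \<mu> (j - x))
          [1..<Suc j]))"

declare cw_fake.simps [simp del] ccw_fake.simps [simp del]

text \<open>The bubbles with \<open>\<mu>\<^sub>i - 1 + j\<close>, respectively \<open>- \<mu>\<^sub>i - 1 + j\<close>, dots, real or fake.\<close>

definition cw :: "'i \<Rightarrow> 'x \<Rightarrow> nat \<Rightarrow> ('i, 'x, 'k) tm" where
  "cw i \<mu> j = (let m = coroot D i \<mu> - 1 + int j in
     if m \<ge> 0 then cw_real D i \<mu> (nat m) else cw_fake i \<mu> j)"

definition ccw :: "'i \<Rightarrow> 'x \<Rightarrow> nat \<Rightarrow> ('i, 'x, 'k) tm" where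
  "ccw i \<mu> j = (let m = - coroot D i \<mu> - 1 + int j in
     if m \<ge> 0 then ccw_real D i \<mu> (nat m) else ccw_fake i \<mu> j)"

text \<open>The triples of natural numbers with sum \<open>n - 1\<close>; there are none if \<open>n \<le> 0\<close>.\<close>

definition triples :: "int \<Rightarrow> (nat \<times> nat \<times> nat) list" where
  "triples n = [(f1, f2, f3). f1 \<leftarrow> [0..<nat n], f2 \<leftarrow> [0..<nat n], f3 \<leftarrow> [0..<nat n],
     int f1 + int f2 + int f3 = n - 1]"

inductive relation :: "('i, 'x, 'k) tm \<Rightarrow> ('i, 'x, 'k) tm \<Rightarrow> bool" where
  biadj_E_left: "relation
     (whisker D [] (cap i (\<mu> + rt D i)) [\<E> i] \<circ>\<^sub>v whisker D [\<E> i] (cup i \<mu>) [])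
     (Ident \<mu> [\<E> i])"
| biadj_E_right: "relation
     (whisker D [\<E> i] (cap' i \<mu>) [] \<circ>\<^sub>v whisker D [] (cup' i (\<mu> + rt D i)) [\<E> i])
     (Ident \<mu> [\<E> i])"
| biadj_F_left: "relation
     (whisker D [\<F> i] (cap i (\<mu> + rt D i)) [] \<circ>\<^sub>v whisker D [] (cup i \<mu>) [\<F> i])
     (Ident (\<mu> + rt D i) [\<F> i])"
| biadj_F_right: "relation
     (whisker D [] (cap' i \<mu>) [\<F> i] \<circ>\<^sub>v whisker D [\<F> i] (cup' i (\<mu> + rt D i)) [])
     (Ident (\<mu> + rt D i) [\<F> i])"

| cyclic_dot: "relation
     (whisker D [] (cap' i \<mu>) [\<F> i] \<circ>\<^sub>v
      whisker D [\<F> i] (dot i \<mu>) [\<F> i] \<circ>\<^sub>v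
      whisker D [\<F> i] (cup' i (\<mu> + rt D i)) [])
     (whisker D [\<F> i] (cap i (\<mu> + rt D i)) [] \<circ>\<^sub>v
      whisker D [\<F> i] (dot i \<mu>) [\<F> i] \<circ>\<^sub>v
      whisker D [] (cup i \<mu>) [\<F> i])"
| cyclic_crossing: "relation
     (whisker D [\<F> j, \<F> i] (cap j \<mu>) [] \<circ>\<^sub>v
      whisker D [\<F> j, \<F> i, \<E> j] (cap i (\<mu> - rt D j)) [\<F> j] \<circ>\<^sub>v
      whisker D [\<F> j, \<F> i] (crossing i j (\<mu> - rt D i - rt D j)) [\<F> i, \<F> j] \<circ>\<^sub>v
      whisker D [\<F> j] (cup i (\<mu> - rt D i)) [\<E> j, \<F> i, \<F> j] \<circ>\<^sub>v
      whisker D [] (cup j (\<mu> - rt D i - rt D j)) [\<F> i, \<F> j])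
     (whisker D [] (cap' i (\<mu> - rt D i - rt D j)) [\<F> j, \<F> i] \<circ>\<^sub>v
      whisker D [\<F> i] (cap' j (\<mu> - rt D j)) [\<E> i, \<F> j, \<F> i] \<circ>\<^sub>v
      whisker D [\<F> i, \<F> j] (crossing i j (\<mu> - rt D i - rt D j)) [\<F> j, \<F> i] \<circ>\<^sub>v
      whisker D [\<F> i, \<F> j, \<E> i] (cup' j (\<mu> - rt D i)) [\<F> i] \<circ>\<^sub>v
      whisker D [\<F> i, \<F> j] (cup' i \<mu>) [])"

| klr_quadratic_same: "relation
     (crossing i i \<mu> \<circ>\<^sub>v crossing i i \<mu>)
     (zer D (crossing i i \<mu> \<circ>\<^sub>v crossing i i \<mu>))"
| klr_quadratic_orthogonal: "i \<noteq> j \<Longrightarrow> cartan D i j = 0 \<Longrightarrow> relation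
     (crossing j i \<mu> \<circ>\<^sub>v crossing i j \<mu>)
     (t i j \<cdot>\<^sub>v Ident \<mu> [\<E> i, \<E> j])"
| klr_quadratic_adjacent: "i \<noteq> j \<Longrightarrow> cartan D i j = - 1 \<Longrightarrow> relation
     (crossing j i \<mu> \<circ>\<^sub>v crossing i j \<mu>)
     (t i j \<cdot>\<^sub>v whisker D [] (dot i (\<mu> + rt D j)) [\<E> j] +\<^sub>v
      t j i \<cdot>\<^sub>v whisker D [\<E> i] (dot j \<mu>) [])"

| nilhecke_left: "relation
     (crossing i i \<mu> \<circ>\<^sub>v whisker D [] (dot i (\<mu> + rt D i)) [\<E> i] -\<^sub>v
      whisker D [\<E> i] (dot i \<mu>) [] \<circ>\<^sub>v crossing i i \<mu>)
     (Ident \<mu> [\<E> i, \<E> i])"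
| nilhecke_right: "relation
     (whisker D [] (dot i (\<mu> + rt D i)) [\<E> i] \<circ>\<^sub>v crossing i i \<mu> -\<^sub>v
      crossing i i \<mu> \<circ>\<^sub>v whisker D [\<E> i] (dot i \<mu>) [])
     (Ident \<mu> [\<E> i, \<E> i])"
| dot_slide_left: "i \<noteq> j \<Longrightarrow> relation
     (crossing i j \<mu> \<circ>\<^sub>v whisker D [] (dot i (\<mu> + rt D j)) [\<E> j])
     (whisker D [\<E> j] (dot i \<mu>) [] \<circ>\<^sub>v crossing i j \<mu>)"
| dot_slide_right: "i \<noteq> j \<Longrightarrow> relation
     (whisker D [] (dot j (\<mu> + rt D i)) [\<E> i] \<circ>\<^sub>v crossing i j \<mu>)
     (crossing i j \<mu> \<circ>\<^sub>v whisker D [\<E> i] (dot j \<mu>) [])"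

| klr_cubic: "lhs =
     whisker D [] (crossing j k (\<mu> + rt D i)) [\<E> i] \<circ>\<^sub>v
     whisker D [\<E> j] (crossing i k \<mu>) [] \<circ>\<^sub>v
     whisker D [] (crossing i j (\<mu> + rt D k)) [\<E> k] -\<^sub>v
     whisker D [\<E> k] (crossing i j \<mu>) [] \<circ>\<^sub>v
     whisker D [] (crossing i k (\<mu> + rt D j)) [\<E> j] \<circ>\<^sub>v
     whisker D [\<E> i] (crossing j k \<mu>) [] \<Longrightarrow>
   relation lhs
     (if i = k \<and> cartan D i j = - 1 then t i j \<cdot>\<^sub>v Ident \<mu> [\<E> i, \<E> j, \<E> k] else zer D lhs)"

| mixed_FE: "i \<noteq> j \<Longrightarrow> relation
     (sigma D i j \<mu> \<circ>\<^sub>v sigma' D j i \<mu>) (Ident \<mu> [\<F> j, \<E> i])"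
| mixed_EF: "i \<noteq> j \<Longrightarrow> relation
     (sigma' D j i \<mu> \<circ>\<^sub>v sigma D i j \<mu>) (Ident \<mu> [\<E> i, \<F> j])"

| cw_bubble_zero: "int m < coroot D i \<mu> - 1 \<Longrightarrow> relation
     (cw_real D i \<mu> m) (zer D (cw_real D i \<mu> m))"
| ccw_bubble_zero: "int m < - coroot D i \<mu> - 1 \<Longrightarrow> relation
     (ccw_real D i \<mu> m) (zer D (ccw_real D i \<mu> m))"
| cw_bubble_degree_zero: "int m = coroot D i \<mu> - 1 \<Longrightarrow> relation
     (cw_real D i \<mu> m) (cplus P i \<mu> \<cdot>\<^sub>v Ident \<mu> [])"
| ccw_bubble_degree_zero: "int m = - coroot D i \<mu> - 1 \<Longrightarrow> relation
     (ccw_real D i \<mu> m) (cminus P i \<mu> \<cdot>\<^sub>v Ident \<mu> [])"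

| sl2_EF: "relation
     (Ident \<mu> [\<E> i, \<F> i])
     (beta P i \<cdot>\<^sub>v (sigma' D i i \<mu> \<circ>\<^sub>v sigma D i i \<mu>) -\<^sub>v
      beta P i \<cdot>\<^sub>v sum_tm (Zer \<mu> [\<E> i, \<F> i] [\<E> i, \<F> i] 0)
        (map (\<lambda>(f1, f2, f3).
           whisker D [] (dots i (\<mu> - rt D i) f3) [\<F> i] \<circ>\<^sub>v cup' i \<mu> \<circ>\<^sub>v
           ccw i \<mu> f2 \<circ>\<^sub>v
           cap i \<mu> \<circ>\<^sub>v whisker D [] (dots i (\<mu> - rt D i) f1) [\<F> i])
         (triples (coroot D i \<mu>))))"
| sl2_FE: "relation
     (Ident \<mu> [\<F> i, \<E> i])
     (beta P i \<cdot>\<^sub>v (sigma D i i \<mu> \<circ>\<^sub>v sigma' D i i \<mu>) -\<^sub>v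
      beta P i \<cdot>\<^sub>v sum_tm (Zer \<mu> [\<F> i, \<E> i] [\<F> i, \<E> i] 0)
        (map (\<lambda>(f1, f2, f3).
           whisker D [\<F> i] (dots i \<mu> f3) [] \<circ>\<^sub>v cup i \<mu> \<circ>\<^sub>v
           cw i \<mu> f2 \<circ>\<^sub>v
           cap' i \<mu> \<circ>\<^sub>v whisker D [\<F> i] (dots i \<mu> f1) [])
         (triples (- coroot D i \<mu>))))"

text \<open>
  Equality of 2-morphisms: the congruence generated by the relations and the axioms of a
  linear strict 2-category.  For a simply-laced datum the last three assumptions of \<open>rel\<close>
  always hold; see \<open>relation_wf\<close> below.
\<close>

inductive eqv :: "('i, 'x, 'k) tm \<Rightarrow> ('i, 'x, 'k) tm \<Rightarrow> bool" (infix \<open>\<approx>\<close> 50) where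
  refl: "wf_tm D f \<Longrightarrow> f \<approx> f"
| sym: "f \<approx> g \<Longrightarrow> g \<approx> f"
| trans: "f \<approx> g \<Longrightarrow> g \<approx> h \<Longrightarrow> f \<approx> h"
| cong_vc: "f \<approx> f' \<Longrightarrow> g \<approx> g' \<Longrightarrow> wf_tm D (f \<circ>\<^sub>v g) \<Longrightarrow> f \<circ>\<^sub>v g \<approx> f' \<circ>\<^sub>v g'"
| cong_hc: "f \<approx> f' \<Longrightarrow> g \<approx> g' \<Longrightarrow> wf_tm D (HC f g) \<Longrightarrow> HC f g \<approx> HC f' g'"
| cong_add: "f \<approx> f' \<Longrightarrow> g \<approx> g' \<Longrightarrow> wf_tm D (f +\<^sub>v g) \<Longrightarrow> f +\<^sub>v g \<approx> f' +\<^sub>v g'"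
| cong_smul: "f \<approx> f' \<Longrightarrow> a \<cdot>\<^sub>v f \<approx> a \<cdot>\<^sub>v f'"
| vc_assoc: "wf_tm D ((f \<circ>\<^sub>v g) \<circ>\<^sub>v h) \<Longrightarrow> (f \<circ>\<^sub>v g) \<circ>\<^sub>v h \<approx> f \<circ>\<^sub>v (g \<circ>\<^sub>v h)"
| vc_id_left: "wf_tm D f \<Longrightarrow> Ident (tm_src f) (tm_cod f) \<circ>\<^sub>v f \<approx> f"
| vc_id_right: "wf_tm D f \<Longrightarrow> f \<circ>\<^sub>v Ident (tm_src f) (tm_dom f) \<approx> f"
| hc_assoc: "wf_tm D (HC (HC f g) h) \<Longrightarrow> HC (HC f g) h \<approx> HC f (HC g h)"
| hc_id_left: "wf_tm D f \<Longrightarrow> HC (Ident (tm_tgt D f) []) f \<approx> f"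
| hc_id_right: "wf_tm D f \<Longrightarrow> HC f (Ident (tm_src f) []) \<approx> f"
| hc_id: "HC (Ident (\<mu> + word_weight D V) W) (Ident \<mu> V) \<approx> Ident \<mu> (W @ V)"
| interchange: "wf_tm D (HC (f \<circ>\<^sub>v f') (g \<circ>\<^sub>v g')) \<Longrightarrow>
    HC (f \<circ>\<^sub>v f') (g \<circ>\<^sub>v g') \<approx> HC f g \<circ>\<^sub>v HC f' g'"
| add_assoc: "wf_tm D (f +\<^sub>v g +\<^sub>v h) \<Longrightarrow> f +\<^sub>v g +\<^sub>v h \<approx> f +\<^sub>v (g +\<^sub>v h)"
| add_comm: "wf_tm D (f +\<^sub>v g) \<Longrightarrow> f +\<^sub>v g \<approx> g +\<^sub>v f"
| add_zero: "wf_tm D f \<Longrightarrow> f +\<^sub>v zer D f \<approx> f"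
| add_neg: "wf_tm D f \<Longrightarrow> f -\<^sub>v f \<approx> zer D f"
| smul_add: "wf_tm D (f +\<^sub>v g) \<Longrightarrow> a \<cdot>\<^sub>v (f +\<^sub>v g) \<approx> a \<cdot>\<^sub>v f +\<^sub>v a \<cdot>\<^sub>v g"
| smul_plus: "wf_tm D f \<Longrightarrow> (a + b) \<cdot>\<^sub>v f \<approx> a \<cdot>\<^sub>v f +\<^sub>v b \<cdot>\<^sub>v f"
| smul_times: "wf_tm D f \<Longrightarrow> (a * b) \<cdot>\<^sub>v f \<approx> a \<cdot>\<^sub>v b \<cdot>\<^sub>v f"
| smul_one: "wf_tm D f \<Longrightarrow> 1 \<cdot>\<^sub>v f \<approx> f"
| vc_add_left: "wf_tm D ((f +\<^sub>v g) \<circ>\<^sub>v h) \<Longrightarrow> (f +\<^sub>v g) \<circ>\<^sub>v h \<approx> (f \<circ>\<^sub>v h) +\<^sub>v (g \<circ>\<^sub>v h)"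
| vc_add_right: "wf_tm D (f \<circ>\<^sub>v (g +\<^sub>v h)) \<Longrightarrow> f \<circ>\<^sub>v (g +\<^sub>v h) \<approx> (f \<circ>\<^sub>v g) +\<^sub>v (f \<circ>\<^sub>v h)"
| vc_smul_left: "wf_tm D (f \<circ>\<^sub>v g) \<Longrightarrow> (a \<cdot>\<^sub>v f) \<circ>\<^sub>v g \<approx> a \<cdot>\<^sub>v (f \<circ>\<^sub>v g)"
| vc_smul_right: "wf_tm D (f \<circ>\<^sub>v g) \<Longrightarrow> f \<circ>\<^sub>v (a \<cdot>\<^sub>v g) \<approx> a \<cdot>\<^sub>v (f \<circ>\<^sub>v g)"
| hc_add_left: "wf_tm D (HC (f +\<^sub>v g) h) \<Longrightarrow> HC (f +\<^sub>v g) h \<approx> HC f h +\<^sub>v HC g h"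
| hc_add_right: "wf_tm D (HC f (g +\<^sub>v h)) \<Longrightarrow> HC f (g +\<^sub>v h) \<approx> HC f g +\<^sub>v HC f h"
| hc_smul_left: "wf_tm D (HC f g) \<Longrightarrow> HC (a \<cdot>\<^sub>v f) g \<approx> a \<cdot>\<^sub>v HC f g"
| hc_smul_right: "wf_tm D (HC f g) \<Longrightarrow> HC f (a \<cdot>\<^sub>v g) \<approx> a \<cdot>\<^sub>v HC f g"
| rel: "relation f g \<Longrightarrow> wf_tm D f \<Longrightarrow> wf_tm D g \<Longrightarrow> parallel D f g \<Longrightarrow> f \<approx> g"

definition cls :: "('i, 'x, 'k) tm \<Rightarrow> ('i, 'x, 'k) tm set" where
  "cls f = {g. f \<approx> g}"

text \<open>The 2-morphisms \<open>W \<one>\<^sub>\<mu> \<rightarrow> V \<one>\<^sub>\<mu>\<close> of degree \<open>d\<close>.\<close>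

definition graded_hom :: "'x \<Rightarrow> 'i word \<Rightarrow> 'i word \<Rightarrow> int \<Rightarrow> ('i, 'x, 'k) tm set set" where
  "graded_hom \<mu> W V d =
     {f. wf_tm D f \<and> tm_src f = \<mu> \<and> tm_dom f = W \<and> tm_cod f = V \<and> tm_deg D f = d}
       // {(f, g). f \<approx> g}"

definition cls_vc :: "('i, 'x, 'k) tm set \<Rightarrow> ('i, 'x, 'k) tm set \<Rightarrow> ('i, 'x, 'k) tm set" where
  "cls_vc X Y = (\<Union>f\<in>X. \<Union>g\<in>Y. cls (f \<circ>\<^sub>v g))"

definition cls_hc :: "('i, 'x, 'k) tm set \<Rightarrow> ('i, 'x, 'k) tm set \<Rightarrow> ('i, 'x, 'k) tm set" where
  "cls_hc X Y = (\<Union>f\<in>X. \<Union>g\<in>Y. cls (HC f g))"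

definition cls_add :: "('i, 'x, 'k) tm set \<Rightarrow> ('i, 'x, 'k) tm set \<Rightarrow> ('i, 'x, 'k) tm set" where
  "cls_add X Y = (\<Union>f\<in>X. \<Union>g\<in>Y. cls (f +\<^sub>v g))"

definition cls_smul :: "'k \<Rightarrow> ('i, 'x, 'k) tm set \<Rightarrow> ('i, 'x, 'k) tm set" where
  "cls_smul a X = (\<Union>f\<in>X. cls (a \<cdot>\<^sub>v f))"

end


section \<open>The 2-category\<close>

text \<open>
  A 1-morphism \<open>\<mu> \<rightarrow> \<nu>\<close> is a formal direct sum of shifted composites \<open>W \<one>\<^sub>\<mu>\<langle>s\<rangle>\<close>, given
  as the list of the pairs \<open>(W, s)\<close>.  A 2-morphism is a matrix; its entry in row \<open>q\<close> and
  column \<open>p\<close> is a morphism \<open>W\<^sub>p \<one>\<^sub>\<mu>\<langle>s\<^sub>p\<rangle> \<rightarrow> V\<^sub>q \<one>\<^sub>\<mu>\<langle>t\<^sub>q\<rangle>\<close>, that is a 2-morphism \<open>W\<^sub>p \<one>\<^sub>\<mu> \<rightarrow> V\<^sub>q \<one>\<^sub>\<mu>\<close> of degree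
  \<open>t\<^sub>q - s\<^sub>p\<close>.  Entries outside the range are \<open>{}\<close>, which is no equivalence class.
\<close>

datatype ('i, 'x) one_cell =
  OneCell (src1: 'x) (tgt1: 'x) (summands: "('i word \<times> int) list")

datatype ('i, 'x, 'k) two_cell =
  TwoCell (dom2: "('i, 'x) one_cell") (cod2: "('i, 'x) one_cell")
    (entry: "nat \<Rightarrow> nat \<Rightarrow> ('i, 'x, 'k) tm set")

abbreviation size1 :: "('i, 'x) one_cell \<Rightarrow> nat" where
  "size1 A \<equiv> length (summands A)"

abbreviation summand_word :: "('i, 'x) one_cell \<Rightarrow> nat \<Rightarrow> 'i word" where
  "summand_word A p \<equiv> fst (summands A ! p)"

abbreviation summand_shift :: "('i, 'x) one_cell \<Rightarrow> nat \<Rightarrow> int" where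
  "summand_shift A p \<equiv> snd (summands A ! p)"

definition matrix_cell :: "('i, 'x) one_cell \<Rightarrow> ('i, 'x) one_cell \<Rightarrow>
    (nat \<Rightarrow> nat \<Rightarrow> ('i, 'x, 'k) tm set) \<Rightarrow> ('i, 'x, 'k) two_cell" where
  "matrix_cell A B m =
     TwoCell A B (\<lambda>q p. if q < size1 B \<and> p < size1 A then m q p else {})"

definition id_one_cell :: "'x \<Rightarrow> ('i, 'x) one_cell" where
  "id_one_cell \<mu> = OneCell \<mu> \<mu> [([], 0)]"

definition comp_one_cell :: "('i, 'x) one_cell \<Rightarrow> ('i, 'x) one_cell \<Rightarrow> ('i, 'x) one_cell" where
  "comp_one_cell A B = OneCell (src1 B) (tgt1 A)
     [(W @ V, s + r). (W, s) \<leftarrow> summands A, (V, r) \<leftarrow> summands B]"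

definition shift_one_cell :: "int \<Rightarrow> ('i, 'x) one_cell \<Rightarrow> ('i, 'x) one_cell" where
  "shift_one_cell n A = OneCell (src1 A) (tgt1 A) [(W, s + n). (W, s) \<leftarrow> summands A]"

context
  fixes D :: "('i, 'x::ab_group_add) cartan_data"
    and t :: "'i \<Rightarrow> 'i \<Rightarrow> 'k::field"
    and P :: "('i, 'x, 'k) bubble_params"
begin

definition one_cells :: "('i, 'x) one_cell set" where
  "one_cells = {A. \<forall>(W, s) \<in> set (summands A). src1 A + word_weight D W = tgt1 A}"

definition two_cells :: "('i, 'x, 'k) two_cell set" where
  "two_cells = {matrix_cell A B m | A B m.
     A \<in> one_cells \<and> B \<in> one_cells \<and> src1 A = src1 B \<and> tgt1 A = tgt1 B \<and>
     (\<forall>q < size1 B. \<forall>p < size1 A.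
        m q p \<in> graded_hom D t P (src1 A) (summand_word A p) (summand_word B q)
          (summand_shift B q - summand_shift A p))}"

definition zero_entry :: "('i, 'x) one_cell \<Rightarrow> ('i, 'x) one_cell \<Rightarrow> nat \<Rightarrow> nat \<Rightarrow>
    ('i, 'x, 'k) tm set" where
  "zero_entry A B q p = cls D t P (Zer (src1 A) (summand_word A p) (summand_word B q)
     (summand_shift B q - summand_shift A p))"

definition zero_two_cell :: "('i, 'x) one_cell \<Rightarrow> ('i, 'x) one_cell \<Rightarrow> ('i, 'x, 'k) two_cell"
  where "zero_two_cell A B = matrix_cell A B (zero_entry A B)"

definition id_two_cell :: "('i, 'x) one_cell \<Rightarrow> ('i, 'x, 'k) two_cell" where
  "id_two_cell A = matrix_cell A A (\<lambda>q p.
     if q = p then cls D t P (Ident (src1 A) (summand_word A p)) else zero_entry A A q p)"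

definition add_two_cell :: "('i, 'x, 'k) two_cell \<Rightarrow> ('i, 'x, 'k) two_cell \<Rightarrow>
    ('i, 'x, 'k) two_cell" where
  "add_two_cell M N = matrix_cell (dom2 M) (cod2 M)
     (\<lambda>q p. cls_add D t P (entry M q p) (entry N q p))"

definition smult_two_cell :: "'k \<Rightarrow> ('i, 'x, 'k) two_cell \<Rightarrow> ('i, 'x, 'k) two_cell" where
  "smult_two_cell a M = matrix_cell (dom2 M) (cod2 M) (\<lambda>q p. cls_smul D t P a (entry M q p))"

definition vcomp_two_cell :: "('i, 'x, 'k) two_cell \<Rightarrow> ('i, 'x, 'k) two_cell \<Rightarrow>
    ('i, 'x, 'k) two_cell" where
  "vcomp_two_cell M N = matrix_cell (dom2 N) (cod2 M) (\<lambda>q p.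
     foldr (cls_add D t P)
       (map (\<lambda>r. cls_vc D t P (entry M q r) (entry N r p)) [0..<size1 (cod2 N)])
       (zero_entry (dom2 N) (cod2 M) q p))"

text \<open>
  The summands of a composite are ordered lexicographically, as in \<^term>\<open>comp_one_cell\<close>.
\<close>

definition hcomp_two_cell :: "('i, 'x, 'k) two_cell \<Rightarrow> ('i, 'x, 'k) two_cell \<Rightarrow>
    ('i, 'x, 'k) two_cell" where
  "hcomp_two_cell M N =
     matrix_cell (comp_one_cell (dom2 M) (dom2 N)) (comp_one_cell (cod2 M) (cod2 N))
       (\<lambda>q p. cls_hc D t P
          (entry M (q div size1 (cod2 N)) (p div size1 (dom2 N)))
          (entry N (q mod size1 (cod2 N)) (p mod size1 (dom2 N))))"

definition shift_two_cell :: "int \<Rightarrow> ('i, 'x, 'k) two_cell \<Rightarrow> ('i, 'x, 'k) two_cell" where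
  "shift_two_cell n M =
     TwoCell (shift_one_cell n (dom2 M)) (shift_one_cell n (cod2 M)) (entry M)"

definition U_Qbeta :: "('x, ('i, 'x) one_cell, ('i, 'x, 'k) two_cell, 'k) two_cat" where
  "U_Qbeta = \<lparr>Obj = UNIV, Mor1 = one_cells, Mor2 = two_cells,
        Src = src1, Tgt = tgt1, Dom = dom2, Cod = cod2,
        Id1 = id_one_cell, Comp1 = comp_one_cell,
        Id2 = id_two_cell, VComp = vcomp_two_cell, HComp = hcomp_two_cell,
        Zero2 = zero_two_cell, Add2 = add_two_cell, Smult2 = smult_two_cell,
        Shift1 = shift_one_cell, Shift2 = shift_two_cell\<rparr>"

text \<open>
  A generator of degree \<open>d\<close> as the 2-morphism \<open>W \<one>\<^sub>\<mu> \<rightarrow> V \<one>\<^sub>\<mu>\<langle>d\<rangle>\<close>, that is as a matrix with one entry.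
\<close>

definition gen_cell :: "('i, 'x) generator \<Rightarrow> ('i, 'x, 'k) two_cell" where
  "gen_cell g =
     (let \<mu> = gen_weight g; \<nu> = \<mu> + word_weight D (gen_dom g) in
      matrix_cell (OneCell \<mu> \<nu> [(gen_dom g, 0)]) (OneCell \<mu> \<nu> [(gen_cod g, gen_deg D g)])
        (\<lambda>q p. cls D t P (Gen g)))"

end

definition U_cyc :: "('i, 'x::ab_group_add) cartan_data \<Rightarrow> ('i \<Rightarrow> 'i \<Rightarrow> 'k::field) \<Rightarrow>
    ('i \<Rightarrow> 'x \<Rightarrow> 'k) \<Rightarrow> ('x, ('i, 'x) one_cell, ('i, 'x, 'k) two_cell, 'k) two_cat" where
  "U_cyc D t c = U_Qbeta D t (cyclic_params c)"


section \<open>Well-formedness of the relations\<close>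

lemma word_weight_simps [simp]:
  "word_weight D [] = 0"
  "word_weight D (l # W) = letter_weight D l + word_weight D W"
  "word_weight D (V @ W) = word_weight D V + word_weight D W"
  by (auto simp: word_weight_def)

lemma word_weight_gen [simp]: "word_weight D (gen_cod g) = word_weight D (gen_dom g)"
  by (cases g) (auto simp: algebra_simps)

lemma word_weight_cod: "wf_tm D f \<Longrightarrow> word_weight D (tm_cod f) = word_weight D (tm_dom f)"
  by (induction f) (auto simp: parallel_def)

lemma whisker_simps [simp]:
  "tm_src (whisker D W f V) = tm_src f - word_weight D V"
  "tm_dom (whisker D W f V) = W @ tm_dom f @ V"
  "tm_cod (whisker D W f V) = W @ tm_cod f @ V"
  "tm_deg D (whisker D W f V) = tm_deg D f"
  "wf_tm D (whisker D W f V) = wf_tm D f"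
  by (auto simp: whisker_def tm_tgt_def algebra_simps)

lemma dots_simps [simp]:
  "tm_src (dots i m n :: ('i,'x::ab_group_add,'k) tm) = m"
  "tm_dom (dots i m n :: ('i,'x,'k) tm) = [\<E> i]"
  "tm_cod (dots i m n :: ('i,'x,'k) tm) = [\<E> i]"
  "tm_deg D (dots i m n :: ('i,'x,'k) tm) = 2 * int n"
  "wf_tm D (dots i m n :: ('i,'x,'k) tm)"
  by (induction n) auto

lemma real_bubble_simps [simp]:
  "tm_src (cw_real D i m n) = m" "tm_dom (cw_real D i m n) = []" "tm_cod (cw_real D i m n) = []"
  "tm_deg D (cw_real D i m n) = 2 * int n + 2 - 2 * coroot D i m" "wf_tm D (cw_real D i m n)"
  "tm_src (ccw_real D i m n) = m" "tm_dom (ccw_real D i m n) = []" "tm_cod (ccw_real D i m n) = []"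
  "tm_deg D (ccw_real D i m n) = 2 * int n + 2 + 2 * coroot D i m" "wf_tm D (ccw_real D i m n)"
  by (auto simp: cw_real_def ccw_real_def algebra_simps)

definition has_type where
  "has_type D f m W V d \<longleftrightarrow>
     wf_tm D f \<and> tm_src f = m \<and> tm_dom f = W \<and> tm_cod f = V \<and> tm_deg D f = d"

lemma has_type_sum:
  "has_type D z m W V d \<Longrightarrow> (\<And>f. f \<in> set fs \<Longrightarrow> has_type D f m W V d) \<Longrightarrow>
     has_type D (sum_tm z fs) m W V d"
  by (induction fs) (auto simp: sum_tm_def has_type_def parallel_def)

lemma has_type_cw_fake: "coroot D i m \<le> 0 \<Longrightarrow> has_type D (cw_fake D P i m j) m [] [] (2 * int j)"
proof (induction j rule: less_induct)
  case (less j)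
  show ?case
  proof (cases "j = 0")
    case True then show ?thesis by (subst cw_fake.simps) (simp add: has_type_def)
  next
    case False
    have "has_type D (sum_tm (Zer m [] [] (2 * int j))
        (map (\<lambda>y. cw_fake D P i m (j - y) \<circ>\<^sub>v ccw_real D i m (nat (- coroot D i m - 1 + int y)))
          [1..<Suc j])) m [] [] (2 * int j)"
      apply (rule has_type_sum)
       apply (simp add: has_type_def)
      using less.IH less.prems by (auto simp: has_type_def)
    then show ?thesis using False by (subst cw_fake.simps) (simp add: has_type_def)
  qed
qed

lemma has_type_ccw_fake: "coroot D i m \<ge> 0 \<Longrightarrow> has_type D (ccw_fake D P i m j) m [] [] (2 * int j)"
proof (induction j rule: less_induct)
  case (less j)
  show ?case
  proof (cases "j = 0")
    case True then show ?thesis by (subst ccw_fake.simps) (simp add: has_type_def)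
  next
    case False
    have "has_type D (sum_tm (Zer m [] [] (2 * int j))
        (map (\<lambda>x. cw_real D i m (nat (coroot D i m - 1 + int x)) \<circ>\<^sub>v ccw_fake D P i m (j - x))
          [1..<Suc j])) m [] [] (2 * int j)"
      apply (rule has_type_sum)
       apply (simp add: has_type_def)
      using less.IH less.prems by (auto simp: has_type_def)
    then show ?thesis using False by (subst ccw_fake.simps) (simp add: has_type_def)
  qed
qed

lemma has_type_cw: "has_type D (cw D P i m j) m [] [] (2 * int j)"
  unfolding cw_def Let_def
  using has_type_cw_fake[of D i m P j] by (auto simp: has_type_def)

lemma has_type_ccw: "has_type D (ccw D P i m j) m [] [] (2 * int j)"
  unfolding ccw_def Let_def
  using has_type_ccw_fake[of D i m P j] by (auto simp: has_type_def)

context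
  fixes D :: "('i, 'x::ab_group_add) cartan_data"
  assumes D: "simply_laced_datum D"
begin

lemma coroot_add: "coroot D i (a + b) = coroot D i a + coroot D i b"
  using D by (simp add: simply_laced_datum_def)

lemma coroot_diff: "coroot D i (a - b) = coroot D i a - coroot D i b"
  using coroot_add[of i "a - b" b] by simp

lemma cartan_sym: "cartan D i j = cartan D j i"
proof -
  have "of_int (coroot D i (simple_root D j)) = (of_int (coroot D j (simple_root D i)) :: rat)"
    using D by (simp add: simply_laced_datum_def)
  then show ?thesis by (simp add: cartan_def)
qed

lemma cartan_diag: "cartan D i i = 2"
proof -
  have "of_int (coroot D i (simple_root D i)) = (2::rat)" using D by (simp add: simply_laced_datum_def)
  then show ?thesis unfolding cartan_def by linarith
qed

lemma coroot_simple_root: "coroot D i (simple_root D j) = cartan D i j" by (simp add: cartan_def)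

lemma has_type_sigma:
  "has_type D (sigma D i j m) m [\<E> i, \<F> j] [\<F> j, \<E> i] 0"
  "has_type D (sigma' D i j m) m [\<F> i, \<E> j] [\<E> j, \<F> i] 0"
  by (simp_all add: has_type_def sigma_def sigma'_def coroot_add coroot_diff coroot_simple_root
      cartan_diag cartan_sym[of i j] algebra_simps)

lemma relation_wf: "relation D t P f g \<Longrightarrow> wf_tm D f \<and> wf_tm D g \<and> parallel D f g"
proof (induction rule: relation.induct)
  case (sl2_EF m i)
  let ?L = "map (\<lambda>(f1, f2, f3).
           whisker D [] (dots i (m - rt D i) f3) [\<F> i] \<circ>\<^sub>v cup' i m \<circ>\<^sub>v
           ccw D P i m f2 \<circ>\<^sub>v
           cap i m \<circ>\<^sub>v whisker D [] (dots i (m - rt D i) f1) [\<F> i])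
         (triples (coroot D i m))"
  have "has_type D (sum_tm (Zer m [\<E> i, \<F> i] [\<E> i, \<F> i] 0) ?L) m [\<E> i, \<F> i] [\<E> i, \<F> i] 0"
    apply (rule has_type_sum)
     apply (simp add: has_type_def)
    using has_type_ccw[of D P i m] by (auto simp: has_type_def triples_def algebra_simps split: if_splits)
  then show ?case using has_type_sigma[of i i m] by (auto simp: has_type_def parallel_def)
next
  case (sl2_FE m i)
  let ?L = "map (\<lambda>(f1, f2, f3).
           whisker D [\<F> i] (dots i m f3) [] \<circ>\<^sub>v cup i m \<circ>\<^sub>v
           cw D P i m f2 \<circ>\<^sub>v
           cap' i m \<circ>\<^sub>v whisker D [\<F> i] (dots i m f1) [])
         (triples (- coroot D i m))"
  have "has_type D (sum_tm (Zer m [\<F> i, \<E> i] [\<F> i, \<E> i] 0) ?L) m [\<F> i, \<E> i] [\<F> i, \<E> i] 0"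
    apply (rule has_type_sum)
     apply (simp add: has_type_def)
    using has_type_cw[of D P i m] by (auto simp: has_type_def triples_def algebra_simps split: if_splits)
  then show ?case using has_type_sigma[of i i m] by (auto simp: has_type_def parallel_def)
next
  case (mixed_FE i j m)
  then show ?case using has_type_sigma[of i j m] has_type_sigma[of j i m]
    by (auto simp: has_type_def parallel_def)
next
  case (mixed_EF i j m)
  then show ?case using has_type_sigma[of i j m] has_type_sigma[of j i m]
    by (auto simp: has_type_def parallel_def)
next
  case (klr_cubic lhs j k m i)
  then show ?case using cartan_sym cartan_diag by (auto simp: parallel_def zer_def algebra_simps)
qed (use cartan_sym in \<open>auto simp: parallel_def zer_def coroot_add coroot_diff
      coroot_simple_root cartan_diag algebra_simps\<close>)

end

end

theory Submission
  imports Defs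
begin

text \<open>
  Multiplying every generator \<open>g\<close> by a scalar \<open>s g\<close> respects the relations as soon as the scalars
  of the cup and the cap of each zigzag are inverse to each other and those of the cup and the cap of
  each bubble multiply to the ratio of the two values of the degree zero bubble: the compatibility
  with \<open>t\<close> makes these ratios for \<open>i\<close> invariant under shifts by \<open>\<alpha>\<^sub>j\<close>, \<open>j \<noteq> i\<close>, and the product of the
  clockwise and the counterclockwise ratio is the ratio of the two values of \<open>\<beta>\<^sub>i\<close>.  The conditions
  are symmetric in the two sets of bubble parameters, so the inverse scalars give the inverse
  2-functor.  For the scalars of the theorem, adding \<open>\<alpha>\<^sub>i\<close> to the weight exchanges the residues
  \<open>{0, 1}\<close> and \<open>{2, 3}\<close> modulo 4, which makes the scalars of the zigzags inverse to each other.
\<close>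


text \<open>Being an isomorphism here includes that both sides are graded additive 2-categories, so
  the matrix model is checked against all axioms, for arbitrary parameters and hence for source and
  target at once. Equality of 2-morphisms is a generated congruence and no bases are available, so
  bijectivity is drawn from an explicit inverse.

  Suitable scalars exist for the following reason. For fixed \<open>i\<close> and weight \<mu>,
  zigzags and bubbles link the scalars of \<epsilon> and \<eta>' at \<mu> with those of \<epsilon>'
  and \<eta> at \<open>\<mu> - \<alpha>\<^sub>i\<close>, and with nothing else. By the zigzags the
  product of the four is 1; by the bubbles it is the clockwise ratio at \<mu> times the
  counterclockwise ratio at \<open>\<mu> - \<alpha>\<^sub>i\<close>. The two agree because the
  diagonal scalar - \<open>beta\<close> forces the clockwise value at \<mu> and the counterclockwise
  value at \<open>\<mu> - \<alpha>\<^sub>i\<close> to be inverse, for every choice of parameters.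
  One scalar in each such block stays free; the residues modulo 4 fix it.

  The obstacle in the relations is that fake bubbles contain the parameters: a relation and its
  image are not proportional as expressions, but only up to the congruence.\<close>

declare eqv.trans [trans]

section \<open>Finite sums in a commutative monoid\<close>

text \<open>Addition and zero are arguments because each matrix entry lives in its own space of
  classes and the addition depends on the bubble parameters; the right fold is the one in
  \<open>vcomp_two_cell\<close>.\<close>

definition lsum :: "('a \<Rightarrow> 'a \<Rightarrow> 'a) \<Rightarrow> 'a \<Rightarrow> (nat \<Rightarrow> 'a) \<Rightarrow> nat \<Rightarrow> 'a" where
  "lsum add z f n = foldr add (map f [0..<n]) z"

lemma lsum_cong: "(\<And>i. i < n \<Longrightarrow> f i = g i) \<Longrightarrow> lsum add z f n = lsum add z g n"
  unfolding lsum_def by (rule arg_cong[where f = "\<lambda>xs. foldr add xs z"]) simp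

text \<open>A carrier is needed since the operations on classes obey the monoid laws only on classes
  of one fixed type, not on arbitrary sets of terms.\<close>

locale commutative_monoid_on =
  fixes M :: "'a set" and add :: "'a \<Rightarrow> 'a \<Rightarrow> 'a" (infixl \<open>\<oplus>\<close> 65) and z :: 'a
  assumes closed: "x \<in> M \<Longrightarrow> y \<in> M \<Longrightarrow> x \<oplus> y \<in> M"
    and z_closed: "z \<in> M"
    and assoc: "x \<in> M \<Longrightarrow> y \<in> M \<Longrightarrow> w \<in> M \<Longrightarrow> (x \<oplus> y) \<oplus> w = x \<oplus> (y \<oplus> w)"
    and comm: "x \<in> M \<Longrightarrow> y \<in> M \<Longrightarrow> x \<oplus> y = y \<oplus> x"
    and unit: "x \<in> M \<Longrightarrow> x \<oplus> z = x"
begin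

abbreviation "S \<equiv> lsum add z"

lemma unit_left: "x \<in> M \<Longrightarrow> z \<oplus> x = x"
  using comm unit z_closed by metis

lemma foldr_closed: "set xs \<subseteq> M \<Longrightarrow> u \<in> M \<Longrightarrow> foldr add xs u \<in> M"
  by (induction xs) (auto intro: closed)

lemma S_closed: "(\<And>i. i < n \<Longrightarrow> f i \<in> M) \<Longrightarrow> S f n \<in> M"
  unfolding lsum_def by (rule foldr_closed) (auto intro: z_closed)

lemma S_0: "S f 0 = z"
  by (simp add: lsum_def)

lemma foldr_unit: "set xs \<subseteq> M \<Longrightarrow> u \<in> M \<Longrightarrow> foldr add xs u = foldr add xs z \<oplus> u"
proof (induction xs)
  case Nil
  then show ?case by (simp add: unit_left)
next
  case (Cons x xs)
  then have "foldr add xs z \<in> M" by (intro foldr_closed) (auto intro: z_closed)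
  with Cons show ?case by (simp add: assoc)
qed

text \<open>A right fold meets the last summand inside its start value; \<open>foldr_unit\<close>
  pulls it out, which opens the way to induction on the number of summands.\<close>

lemma S_Suc: "(\<And>i. i < Suc n \<Longrightarrow> f i \<in> M) \<Longrightarrow> S f (Suc n) = S f n \<oplus> f n"
proof -
  assume f: "\<And>i. i < Suc n \<Longrightarrow> f i \<in> M"
  then have "set (map f [0..<n]) \<subseteq> M" "f n \<in> M" by auto
  then show ?thesis using foldr_unit[of "map f [0..<n]" "f n"] by (simp add: lsum_def unit)
qed

lemma S_zero: "(\<And>i. i < n \<Longrightarrow> f i = z) \<Longrightarrow> S f n = z"
proof (induction n)
  case (Suc n)
  then have "S f (Suc n) = S f n \<oplus> f n" by (intro S_Suc) (simp add: z_closed)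
  with Suc show ?case by (simp add: unit z_closed)
qed (simp add: S_0)

text \<open>Collapses a matrix product in which one factor is an identity or a selection
  matrix.\<close>

lemma S_single:
  "j < n \<Longrightarrow> f j \<in> M \<Longrightarrow> (\<And>i. i < n \<Longrightarrow> i \<noteq> j \<Longrightarrow> f i = z) \<Longrightarrow> S f n = f j"
proof (induction n)
  case (Suc n)
  have "f i \<in> M" if "i < Suc n" for i using Suc.prems that z_closed by (cases "i = j") auto
  then have *: "S f (Suc n) = S f n \<oplus> f n" by (rule S_Suc)
  show ?case
  proof (cases "j = n")
    case True
    then have "S f n = z" using Suc.prems by (intro S_zero) auto
    then show ?thesis using * True Suc.prems by (simp add: unit_left)
  next
    case False
    then have "S f n = f j" "f n = z" using Suc by auto
    then show ?thesis using * Suc.prems by (simp add: unit)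
  qed
qed simp

lemma S_add: "(\<And>i. i < n \<Longrightarrow> f i \<in> M) \<Longrightarrow> (\<And>i. i < n \<Longrightarrow> g i \<in> M) \<Longrightarrow>
  S (\<lambda>i. f i \<oplus> g i) n = S f n \<oplus> S g n"
proof (induction n)
  case (Suc n)
  have mem: "S f n \<in> M" "S g n \<in> M" "f n \<in> M" "g n \<in> M" using Suc.prems by (auto intro: S_closed)
  have "S (\<lambda>i. f i \<oplus> g i) (Suc n) = S (\<lambda>i. f i \<oplus> g i) n \<oplus> (f n \<oplus> g n)"
    using Suc.prems by (intro S_Suc) (auto intro: closed)
  also have "\<dots> = (S f n \<oplus> S g n) \<oplus> (f n \<oplus> g n)" using Suc by simp
  also have "\<dots> = (S f n \<oplus> f n) \<oplus> (S g n \<oplus> g n)"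
    using mem by (simp add: assoc closed comm[of "S g n"] flip: assoc[of "S g n" "f n" "g n"])
  also have "\<dots> = S f (Suc n) \<oplus> S g (Suc n)" using Suc.prems by (simp add: S_Suc)
  finally show ?case .
qed (simp add: S_0 unit z_closed)

text \<open>Exchanges the two intermediate indices of a triple matrix product.\<close>

lemma S_swap: "(\<And>i j. i < m \<Longrightarrow> j < n \<Longrightarrow> f i j \<in> M) \<Longrightarrow>
  S (\<lambda>i. S (\<lambda>j. f i j) n) m = S (\<lambda>j. S (\<lambda>i. f i j) m) n"
proof (induction m)
  case 0
  then show ?case by (simp add: S_0 S_zero)
next
  case (Suc m)
  have "S (\<lambda>i. S (\<lambda>j. f i j) n) (Suc m) = S (\<lambda>i. S (\<lambda>j. f i j) n) m \<oplus> S (\<lambda>j. f m j) n"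
    using Suc.prems by (intro S_Suc) (auto intro: S_closed)
  also have "\<dots> = S (\<lambda>j. S (\<lambda>i. f i j) m) n \<oplus> S (\<lambda>j. f m j) n" using Suc by simp
  also have "\<dots> = S (\<lambda>j. S (\<lambda>i. f i j) m \<oplus> f m j) n"
    using Suc.prems by (intro S_add[symmetric]) (auto intro: S_closed)
  also have "\<dots> = S (\<lambda>j. S (\<lambda>i. f i j) (Suc m)) n"
    using Suc.prems by (intro lsum_cong S_Suc[symmetric]) auto
  finally show ?case .
qed

lemma S_append: "(\<And>i. i < m + n \<Longrightarrow> f i \<in> M) \<Longrightarrow> S f (m + n) = S f m \<oplus> S (\<lambda>j. f (m + j)) n"
proof (induction n)
  case 0
  then show ?case by (simp add: S_0 unit S_closed)
next
  case (Suc n)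
  have "S f (m + Suc n) = S f (m + n) \<oplus> f (m + n)" using Suc.prems S_Suc[of "m + n" f] by simp
  also have "\<dots> = (S f m \<oplus> S (\<lambda>j. f (m + j)) n) \<oplus> f (m + n)" using Suc by simp
  also have "\<dots> = S f m \<oplus> (S (\<lambda>j. f (m + j)) n \<oplus> f (m + n))"
    using Suc.prems by (intro assoc) (auto intro: S_closed)
  also have "\<dots> = S f m \<oplus> S (\<lambda>j. f (m + j)) (Suc n)" using Suc.prems by (simp add: S_Suc)
  finally show ?case .
qed

text \<open>Division with remainder: an index below \<open>m * n\<close> is
  \<open>i * n + j\<close>. Summands of a composite 1-morphism are numbered in this way, so the
  lemma splits the intermediate index of a product of Kronecker matrices.\<close>

lemma S_prod: "(\<And>i. i < m * n \<Longrightarrow> f i \<in> M) \<Longrightarrow>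
  S f (m * n) = S (\<lambda>i. S (\<lambda>j. f (i * n + j)) n) m"
proof (induction m)
  case (Suc m)
  have less: "i * n + j < Suc m * n" if "i < Suc m" "j < n" for i j
  proof -
    have "i * n + j < Suc i * n" using that by simp
    also have "\<dots> \<le> Suc m * n" using that by (intro mult_right_mono) auto
    finally show ?thesis .
  qed
  have "S f (Suc m * n) = S f (m * n) \<oplus> S (\<lambda>j. f (m * n + j)) n"
    using S_append[of "m * n" n f] Suc.prems by (simp add: add.commute)
  also have "\<dots> = S (\<lambda>i. S (\<lambda>j. f (i * n + j)) n) m \<oplus> S (\<lambda>j. f (m * n + j)) n"
    using Suc by simp
  also have "\<dots> = S (\<lambda>i. S (\<lambda>j. f (i * n + j)) n) (Suc m)"
    by (rule S_Suc[symmetric]) (use less Suc.prems in \<open>auto intro!: S_closed\<close>)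
  finally show ?case .
qed (simp add: S_0)

text \<open>Serves both for distributing a composition over a sum and for passing from sums for one
  set of parameters to sums for another; hence the separate addition \<open>add'\<close> in the
  target.\<close>

lemma hom_S:
  assumes h: "h z = z'" "\<And>x y. x \<in> M \<Longrightarrow> y \<in> M \<Longrightarrow> h (x \<oplus> y) = add' (h x) (h y)"
    and f: "\<And>i. i < n \<Longrightarrow> f i \<in> M"
  shows "h (S f n) = lsum add' z' (\<lambda>i. h (f i)) n"
proof -
  have *: "h (foldr add xs z) = foldr add' (map h xs) z'" if "set xs \<subseteq> M" for xs
    using that by (induction xs) (auto simp: h foldr_closed z_closed)
  have "set (map f [0..<n]) \<subseteq> M" using f by auto
  from *[OF this] show ?thesis by (simp add: lsum_def comp_def)
qed

end


section \<open>Composites and shifts of 1-morphisms, and the numbering of their summands\<close>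

lemma size1_comp: "size1 (comp_one_cell A B) = size1 A * size1 B"
  by (simp add: comp_one_cell_def length_concat comp_def case_prod_unfold sum_list_triv)

lemma nth_comp_one_cell:
  assumes "u < size1 A * size1 B"
  shows "summands (comp_one_cell A B) ! u =
    (summand_word A (u div size1 B) @ summand_word B (u mod size1 B),
     summand_shift A (u div size1 B) + summand_shift B (u mod size1 B))"
proof -
  \<comment> \<open>The lexicographic order of the comprehension is that of
    \<open>List.product\<close>, whose elements are addressed by quotient and remainder.\<close>
  have "summands (comp_one_cell A B) =
    map (\<lambda>((W, s), (V, r)). (W @ V, s + r)) (List.product (summands A) (summands B))"
    by (simp add: comp_one_cell_def product_concat_map map_concat comp_def case_prod_unfold)
  then show ?thesis using assms by (simp add: product_nth case_prod_unfold)
qed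

lemma cell_sel_simps [simp]:
  "src1 (comp_one_cell A B) = src1 B" "tgt1 (comp_one_cell A B) = tgt1 A"
  "src1 (shift_one_cell n A) = src1 A" "tgt1 (shift_one_cell n A) = tgt1 A"
  "size1 (shift_one_cell n A) = size1 A"
  "src1 (id_one_cell m) = m" "tgt1 (id_one_cell m) = m" "summands (id_one_cell m) = [([], 0)]"
  "dom2 (matrix_cell A B M) = A" "cod2 (matrix_cell A B M) = B"
  by (auto simp: comp_one_cell_def shift_one_cell_def id_one_cell_def matrix_cell_def)

lemma entry_matrix_cell:
  "entry (matrix_cell A B M) q p = (if q < size1 B \<and> p < size1 A then M q p else {})"
  by (simp add: matrix_cell_def)

lemma nth_shift_one_cell: "p < size1 A \<Longrightarrow>
    summands (shift_one_cell n A) ! p = (summand_word A p, summand_shift A p + n)"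
  by (simp add: shift_one_cell_def case_prod_unfold)

lemma concat_concat: "concat (concat xss) = concat (map concat xss)"
  by (induction xss) auto

lemma comp_one_cell_assoc:
  "comp_one_cell (comp_one_cell A B) C = comp_one_cell A (comp_one_cell B C)"
  by (simp add: comp_one_cell_def map_concat concat_concat comp_def case_prod_unfold add.assoc)

lemma comp_one_cell_id:
  "comp_one_cell (id_one_cell (tgt1 A)) A = A" "comp_one_cell A (id_one_cell (src1 A)) = A"
  by (cases A, auto simp: comp_one_cell_def id_one_cell_def case_prod_unfold)+

lemma comp_one_cell_shift:
  "comp_one_cell (shift_one_cell n A) B = shift_one_cell n (comp_one_cell A B)"
  "comp_one_cell A (shift_one_cell n B) = shift_one_cell n (comp_one_cell A B)"
  by (auto simp: comp_one_cell_def shift_one_cell_def case_prod_unfold map_concat comp_def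
      algebra_simps)

lemma shift_two_cell_sel [simp]:
  "dom2 (shift_two_cell n f) = shift_one_cell n (dom2 f)"
  "cod2 (shift_two_cell n f) = shift_one_cell n (cod2 f)"
  "entry (shift_two_cell n f) = entry f"
  by (simp_all add: shift_two_cell_def)

lemma two_cell_expand: "f = g \<longleftrightarrow> dom2 f = dom2 g \<and> cod2 f = cod2 g \<and> entry f = entry g"
  by (cases f; cases g) auto

lemma shift_one_cell_0: "shift_one_cell 0 A = A"
  by (cases A) (simp add: shift_one_cell_def case_prod_unfold)

lemma shift_one_cell_plus: "shift_one_cell (m + n) A = shift_one_cell m (shift_one_cell n A)"
  by (simp add: shift_one_cell_def case_prod_unfold ac_simps)

text \<open>Operations on classes are unions over all representatives; well-definedness makes the
  members equal, and nonempty index sets let the union collapse.\<close>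

lemma UN_UN_const:
  "a \<in> A \<Longrightarrow> b \<in> B \<Longrightarrow> (\<And>x y. x \<in> A \<Longrightarrow> y \<in> B \<Longrightarrow> h x y = C) \<Longrightarrow>
     (\<Union>x\<in>A. \<Union>y\<in>B. h x y) = C"
  by fastforce

lemma div_mod_less:
  fixes q :: nat
  assumes "q < m * n"
  shows "q div n < m" "q mod n < n"
proof -
  have "n > 0" using assms by (cases n) auto
  then show "q div n < m" "q mod n < n" using assms by (simp_all add: less_mult_imp_div_less)
qed

lemma mult_add_div: "s < n \<Longrightarrow> (r * n + s) div n = (r :: nat)"
proof -
  assume "s < n"
  then have "n \<noteq> 0" by auto
  then show ?thesis using \<open>s < n\<close> by simp
qed

text \<open>An index of a triple composite has three digits to the mixed radices \<open>a\<close>,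
  \<open>b\<close>, \<open>c\<close>; both bracketings read off the same digits.\<close>

lemma nat_div_mod_mult:
  fixes q :: nat
  assumes "q < a * (b * c)"
  shows "q div (b * c) = q div c div b" "q mod (b * c) div c = q div c mod b"
    "q mod (b * c) mod c = q mod c"
proof -
  have "c > 0" using assms by (cases c) auto
  then show "q div (b * c) = q div c div b" "q mod (b * c) div c = q div c mod b"
    "q mod (b * c) mod c = q mod c"
    using div_mult2_eq[of q c b] mod_mult2_eq[of q c b] by (simp_all add: mult.commute)
qed


section \<open>Morphisms between words modulo the relations\<close>

context
  fixes D :: "('i, 'x::ab_group_add) cartan_data"
    and t :: "'i \<Rightarrow> 'i \<Rightarrow> 'k::field"
    and P :: "('i, 'x, 'k) bubble_params"
begin

private abbreviation (input) eqv_here (infix \<open>\<approx>\<close> 50) where "f \<approx> g \<equiv> eqv D t P f g"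
private abbreviation (input) "H \<equiv> graded_hom D t P"
private abbreviation (input) "cl \<equiv> cls D t P"
private abbreviation (input) "vc \<equiv> cls_vc D t P"
private abbreviation (input) "hc \<equiv> cls_hc D t P"
private abbreviation (input) "add \<equiv> cls_add D t P"
private abbreviation (input) "sm \<equiv> cls_smul D t P"

text \<open>Apart from \<open>rel\<close>, a rule assumes well-formedness of at most one side. Its
  transfer to the other side is what gives an equivalence class a definite weight, domain, codomain
  and degree.\<close>

lemma eqv_wf_parallel: "f \<approx> g \<Longrightarrow> wf_tm D f \<and> wf_tm D g \<and> parallel D f g"
proof (induction rule: eqv.induct)
  case (cong_hc f f' g g')
  then show ?case by (simp add: parallel_def tm_tgt_def)
next
  case (hc_assoc f g h)
  then show ?case by (simp add: parallel_def tm_tgt_def algebra_simps)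
next
  case (interchange f f' g g')
  \<comment> \<open>\<open>HC f g\<close> compares weights through the domain of \<open>g\<close>,
    which is the codomain of \<open>g'\<close>; the hypothesis speaks of the domain of
    \<open>g'\<close>.\<close>
  then show ?case using word_weight_cod[of D g'] by (simp add: parallel_def tm_tgt_def)
qed (auto simp: parallel_def tm_tgt_def zer_def word_weight_cod)

text \<open>Writes 0 as 1 + (- 1) and uses \<open>add_neg\<close>, the axiom that produces
  zeros.\<close>

lemma smul_zero_eqv: "wf_tm D f \<Longrightarrow> 0 \<cdot>\<^sub>v f \<approx> zer D f"
proof -
  assume f: "wf_tm D f"
  have "0 \<cdot>\<^sub>v f \<approx> 1 \<cdot>\<^sub>v f -\<^sub>v f" using eqv.smul_plus[OF f, of t P 1 "-1"] by simp
  also have "1 \<cdot>\<^sub>v f -\<^sub>v f \<approx> f -\<^sub>v f"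
    by (rule eqv.cong_add) (auto simp: f parallel_def intro: eqv.smul_one eqv.refl)
  also have "f -\<^sub>v f \<approx> zer D f" by (rule eqv.add_neg[OF f])
  finally show ?thesis .
qed

lemma smul_zer_eqv: "wf_tm D f \<Longrightarrow> a \<cdot>\<^sub>v zer D f \<approx> zer D f"
proof -
  assume f: "wf_tm D f"
  then have z: "wf_tm D (zer D f)" by (simp add: zer_def word_weight_cod)
  have "a \<cdot>\<^sub>v zer D f \<approx> a \<cdot>\<^sub>v 0 \<cdot>\<^sub>v f" by (intro eqv.cong_smul eqv.sym[OF smul_zero_eqv] f)
  also have "a \<cdot>\<^sub>v 0 \<cdot>\<^sub>v f \<approx> (a * 0) \<cdot>\<^sub>v f" by (rule eqv.sym[OF eqv.smul_times[OF f]])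
  also have "(a * 0) \<cdot>\<^sub>v f \<approx> zer D f" using smul_zero_eqv[OF f] by simp
  finally show ?thesis .
qed

text \<open>No axiom composes with a formal zero. Written as 0 times itself, it lets the linearity
  axioms move the scalar out of a composite; the four absorption laws below all rest on
  this.\<close>

lemma zer_eqv_smul_Zer:
  "word_weight D W = word_weight D V \<Longrightarrow> Zer m W V d \<approx> 0 \<cdot>\<^sub>v Zer m W V d"
  using eqv.sym[OF smul_zero_eqv[of "Zer m W V d"]] by (simp add: zer_def)

lemma vc_zero_right_eqv:
  assumes f: "wf_tm D f" and W: "word_weight D W = word_weight D (tm_dom f)"
  shows "f \<circ>\<^sub>v Zer (tm_src f) W (tm_dom f) d \<approx> Zer (tm_src f) W (tm_cod f) (tm_deg D f + d)"
proof -
  let ?z = "Zer (tm_src f) W (tm_dom f) d"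
  have w: "wf_tm D (f \<circ>\<^sub>v ?z)" using f W by simp
  have "f \<circ>\<^sub>v ?z \<approx> f \<circ>\<^sub>v (0 \<cdot>\<^sub>v ?z)"
    by (rule eqv.cong_vc[OF eqv.refl[OF f] zer_eqv_smul_Zer w]) (use W in simp)
  also have "f \<circ>\<^sub>v (0 \<cdot>\<^sub>v ?z) \<approx> 0 \<cdot>\<^sub>v (f \<circ>\<^sub>v ?z)" by (rule eqv.vc_smul_right[OF w])
  also have "0 \<cdot>\<^sub>v (f \<circ>\<^sub>v ?z) \<approx> zer D (f \<circ>\<^sub>v ?z)" by (rule smul_zero_eqv[OF w])
  finally show ?thesis by (simp add: zer_def)
qed

lemma vc_zero_left_eqv:
  assumes f: "wf_tm D f" and W: "word_weight D W = word_weight D (tm_cod f)"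
  shows "Zer (tm_src f) (tm_cod f) W d \<circ>\<^sub>v f \<approx> Zer (tm_src f) (tm_dom f) W (d + tm_deg D f)"
proof -
  let ?z = "Zer (tm_src f) (tm_cod f) W d"
  have w: "wf_tm D (?z \<circ>\<^sub>v f)" using f W by simp
  have "?z \<circ>\<^sub>v f \<approx> (0 \<cdot>\<^sub>v ?z) \<circ>\<^sub>v f"
    by (rule eqv.cong_vc[OF zer_eqv_smul_Zer eqv.refl[OF f] w]) (use W in simp)
  also have "(0 \<cdot>\<^sub>v ?z) \<circ>\<^sub>v f \<approx> 0 \<cdot>\<^sub>v (?z \<circ>\<^sub>v f)" by (rule eqv.vc_smul_left[OF w])
  also have "0 \<cdot>\<^sub>v (?z \<circ>\<^sub>v f) \<approx> zer D (?z \<circ>\<^sub>v f)" by (rule smul_zero_eqv[OF w])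
  finally show ?thesis by (simp add: zer_def)
qed

lemma hc_zero_right_eqv:
  assumes f: "wf_tm D f" and W: "word_weight D W = word_weight D V"
    and m: "tm_src f = m + word_weight D W"
  shows "HC f (Zer m W V d) \<approx> Zer m (tm_dom f @ W) (tm_cod f @ V) (tm_deg D f + d)"
proof -
  let ?z = "Zer m W V d"
  have w: "wf_tm D (HC f ?z)" using f W m by (simp add: tm_tgt_def)
  have "HC f ?z \<approx> HC f (0 \<cdot>\<^sub>v ?z)"
    by (rule eqv.cong_hc[OF eqv.refl[OF f] zer_eqv_smul_Zer w]) (use W in simp)
  also have "HC f (0 \<cdot>\<^sub>v ?z) \<approx> 0 \<cdot>\<^sub>v (HC f ?z)" by (rule eqv.hc_smul_right[OF w])
  also have "0 \<cdot>\<^sub>v (HC f ?z) \<approx> zer D (HC f ?z)" by (rule smul_zero_eqv[OF w])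
  finally show ?thesis by (simp add: zer_def)
qed

lemma hc_zero_left_eqv:
  assumes f: "wf_tm D f" and W: "word_weight D W = word_weight D V"
    and m: "m = tm_tgt D f"
  shows "HC (Zer m W V d) f \<approx> Zer (tm_src f) (W @ tm_dom f) (V @ tm_cod f) (d + tm_deg D f)"
proof -
  let ?z = "Zer m W V d"
  have w: "wf_tm D (HC ?z f)" using f W m by simp
  have "HC ?z f \<approx> HC (0 \<cdot>\<^sub>v ?z) f"
    by (rule eqv.cong_hc[OF zer_eqv_smul_Zer eqv.refl[OF f] w]) (use W in simp)
  also have "HC (0 \<cdot>\<^sub>v ?z) f \<approx> 0 \<cdot>\<^sub>v (HC ?z f)" by (rule eqv.hc_smul_left[OF w])
  also have "0 \<cdot>\<^sub>v (HC ?z f) \<approx> zer D (HC ?z f)" by (rule smul_zero_eqv[OF w])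
  finally show ?thesis by (simp add: zer_def)
qed


section \<open>Operations on classes of 2-morphisms between words\<close>

lemma graded_hom_iff: "X \<in> H m W V d \<longleftrightarrow> (\<exists>f. has_type D f m W V d \<and> X = cl f)"
  by (auto simp: graded_hom_def quotient_def has_type_def cls_def)

lemma graded_homE:
  assumes "X \<in> H m W V d"
  obtains f where "has_type D f m W V d" "X = cl f"
  using assms by (auto simp: graded_hom_iff)

lemma cls_in_graded_hom: "has_type D f m W V d \<Longrightarrow> cl f \<in> H m W V d"
  by (auto simp: graded_hom_iff)

lemma cls_eqI: "f \<approx> g \<Longrightarrow> cl f = cl g"
  unfolding cls_def using eqv.trans[of D t P f g] eqv.trans[OF eqv.sym, of D t P f g] by blast

lemma mem_clsD: "f' \<in> cl f \<Longrightarrow> f \<approx> f'"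
  by (simp add: cls_def)

lemma mem_cls_self: "wf_tm D f \<Longrightarrow> f \<in> cl f"
  by (simp add: cls_def eqv.refl)

text \<open>By congruence all members of the defining union coincide, so one pair of representatives
  computes the operation.\<close>

lemma cls_vc_cls: "wf_tm D (f \<circ>\<^sub>v g) \<Longrightarrow> vc (cl f) (cl g) = cl (f \<circ>\<^sub>v g)"
proof -
  assume w: "wf_tm D (f \<circ>\<^sub>v g)"
  have *: "cl (f' \<circ>\<^sub>v g') = cl (f \<circ>\<^sub>v g)" if "f' \<in> cl f" "g' \<in> cl g" for f' g'
    using cls_eqI[OF eqv.cong_vc[OF mem_clsD[OF that(1)] mem_clsD[OF that(2)] w]] by simp
  show ?thesis unfolding cls_vc_def
    by (rule UN_UN_const[OF mem_cls_self[of f] mem_cls_self[of g] *]) (use w in auto)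
qed

lemma cls_hc_cls: "wf_tm D (HC f g) \<Longrightarrow> hc (cl f) (cl g) = cl (HC f g)"
proof -
  assume w: "wf_tm D (HC f g)"
  have *: "cl (HC f' g') = cl (HC f g)" if "f' \<in> cl f" "g' \<in> cl g" for f' g'
    using cls_eqI[OF eqv.cong_hc[OF mem_clsD[OF that(1)] mem_clsD[OF that(2)] w]] by simp
  show ?thesis unfolding cls_hc_def
    by (rule UN_UN_const[OF mem_cls_self[of f] mem_cls_self[of g] *]) (use w in auto)
qed

lemma cls_add_cls: "wf_tm D (f +\<^sub>v g) \<Longrightarrow> add (cl f) (cl g) = cl (f +\<^sub>v g)"
proof -
  assume w: "wf_tm D (f +\<^sub>v g)"
  have *: "cl (f' +\<^sub>v g') = cl (f +\<^sub>v g)" if "f' \<in> cl f" "g' \<in> cl g" for f' g'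
    using cls_eqI[OF eqv.cong_add[OF mem_clsD[OF that(1)] mem_clsD[OF that(2)] w]] by simp
  show ?thesis unfolding cls_add_def
    by (rule UN_UN_const[OF mem_cls_self[of f] mem_cls_self[of g] *]) (use w in auto)
qed

lemma cls_smul_cls: "wf_tm D f \<Longrightarrow> sm a (cl f) = cl (a \<cdot>\<^sub>v f)"
proof -
  assume w: "wf_tm D f"
  have "cl (a \<cdot>\<^sub>v f') = cl (a \<cdot>\<^sub>v f)" if "f' \<in> cl f" for f'
    using cls_eqI[OF eqv.cong_smul[OF mem_clsD[OF that]]] by simp
  then show ?thesis unfolding cls_smul_def using mem_cls_self[OF w] by blast
qed

lemmas cls_ops = cls_vc_cls cls_hc_cls cls_add_cls cls_smul_cls

lemma has_type_ops:
  "has_type D f m V U d \<Longrightarrow> has_type D g m W V e \<Longrightarrow> has_type D (f \<circ>\<^sub>v g) m W U (d + e)"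
  "has_type D f (m + word_weight D W) W' V' d \<Longrightarrow> has_type D g m W V e \<Longrightarrow>
     has_type D (HC f g) m (W' @ W) (V' @ V) (d + e)"
  "has_type D f m W V d \<Longrightarrow> has_type D g m W V d \<Longrightarrow> has_type D (f +\<^sub>v g) m W V d"
  "has_type D f m W V d \<Longrightarrow> has_type D (a \<cdot>\<^sub>v f) m W V d"
  "has_type D (Ident m W) m W W 0"
  "word_weight D W = word_weight D V \<Longrightarrow> has_type D (Zer m W V d) m W V d"
  by (auto simp: has_type_def tm_tgt_def parallel_def)

lemma has_type_wf: "has_type D f m W V d \<Longrightarrow> wf_tm D f"
  by (simp add: has_type_def)

lemma has_type_weight: "has_type D f m W V d \<Longrightarrow> word_weight D W = word_weight D V"
  using word_weight_cod[of D f] by (auto simp: has_type_def)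

lemmas cls_typed_simps = has_type_def tm_tgt_def parallel_def cls_ops zer_def word_weight_cod

lemma vc_closed: "X \<in> H m V U d \<Longrightarrow> Y \<in> H m W V e \<Longrightarrow> vc X Y \<in> H m W U (d + e)"
  by (elim graded_homE) (auto simp: cls_typed_simps intro!: cls_in_graded_hom)

lemma hc_closed: "X \<in> H (m + word_weight D W) W' V' d \<Longrightarrow> Y \<in> H m W V e \<Longrightarrow>
    hc X Y \<in> H m (W' @ W) (V' @ V) (d + e)"
  by (elim graded_homE) (auto simp: cls_typed_simps intro!: cls_in_graded_hom)

lemma add_closed: "X \<in> H m W V d \<Longrightarrow> Y \<in> H m W V d \<Longrightarrow> add X Y \<in> H m W V d"
  by (elim graded_homE) (auto simp: cls_typed_simps intro!: cls_in_graded_hom)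

lemma smul_closed: "X \<in> H m W V d \<Longrightarrow> sm a X \<in> H m W V d"
  by (elim graded_homE) (auto simp: cls_typed_simps intro!: cls_in_graded_hom)

lemma ident_closed: "cl (Ident m W) \<in> H m W W 0"
  by (rule cls_in_graded_hom[OF has_type_ops(5)])

lemma zer_closed: "word_weight D W = word_weight D V \<Longrightarrow> cl (Zer m W V d) \<in> H m W V d"
  by (rule cls_in_graded_hom[OF has_type_ops(6)])

lemma cls_vc_assoc: "X \<in> H m U T d \<Longrightarrow> Y \<in> H m V U e \<Longrightarrow> Z \<in> H m W V a \<Longrightarrow>
    vc (vc X Y) Z = vc X (vc Y Z)"
  by (elim graded_homE) (auto simp: cls_typed_simps intro!: cls_eqI eqv.vc_assoc)

lemma cls_hc_assoc: "X \<in> H (m + word_weight D W + word_weight D V) U U' d \<Longrightarrow>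
    Y \<in> H (m + word_weight D W) V V' e \<Longrightarrow> Z \<in> H m W W' a \<Longrightarrow>
    hc (hc X Y) Z = hc X (hc Y Z)"
  by (elim graded_homE) (auto simp: cls_typed_simps algebra_simps intro!: cls_eqI eqv.hc_assoc)

lemma cls_vc_id:
  "X \<in> H m W V d \<Longrightarrow> vc (cl (Ident m V)) X = X"
  "X \<in> H m W V d \<Longrightarrow> vc X (cl (Ident m W)) = X"
   apply (elim graded_homE, simp add: cls_typed_simps)
   apply (metis cls_eqI eqv.vc_id_left)
  apply (elim graded_homE, simp add: cls_typed_simps)
  apply (metis cls_eqI eqv.vc_id_right)
  done

lemma cls_hc_id:
  "X \<in> H m W V d \<Longrightarrow> hc (cl (Ident (m + word_weight D W) [])) X = X"
  "X \<in> H m W V d \<Longrightarrow> hc X (cl (Ident m [])) = X"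
   apply (elim graded_homE, simp add: cls_typed_simps)
   apply (metis cls_eqI eqv.hc_id_left tm_tgt_def)
  apply (elim graded_homE, simp add: cls_typed_simps)
  apply (metis cls_eqI eqv.hc_id_right)
  done

lemma cls_hc_Ident:
  "hc (cl (Ident (m + word_weight D V) W)) (cl (Ident m V)) = cl (Ident m (W @ V))"
  by (simp add: cls_ops tm_tgt_def cls_eqI eqv.hc_id)

lemma cls_interchange: "X \<in> H (m + word_weight D V) V' U' d \<Longrightarrow>
    X' \<in> H (m + word_weight D V) W' V' d' \<Longrightarrow> Y \<in> H m V U e \<Longrightarrow> Y' \<in> H m W V e' \<Longrightarrow>
    hc (vc X X') (vc Y Y') = vc (hc X Y) (hc X' Y')"
proof (elim graded_homE, goal_cases)
  case (1 f f' g g')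
  \<comment> \<open>Forced by the type of \<open>g'\<close>; it makes the left factors composable
    with \<open>g\<close> as well as with \<open>g'\<close>.\<close>
  have "word_weight D W = word_weight D V" using has_type_weight[OF 1(7)] .
  with 1 show ?case by (auto simp: cls_typed_simps intro!: cls_eqI eqv.interchange)
qed

lemma cls_add_assoc: "X \<in> H m W V d \<Longrightarrow> Y \<in> H m W V d \<Longrightarrow> Z \<in> H m W V d \<Longrightarrow>
    add (add X Y) Z = add X (add Y Z)"
  by (elim graded_homE) (auto simp: cls_typed_simps intro!: cls_eqI eqv.add_assoc)

lemma cls_add_comm: "X \<in> H m W V d \<Longrightarrow> Y \<in> H m W V d \<Longrightarrow> add X Y = add Y X"
  by (elim graded_homE) (auto simp: cls_typed_simps intro!: cls_eqI eqv.add_comm)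

lemma cls_add_zero: "X \<in> H m W V d \<Longrightarrow> add X (cl (Zer m W V d)) = X"
proof (elim graded_homE, goal_cases)
  case (1 f)
  have "word_weight D W = word_weight D V" using has_type_weight[OF 1(1)] .
  moreover have "f +\<^sub>v Zer m W V d \<approx> f"
    using 1(1) eqv.add_zero[of D f t P] by (auto simp: has_type_def zer_def)
  ultimately show ?case using 1 by (auto simp: cls_typed_simps intro!: cls_eqI)
qed

lemma cls_add_neg: "X \<in> H m W V d \<Longrightarrow> add X (sm (- 1) X) = cl (Zer m W V d)"
proof (elim graded_homE, goal_cases)
  case (1 f)
  have "f -\<^sub>v f \<approx> Zer m W V d"
    using 1(1) eqv.add_neg[of D f t P] by (auto simp: has_type_def zer_def)
  then show ?case using 1 by (auto simp: cls_typed_simps intro!: cls_eqI)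
qed

lemma cls_smul_add: "X \<in> H m W V d \<Longrightarrow> Y \<in> H m W V d \<Longrightarrow>
    sm a (add X Y) = add (sm a X) (sm a Y)"
  by (elim graded_homE) (auto simp: cls_typed_simps intro!: cls_eqI eqv.smul_add)

lemma cls_smul_plus: "X \<in> H m W V d \<Longrightarrow> sm (a + b) X = add (sm a X) (sm b X)"
  by (elim graded_homE) (auto simp: cls_typed_simps intro!: cls_eqI eqv.smul_plus)

lemma cls_smul_times: "X \<in> H m W V d \<Longrightarrow> sm (a * b) X = sm a (sm b X)"
  by (elim graded_homE) (auto simp: cls_typed_simps intro!: cls_eqI eqv.smul_times)

lemma cls_smul_one: "X \<in> H m W V d \<Longrightarrow> sm 1 X = X"
  by (elim graded_homE) (auto simp: cls_typed_simps intro!: cls_eqI eqv.smul_one)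

lemma cls_smul_zero:
  "word_weight D W = word_weight D V \<Longrightarrow> sm a (cl (Zer m W V d)) = cl (Zer m W V d)"
  using smul_zer_eqv[of "Zer m W V d"] by (auto simp: cls_typed_simps intro!: cls_eqI)

lemma cls_vc_add:
  "X \<in> H m V U d \<Longrightarrow> Y \<in> H m V U d \<Longrightarrow> Z \<in> H m W V e \<Longrightarrow>
     vc (add X Y) Z = add (vc X Z) (vc Y Z)"
  "Z \<in> H m V U e \<Longrightarrow> X \<in> H m W V d \<Longrightarrow> Y \<in> H m W V d \<Longrightarrow>
     vc Z (add X Y) = add (vc Z X) (vc Z Y)"
  by (elim graded_homE, force simp: cls_typed_simps intro!: cls_eqI eqv.vc_add_left eqv.vc_add_right)+

lemma cls_hc_add:
  "X \<in> H (m + word_weight D W) W' V' d \<Longrightarrow> Y \<in> H (m + word_weight D W) W' V' d \<Longrightarrow>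
     Z \<in> H m W V e \<Longrightarrow> hc (add X Y) Z = add (hc X Z) (hc Y Z)"
  "Z \<in> H (m + word_weight D W) W' V' e \<Longrightarrow> X \<in> H m W V d \<Longrightarrow> Y \<in> H m W V d \<Longrightarrow>
     hc Z (add X Y) = add (hc Z X) (hc Z Y)"
  by (elim graded_homE, force simp: cls_typed_simps intro!: cls_eqI eqv.hc_add_left eqv.hc_add_right)+

lemma cls_vc_smul:
  "X \<in> H m V U d \<Longrightarrow> Y \<in> H m W V e \<Longrightarrow> vc (sm a X) Y = sm a (vc X Y)"
  "X \<in> H m V U d \<Longrightarrow> Y \<in> H m W V e \<Longrightarrow> vc X (sm a Y) = sm a (vc X Y)"
  by (elim graded_homE, force simp: cls_typed_simps intro!: cls_eqI eqv.vc_smul_left eqv.vc_smul_right)+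

lemma cls_hc_smul:
  "X \<in> H (m + word_weight D W) W' V' d \<Longrightarrow> Y \<in> H m W V e \<Longrightarrow> hc (sm a X) Y = sm a (hc X Y)"
  "X \<in> H (m + word_weight D W) W' V' d \<Longrightarrow> Y \<in> H m W V e \<Longrightarrow> hc X (sm a Y) = sm a (hc X Y)"
  by (elim graded_homE, force simp: cls_typed_simps intro!: cls_eqI eqv.hc_smul_left eqv.hc_smul_right)+

lemma cls_vc_zero:
  "X \<in> H m V U d \<Longrightarrow> word_weight D W = word_weight D V \<Longrightarrow>
     vc X (cl (Zer m W V e)) = cl (Zer m W U (d + e))"
  "X \<in> H m W V d \<Longrightarrow> word_weight D V = word_weight D U \<Longrightarrow>
     vc (cl (Zer m V U e)) X = cl (Zer m W U (e + d))"
   apply (elim graded_homE, clarsimp simp: cls_typed_simps)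
   apply (rule cls_eqI, rule vc_zero_right_eqv; simp add: tm_tgt_def word_weight_cod)
  apply (elim graded_homE, clarsimp simp: cls_typed_simps)
  apply (rule cls_eqI, rule vc_zero_left_eqv; simp add: tm_tgt_def word_weight_cod)
  done

lemma cls_hc_zero:
  "X \<in> H (m + word_weight D W) W' V' d \<Longrightarrow> word_weight D W = word_weight D V \<Longrightarrow>
     hc X (cl (Zer m W V e)) = cl (Zer m (W' @ W) (V' @ V) (d + e))"
  "X \<in> H m W V d \<Longrightarrow> word_weight D W' = word_weight D V' \<Longrightarrow>
     hc (cl (Zer (m + word_weight D W) W' V' e)) X = cl (Zer m (W' @ W) (V' @ V) (e + d))"
   apply (elim graded_homE, clarsimp simp: cls_typed_simps)
   apply (rule cls_eqI, rule hc_zero_right_eqv; simp add: tm_tgt_def word_weight_cod)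
  apply (elim graded_homE, clarsimp simp: cls_typed_simps)
  apply (rule cls_eqI, rule hc_zero_left_eqv; simp add: tm_tgt_def word_weight_cod)
  done


subsection \<open>The 2-category axioms\<close>

private abbreviation (input) "U \<equiv> U_Qbeta D t P"
private abbreviation (input) "ww \<equiv> word_weight D"
private abbreviation (input) "ze \<equiv> zero_entry D t P"
private abbreviation (input) "cc \<equiv> comp_one_cell"
private abbreviation (input) "hcomp \<equiv> hcomp_two_cell D t P"
private abbreviation (input) "vcomp \<equiv> vcomp_two_cell D t P"
private abbreviation (input) "addc \<equiv> add_two_cell D t P"
private abbreviation (input) "smultc \<equiv> smult_two_cell D t P"
private abbreviation (input) "idc \<equiv> id_two_cell D t P"

lemma U_Qbeta_simps [simp]:
  "Obj U = UNIV" "Mor1 U = one_cells D" "Mor2 U = two_cells D t P"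
  "Src U = src1" "Tgt U = tgt1" "Dom U = dom2" "Cod U = cod2"
  "Id1 U = id_one_cell" "Comp1 U = comp_one_cell"
  "Id2 U = id_two_cell D t P" "VComp U = vcomp_two_cell D t P" "HComp U = hcomp_two_cell D t P"
  "Zero2 U = zero_two_cell D t P" "Add2 U = add_two_cell D t P" "Smult2 U = smult_two_cell D t P"
  "Shift1 U = shift_one_cell" "Shift2 U = shift_two_cell"
  by (simp_all add: U_Qbeta_def)

section \<open>Matrices of classes and vertical composition\<close>

definition parallel_cells :: "('i, 'x) one_cell \<Rightarrow> ('i, 'x) one_cell \<Rightarrow> bool" where
  "parallel_cells A B \<longleftrightarrow> A \<in> one_cells D \<and> B \<in> one_cells D \<and> src1 A = src1 B \<and> tgt1 A = tgt1 B"

definition entry_hom :: "('i, 'x) one_cell \<Rightarrow> ('i, 'x) one_cell \<Rightarrow> nat \<Rightarrow> nat \<Rightarrow>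
    ('i, 'x, 'k) tm set set" where
  "entry_hom A B q p = H (src1 A) (summand_word A p) (summand_word B q)
     (summand_shift B q - summand_shift A p)"

lemma one_cell_weight:
  "A \<in> one_cells D \<Longrightarrow> p < size1 A \<Longrightarrow> src1 A + ww (summand_word A p) = tgt1 A"
  by (fastforce simp: one_cells_def dest: nth_mem)

lemma one_cell_weight':
  "A \<in> one_cells D \<Longrightarrow> p < size1 A \<Longrightarrow> ww (summand_word A p) = tgt1 A - src1 A"
  using one_cell_weight[of A p] by (simp add: algebra_simps)

lemma hom1_iff: "A \<in> hom1 U x y \<longleftrightarrow> A \<in> one_cells D \<and> src1 A = x \<and> tgt1 A = y"
  by (simp add: hom1_def)

text \<open>Entries out of range are pinned to the empty set, so a 2-morphism is determined by its
  entries in range and \<open>two_cell_eqI\<close> has only those to compare.\<close>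

lemma hom2_iff: "f \<in> hom2 U A B \<longleftrightarrow> parallel_cells A B \<and> dom2 f = A \<and> cod2 f = B \<and>
   (\<forall>q p. entry f q p \<in> (if q < size1 B \<and> p < size1 A then entry_hom A B q p else {{}}))"
  (is "?l \<longleftrightarrow> ?r")
proof
  assume ?l then show ?r
    by (auto simp: hom2_def two_cells_def entry_matrix_cell entry_hom_def parallel_cells_def)
next
  assume r: ?r
  then have "f = matrix_cell A B (entry f)"
    by (cases f) (auto simp: matrix_cell_def fun_eq_iff split: if_splits)
  moreover have "\<forall>q<size1 B. \<forall>p<size1 A. entry f q p \<in> entry_hom A B q p"
    using r by (metis (full_types))
  moreover have "A \<in> one_cells D" "B \<in> one_cells D" "src1 A = src1 B" "tgt1 A = tgt1 B"
    using r by (simp_all add: parallel_cells_def)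
  ultimately have "f \<in> two_cells D t P" unfolding two_cells_def entry_hom_def by blast
  then show ?l using r by (simp add: hom2_def)
qed

lemma hom2_cells:
  "f \<in> hom2 U A B \<Longrightarrow> parallel_cells A B" "f \<in> hom2 U A B \<Longrightarrow> dom2 f = A" "f \<in> hom2 U A B \<Longrightarrow> cod2 f = B"
  by (simp_all add: hom2_iff)

lemma hom2_entry: "f \<in> hom2 U A B \<Longrightarrow> q < size1 B \<Longrightarrow> p < size1 A \<Longrightarrow>
    entry f q p \<in> entry_hom A B q p"
  by (metis hom2_iff)

lemma hom2_entry_outside:
  "f \<in> hom2 U A B \<Longrightarrow> \<not> (q < size1 B \<and> p < size1 A) \<Longrightarrow> entry f q p = {}"
  by (metis hom2_iff singletonD)

lemma matrix_cell_hom2: "parallel_cells A B \<Longrightarrow>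
    (\<And>q p. q < size1 B \<Longrightarrow> p < size1 A \<Longrightarrow> M q p \<in> entry_hom A B q p) \<Longrightarrow>
    matrix_cell A B M \<in> hom2 U A B"
  by (simp add: hom2_iff entry_matrix_cell)

lemma two_cell_eqI:
  assumes "f \<in> hom2 U A B" "g \<in> hom2 U A B"
    and "\<And>q p. q < size1 B \<Longrightarrow> p < size1 A \<Longrightarrow> entry f q p = entry g q p"
  shows "f = g"
proof -
  have "entry f q p = entry g q p" for q p
    using assms(3)[of q p] hom2_entry_outside[OF assms(1)] hom2_entry_outside[OF assms(2)]
    by (cases "q < size1 B \<and> p < size1 A") simp_all
  then show ?thesis using hom2_cells(2,3)[OF assms(1)] hom2_cells(2,3)[OF assms(2)]
    by (cases f; cases g) (simp add: fun_eq_iff)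
qed

lemma parallel_cells_trans: "parallel_cells A B \<Longrightarrow> parallel_cells B C \<Longrightarrow> parallel_cells A C"
  and parallel_cells_refl: "A \<in> one_cells D \<Longrightarrow> parallel_cells A A"
  by (auto simp: parallel_cells_def)

lemma parallel_weight: "parallel_cells A B \<Longrightarrow> q < size1 B \<Longrightarrow> p < size1 A \<Longrightarrow>
    ww (summand_word A p) = ww (summand_word B q)"
  by (simp add: parallel_cells_def one_cell_weight')

lemma zero_entry_closed: "parallel_cells A B \<Longrightarrow> q < size1 B \<Longrightarrow> p < size1 A \<Longrightarrow>
    ze A B q p \<in> entry_hom A B q p"
  unfolding zero_entry_def entry_hom_def by (intro zer_closed parallel_weight)

lemma entry_monoid:
  assumes "parallel_cells A B" "q < size1 B" "p < size1 A"
  shows "commutative_monoid_on (entry_hom A B q p) add (ze A B q p)"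
proof
  show "ze A B q p \<in> entry_hom A B q p" by (rule zero_entry_closed[OF assms])
qed (unfold entry_hom_def zero_entry_def,
     (rule add_closed cls_add_assoc cls_add_comm cls_add_zero; assumption)+)

lemma entry_vc_closed:
  assumes "X \<in> entry_hom B C q r" "Y \<in> entry_hom A B r p" "src1 A = src1 B"
  shows "vc X Y \<in> entry_hom A C q p"
  using vc_closed[OF assms(1,2)[unfolded entry_hom_def assms(3)]]
  by (simp add: entry_hom_def assms(3))

lemma vc_zero_entry:
  assumes "parallel_cells A B" "parallel_cells B C" "q < size1 C" "r < size1 B" "p < size1 A"
  shows "X \<in> entry_hom B C q r \<Longrightarrow> vc X (ze A B r p) = ze A C q p"
    and "Y \<in> entry_hom A B r p \<Longrightarrow> vc (ze B C q r) Y = ze A C q p"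
proof -
  note W = parallel_weight[OF assms(1,4,5)] parallel_weight[OF assms(2,3,4)]
  have src: "src1 A = src1 B" using assms(1) by (simp add: parallel_cells_def)
  show "vc X (ze A B r p) = ze A C q p" if "X \<in> entry_hom B C q r"
    using cls_vc_zero(1)[OF that[unfolded entry_hom_def] W(1),
        of "summand_shift B r - summand_shift A p"]
    by (simp add: zero_entry_def src)
  show "vc (ze B C q r) Y = ze A C q p" if "Y \<in> entry_hom A B r p"
    using cls_vc_zero(2)[OF that[unfolded entry_hom_def] W(2),
        of "summand_shift C q - summand_shift B r"]
    by (simp add: zero_entry_def src)
qed

lemma entry_vcomp:
  assumes "f \<in> hom2 U B C" "g \<in> hom2 U A B" "q < size1 C" "p < size1 A"
  shows "entry (vcomp f g) q p =
    lsum add (ze A C q p) (\<lambda>r. vc (entry f q r) (entry g r p)) (size1 B)"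
  using assms by (simp add: vcomp_two_cell_def entry_matrix_cell lsum_def hom2_cells)

lemma vcomp_closed:
  assumes f: "f \<in> hom2 U B C" and g: "g \<in> hom2 U A B"
  shows "vcomp f g \<in> hom2 U A C"
proof -
  have AB: "parallel_cells A B" and BC: "parallel_cells B C" using f g by (auto dest: hom2_cells)
  have "lsum add (ze A C q p) (\<lambda>r. vc (entry f q r) (entry g r p)) (size1 B) \<in> entry_hom A C q p"
    if "q < size1 C" "p < size1 A" for q p
  proof -
    interpret commutative_monoid_on "entry_hom A C q p" add "ze A C q p"
      by (rule entry_monoid[OF parallel_cells_trans[OF AB BC] that])
    show ?thesis using AB that
      by (intro S_closed entry_vc_closed[OF hom2_entry[OF f] hom2_entry[OF g]])
         (auto simp: parallel_cells_def)
  qed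
  then show ?thesis unfolding vcomp_two_cell_def hom2_cells[OF f] hom2_cells[OF g] lsum_def
    by (intro matrix_cell_hom2 parallel_cells_trans[OF AB BC])
qed

text \<open>Associativity of matrix multiplication: distributivity on both sides, entrywise
  associativity, and an exchange of the two intermediate indices.\<close>

lemma vcomp_assoc_cells:
  assumes f: "f \<in> hom2 U A3 A4" and g: "g \<in> hom2 U A2 A3" and h: "h \<in> hom2 U A1 A2"
  shows "vcomp (vcomp f g) h =
    vcomp f (vcomp g h)"
proof (rule two_cell_eqI)
  note cells = hom2_cells(1)[OF f] hom2_cells(1)[OF g] hom2_cells(1)[OF h]
  note p24 = parallel_cells_trans[OF cells(2,1)] and p13 = parallel_cells_trans[OF cells(3,2)]
  note p14 = parallel_cells_trans[OF p13 cells(1)]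
  have src: "src1 A1 = src1 A2" "src1 A2 = src1 A3" "src1 A3 = src1 A4" using cells
    by (auto simp: parallel_cells_def)
  show fg: "vcomp (vcomp f g) h \<in> hom2 U A1 A4"
    "vcomp f (vcomp g h) \<in> hom2 U A1 A4"
    using f g h by (auto intro: vcomp_closed)
  fix q p assume q: "q < size1 A4" and p: "p < size1 A1"
  note f' = hom2_entry[OF f] and g' = hom2_entry[OF g] and h' = hom2_entry[OF h]
  interpret commutative_monoid_on "entry_hom A1 A4 q p" add "ze A1 A4 q p"
    by (rule entry_monoid[OF p14 q p])
  let ?f = "entry f" and ?g = "entry g" and ?h = "entry h"
  have fg': "vc (?f q s) (?g s r) \<in> entry_hom A2 A4 q r" if "s < size1 A3" "r < size1 A2" for s r
    by (rule entry_vc_closed[OF f' g']) (use that q src in auto)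
  have gh': "vc (?g s r) (?h r p) \<in> entry_hom A1 A3 s p" if "s < size1 A3" "r < size1 A2" for s r
    by (rule entry_vc_closed[OF g' h']) (use that p src in auto)
  have assoc': "vc (vc (?f q s) (?g s r)) (?h r p) = vc (?f q s) (vc (?g s r) (?h r p))"
    if "s < size1 A3" "r < size1 A2" for s r
    by (rule cls_vc_assoc[OF f'[unfolded entry_hom_def] g'[unfolded entry_hom_def src(2)]
          h'[unfolded entry_hom_def src(1,2)]]) (use that q p in auto)
  have 1: "vc (lsum add (ze A2 A4 q r) (\<lambda>s. vc (?f q s) (?g s r)) (size1 A3)) (?h r p) =
      lsum add (ze A1 A4 q p) (\<lambda>s. vc (vc (?f q s) (?g s r)) (?h r p)) (size1 A3)"
    if r: "r < size1 A2" for r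
    by (rule commutative_monoid_on.hom_S[OF entry_monoid[OF p24 q r], where h = "\<lambda>X. vc X (?h r p)"])
       (use r p q vc_zero_entry(2)[OF cells(3) p24 q r p h'] fg'
          cls_vc_add(1)[OF _ _ h'[unfolded entry_hom_def src(1), OF r p]] in \<open>auto simp: entry_hom_def\<close>)
  have 2: "vc (?f q s) (lsum add (ze A1 A3 s p) (\<lambda>r. vc (?g s r) (?h r p)) (size1 A2)) =
      lsum add (ze A1 A4 q p) (\<lambda>r. vc (?f q s) (vc (?g s r) (?h r p))) (size1 A2)"
    if s: "s < size1 A3" for s
    by (rule commutative_monoid_on.hom_S[OF entry_monoid[OF p13 s p], where h = "\<lambda>X. vc (?f q s) X"])
       (use s p q vc_zero_entry(1)[OF p13 cells(1) q s p f'] gh'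
          cls_vc_add(2)[OF f'[unfolded entry_hom_def src(3), OF q s]] src in \<open>auto simp: entry_hom_def\<close>)
  have "entry (vcomp (vcomp f g) h) q p =
    S (\<lambda>r. vc (entry (vcomp f g) q r) (?h r p)) (size1 A2)"
    by (rule entry_vcomp[OF vcomp_closed[OF f g] h q p])
  also have "\<dots> = S (\<lambda>r. S (\<lambda>s. vc (vc (?f q s) (?g s r)) (?h r p)) (size1 A3)) (size1 A2)"
    by (rule lsum_cong) (simp only: entry_vcomp[OF f g q] 1)
  also have "\<dots> = S (\<lambda>r. S (\<lambda>s. vc (?f q s) (vc (?g s r) (?h r p))) (size1 A3)) (size1 A2)"
    by (intro lsum_cong assoc')
  also have "\<dots> = S (\<lambda>s. S (\<lambda>r. vc (?f q s) (vc (?g s r) (?h r p))) (size1 A2)) (size1 A3)"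
    by (intro S_swap entry_vc_closed[OF f' gh']) (use q p src in auto)
  also have "\<dots> = S (\<lambda>s. vc (?f q s) (entry (vcomp g h) s p)) (size1 A3)"
    by (rule lsum_cong) (simp only: entry_vcomp[OF g h _ p] 2)
  also have "\<dots> = entry (vcomp f (vcomp g h)) q p"
    by (rule entry_vcomp[OF f vcomp_closed[OF g h] q p, symmetric])
  finally show "entry (vcomp (vcomp f g) h) q p =
    entry (vcomp f (vcomp g h)) q p" .
qed

lemma zero_entry_cong: "src1 A = src1 A' \<Longrightarrow> summands A ! p = summands A' ! p' \<Longrightarrow>
    summands B ! q = summands B' ! q' \<Longrightarrow> ze A B q p = ze A' B' q' p'"
  by (simp add: zero_entry_def)

text \<open>
  The identities, the zero 2-morphisms and the structure maps of biproducts are all matrices whose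
  entries are identities and zeros.
\<close>

definition selection_cell :: "('i, 'x) one_cell \<Rightarrow> ('i, 'x) one_cell \<Rightarrow> (nat \<Rightarrow> nat \<Rightarrow> bool) \<Rightarrow>
    ('i, 'x, 'k) two_cell" where
  "selection_cell A B R = matrix_cell A B
     (\<lambda>q p. if R q p then cl (Ident (src1 A) (summand_word A p)) else ze A B q p)"

text \<open>Equal summands have equal words and equal shifts, so at such a position the identity has
  the degree that the matrix requires.\<close>

definition selects :: "('i, 'x) one_cell \<Rightarrow> ('i, 'x) one_cell \<Rightarrow> (nat \<Rightarrow> nat \<Rightarrow> bool) \<Rightarrow> bool" where
  "selects A B R \<longleftrightarrow> parallel_cells A B \<and>
     (\<forall>q<size1 B. \<forall>p<size1 A. R q p \<longrightarrow> summands B ! q = summands A ! p)"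

lemma id_two_cell_selection: "idc A = selection_cell A A (=)"
  by (simp add: id_two_cell_def selection_cell_def)

lemma selects_eq: "A \<in> one_cells D \<Longrightarrow> selects A A (=)"
  by (simp add: selects_def parallel_cells_refl)

lemma ident_entry_closed: "summands B ! q = summands A ! p \<Longrightarrow>
    cl (Ident (src1 A) (summand_word A p)) \<in> entry_hom A B q p"
  by (simp add: entry_hom_def ident_closed)

lemma selection_closed: "selects A B R \<Longrightarrow> selection_cell A B R \<in> hom2 U A B"
  unfolding selection_cell_def selects_def
  by (intro matrix_cell_hom2) (auto intro: ident_entry_closed zero_entry_closed)

lemma entry_selection: "q < size1 B \<Longrightarrow> p < size1 A \<Longrightarrow> entry (selection_cell A B R) q p =
    (if R q p then cl (Ident (src1 A) (summand_word A p)) else ze A B q p)"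
  by (simp add: selection_cell_def entry_matrix_cell)

text \<open>When row \<open>q\<close> of the selection has a single nonzero entry, the product
  copies the corresponding row of \<open>f\<close>; when it has none, the product vanishes
  there.\<close>

lemma entry_selection_vcomp:
  assumes R: "selects B C R" and f: "f \<in> hom2 U A B" and q: "q < size1 C" and p: "p < size1 A"
  shows "r < size1 B \<Longrightarrow> R q r \<Longrightarrow> (\<And>s. s < size1 B \<Longrightarrow> R q s \<Longrightarrow> s = r) \<Longrightarrow>
      entry (vcomp (selection_cell B C R) f) q p = entry f r p"
    and "(\<And>s. s < size1 B \<Longrightarrow> \<not> R q s) \<Longrightarrow>
      entry (vcomp (selection_cell B C R) f) q p = ze A C q p"
proof -
  have AB: "parallel_cells A B" and BC: "parallel_cells B C"
    using R f by (auto simp: selects_def dest: hom2_cells)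
  have src: "src1 A = src1 B" using AB by (simp add: parallel_cells_def)
  interpret commutative_monoid_on "entry_hom A C q p" add "ze A C q p"
    by (rule entry_monoid[OF parallel_cells_trans[OF AB BC] q p])
  let ?g = "\<lambda>r. vc (entry (selection_cell B C R) q r) (entry f r p)"
  have zero: "?g s = ze A C q p" if "s < size1 B" "\<not> R q s" for s
    using vc_zero_entry(2)[OF AB BC q that(1) p hom2_entry[OF f that(1) p]] that q
    by (simp add: entry_selection)
  have E: "entry (vcomp (selection_cell B C R) f) q p = S ?g (size1 B)"
    by (rule entry_vcomp[OF selection_closed[OF R] f q p])
  show "entry (vcomp (selection_cell B C R) f) q p = ze A C q p"
    if "\<And>s. s < size1 B \<Longrightarrow> \<not> R q s"
    unfolding E by (rule S_zero) (use zero that in auto)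
  assume r: "r < size1 B" "R q r" and unique: "\<And>s. s < size1 B \<Longrightarrow> R q s \<Longrightarrow> s = r"
  have gr: "?g r = entry f r p"
    using cls_vc_id(1)[OF hom2_entry[OF f r(1) p, unfolded entry_hom_def]] r q
    by (simp add: entry_selection src)
  have "entry f r p \<in> entry_hom A C q p"
    using hom2_entry[OF f r(1) p] R q r by (simp add: entry_hom_def selects_def)
  then have "S ?g (size1 B) = ?g r"
    by (intro S_single[OF r(1)]) (simp only: gr, use zero unique in blast)
  then show "entry (vcomp (selection_cell B C R) f) q p = entry f r p"
    by (simp only: E gr)
qed

text \<open>Multiplication from the right is wanted only for the identity: the composites in the
  biproduct axioms are products of two selections, which \<open>entry_selection_vcomp\<close>
  covers.\<close>

lemma entry_vcomp_id:
  assumes f: "f \<in> hom2 U A B" and q: "q < size1 B" and p: "p < size1 A"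
  shows "entry (vcomp f (idc A)) q p = entry f q p"
proof -
  have AB: "parallel_cells A B" using f by (auto dest: hom2_cells)
  then have A: "A \<in> one_cells D" by (simp add: parallel_cells_def)
  interpret commutative_monoid_on "entry_hom A B q p" add "ze A B q p"
    by (rule entry_monoid[OF AB q p])
  let ?g = "\<lambda>r. vc (entry f q r) (entry (idc A) r p)"
  have zero: "?g s = ze A B q p" if "s < size1 A" "s \<noteq> p" for s
    using vc_zero_entry(1)[OF parallel_cells_refl[OF A] AB q that(1) p hom2_entry[OF f q that(1)]]
      that p by (simp add: id_two_cell_selection entry_selection)
  have E: "entry (vcomp f (idc A)) q p = S ?g (size1 A)"
    unfolding id_two_cell_selection
    by (rule entry_vcomp[OF f selection_closed[OF selects_eq[OF A]] q p])
  have gp: "?g p = entry f q p"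
    using cls_vc_id(2)[OF hom2_entry[OF f q p, unfolded entry_hom_def]] p
    by (simp add: id_two_cell_selection entry_selection)
  have "S ?g (size1 A) = ?g p"
    by (rule S_single[OF p]) (simp only: gp hom2_entry[OF f q p], rule zero)
  then show ?thesis by (simp only: E gp)
qed

lemma id_two_cell_closed: "A \<in> one_cells D \<Longrightarrow> idc A \<in> hom2 U A A"
  unfolding id_two_cell_selection by (intro selection_closed selects_eq)

lemma vcomp_id_cells:
  assumes f: "f \<in> hom2 U A B"
  shows "vcomp (idc B) f = f"
    and "vcomp f (idc A) = f"
proof -
  have A: "A \<in> one_cells D" and B: "B \<in> one_cells D"
    using hom2_cells(1)[OF f] by (auto simp: parallel_cells_def)
  show "vcomp (idc B) f = f"
    by (rule two_cell_eqI[OF vcomp_closed[OF id_two_cell_closed[OF B] f] f])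
       (unfold id_two_cell_selection, rule entry_selection_vcomp(1)[OF selects_eq[OF B] f]; simp)
  show "vcomp f (idc A) = f"
    by (rule two_cell_eqI[OF vcomp_closed[OF f id_two_cell_closed[OF A]] f]) (rule entry_vcomp_id[OF f])
qed


section \<open>The entrywise linear structure\<close>

lemma add_two_cell_closed:
  "f \<in> hom2 U A B \<Longrightarrow> g \<in> hom2 U A B \<Longrightarrow> addc f g \<in> hom2 U A B"
  unfolding add_two_cell_def
  by (simp add: hom2_cells, intro matrix_cell_hom2)
     (auto simp: entry_hom_def hom2_cells intro!: add_closed dest: hom2_entry)

lemma smult_two_cell_closed: "f \<in> hom2 U A B \<Longrightarrow> smultc a f \<in> hom2 U A B"
  unfolding smult_two_cell_def
  by (simp add: hom2_cells, intro matrix_cell_hom2)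
     (auto simp: entry_hom_def hom2_cells intro!: smul_closed dest: hom2_entry)

lemma zero_two_cell_closed: "parallel_cells A B \<Longrightarrow> zero_two_cell D t P A B \<in> hom2 U A B"
  unfolding zero_two_cell_def by (intro matrix_cell_hom2 zero_entry_closed)

lemma entry_add: "f \<in> hom2 U A B \<Longrightarrow> q < size1 B \<Longrightarrow> p < size1 A \<Longrightarrow>
    entry (addc f g) q p = add (entry f q p) (entry g q p)"
  by (simp add: add_two_cell_def entry_matrix_cell hom2_cells)

lemma entry_smult: "f \<in> hom2 U A B \<Longrightarrow> q < size1 B \<Longrightarrow> p < size1 A \<Longrightarrow>
    entry (smultc a f) q p = sm a (entry f q p)"
  by (simp add: smult_two_cell_def entry_matrix_cell hom2_cells)

lemma entry_zero: "q < size1 B \<Longrightarrow> p < size1 A \<Longrightarrow>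
    entry (zero_two_cell D t P A B) q p = ze A B q p"
  by (simp add: zero_two_cell_def entry_matrix_cell)

lemma vcomp_add_cells:
  assumes f: "f \<in> hom2 U B C" and g: "g \<in> hom2 U B C" and h: "h \<in> hom2 U A B"
  shows "vcomp (addc f g) h =
    addc (vcomp f h) (vcomp g h)"
proof (rule two_cell_eqI)
  note fg = add_two_cell_closed[OF f g]
  show "vcomp (addc f g) h \<in> hom2 U A C"
    "addc (vcomp f h) (vcomp g h) \<in> hom2 U A C"
    by (intro vcomp_closed[OF fg h] add_two_cell_closed vcomp_closed[OF f h] vcomp_closed[OF g h])+
  fix q p assume q: "q < size1 C" and p: "p < size1 A"
  note cells = hom2_cells(1)[OF f] hom2_cells(1)[OF h]
  have src: "src1 A = src1 B" using cells by (simp add: parallel_cells_def)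
  interpret commutative_monoid_on "entry_hom A C q p" add "ze A C q p"
    by (rule entry_monoid[OF parallel_cells_trans[OF cells(2,1)] q p])
  have "vc (entry (addc f g) q r) (entry h r p) =
     add (vc (entry f q r) (entry h r p)) (vc (entry g q r) (entry h r p))" if r: "r < size1 B" for r
    unfolding entry_add[OF f q r]
    by (rule cls_vc_add(1)[OF hom2_entry[OF f q r, unfolded entry_hom_def]
          hom2_entry[OF g q r, unfolded entry_hom_def] hom2_entry[OF h r p, unfolded entry_hom_def src]])
  then show "entry (vcomp (addc f g) h) q p =
      entry (addc (vcomp f h) (vcomp g h)) q p"
    unfolding entry_vcomp[OF fg h q p] entry_add[OF vcomp_closed[OF f h] q p]
      entry_vcomp[OF f h q p] entry_vcomp[OF g h q p]
    by (subst S_add[symmetric])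
       (auto intro!: lsum_cong entry_vc_closed[OF hom2_entry[OF f] hom2_entry[OF h]]
         entry_vc_closed[OF hom2_entry[OF g] hom2_entry[OF h]] simp: q p src)
qed

lemma vcomp_add_right_cells:
  assumes f: "f \<in> hom2 U A B" and g: "g \<in> hom2 U A B" and h: "h \<in> hom2 U B C"
  shows "vcomp h (addc f g) =
    addc (vcomp h f) (vcomp h g)"
proof (rule two_cell_eqI)
  note fg = add_two_cell_closed[OF f g]
  show "vcomp h (addc f g) \<in> hom2 U A C"
    "addc (vcomp h f) (vcomp h g) \<in> hom2 U A C"
    by (intro vcomp_closed[OF h fg] add_two_cell_closed vcomp_closed[OF h f] vcomp_closed[OF h g])+
  fix q p assume q: "q < size1 C" and p: "p < size1 A"
  note cells = hom2_cells(1)[OF f] hom2_cells(1)[OF h]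
  have src: "src1 A = src1 B" using cells by (simp add: parallel_cells_def)
  interpret commutative_monoid_on "entry_hom A C q p" add "ze A C q p"
    by (rule entry_monoid[OF parallel_cells_trans[OF cells] q p])
  have "vc (entry h q r) (entry (addc f g) r p) =
     add (vc (entry h q r) (entry f r p)) (vc (entry h q r) (entry g r p))" if r: "r < size1 B" for r
    unfolding entry_add[OF f r p]
    by (rule cls_vc_add(2)[OF hom2_entry[OF h q r, unfolded entry_hom_def]
          hom2_entry[OF f r p, unfolded entry_hom_def src] hom2_entry[OF g r p, unfolded entry_hom_def src]])
  then show "entry (vcomp h (addc f g)) q p =
      entry (addc (vcomp h f) (vcomp h g)) q p"
    unfolding entry_vcomp[OF h fg q p] entry_add[OF vcomp_closed[OF h f] q p]
      entry_vcomp[OF h f q p] entry_vcomp[OF h g q p]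
    by (subst S_add[symmetric])
       (auto intro!: lsum_cong entry_vc_closed[OF hom2_entry[OF h] hom2_entry[OF f]]
         entry_vc_closed[OF hom2_entry[OF h] hom2_entry[OF g]] simp: q p src)
qed

lemma smul_zero_entry: "parallel_cells A B \<Longrightarrow> q < size1 B \<Longrightarrow> p < size1 A \<Longrightarrow>
    sm a (ze A B q p) = ze A B q p"
  unfolding zero_entry_def by (intro cls_smul_zero parallel_weight)

lemma vcomp_smult_cells:
  assumes f: "f \<in> hom2 U B C" and g: "g \<in> hom2 U A B"
  shows "vcomp (smultc a f) g =
      smultc a (vcomp f g)" (is ?left)
    and "vcomp f (smultc a g) =
      smultc a (vcomp f g)" (is ?right)
proof -
  note cells = hom2_cells(1)[OF f] hom2_cells(1)[OF g]
  have src: "src1 A = src1 B" using cells by (simp add: parallel_cells_def)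
  note AC = parallel_cells_trans[OF cells(2,1)]
  note f' = smult_two_cell_closed[OF f, of a] and g' = smult_two_cell_closed[OF g, of a]
  note fg = smult_two_cell_closed[OF vcomp_closed[OF f g], of a]
  have E: "entry (smultc a (vcomp f g)) q p =
     lsum add (ze A C q p) (\<lambda>r. sm a (vc (entry f q r) (entry g r p))) (size1 B)"
    if q: "q < size1 C" and p: "p < size1 A" for q p
    unfolding entry_smult[OF vcomp_closed[OF f g] q p] entry_vcomp[OF f g q p]
  proof (rule commutative_monoid_on.hom_S[OF entry_monoid[OF AC q p]], goal_cases)
    case 1
    show ?case by (rule smul_zero_entry[OF AC q p])
  next
    case (2 x y)
    then show ?case unfolding entry_hom_def by (rule cls_smul_add)
  next
    case (3 r)
    show ?case by (rule entry_vc_closed[OF hom2_entry[OF f q 3] hom2_entry[OF g 3 p] src])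
  qed
  show ?left
    by (rule two_cell_eqI[OF vcomp_closed[OF f' g] fg])
       (unfold E entry_vcomp[OF f' g], intro lsum_cong, simp add: entry_smult[OF f],
        rule cls_vc_smul(1)[OF hom2_entry[OF f, unfolded entry_hom_def]
          hom2_entry[OF g, unfolded entry_hom_def src]])
  show ?right
    by (rule two_cell_eqI[OF vcomp_closed[OF f g'] fg])
       (unfold E entry_vcomp[OF f g'], intro lsum_cong, simp add: entry_smult[OF g],
        rule cls_vc_smul(2)[OF hom2_entry[OF f, unfolded entry_hom_def]
          hom2_entry[OF g, unfolded entry_hom_def src]])
qed

section \<open>Horizontal composition as a Kronecker product of matrices\<close>

lemma comp_one_cells: "A \<in> one_cells D \<Longrightarrow> B \<in> one_cells D \<Longrightarrow> src1 A = tgt1 B \<Longrightarrow>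
    cc A B \<in> one_cells D"
proof -
  assume A: "A \<in> one_cells D" and B: "B \<in> one_cells D" and src: "src1 A = tgt1 B"
  have "src1 B + ww (W @ V) = tgt1 A"
    if "(W, s) \<in> set (summands A)" "(V, r) \<in> set (summands B)" for W s V r
  proof -
    have "tgt1 B + ww W = tgt1 A" "src1 B + ww V = tgt1 B"
      using that A B src by (auto simp: one_cells_def)
    then show ?thesis by (simp add: algebra_simps flip: add.assoc)
  qed
  then show ?thesis by (auto simp: one_cells_def comp_one_cell_def)
qed

lemma comp_parallel: "parallel_cells A A' \<Longrightarrow> parallel_cells B B' \<Longrightarrow> src1 A = tgt1 B \<Longrightarrow>
    parallel_cells (cc A B) (cc A' B')"
  by (auto simp: parallel_cells_def intro: comp_one_cells)

text \<open>Two entries compose horizontally if the source weight of the left one is the target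
  weight of the chosen word on the right; membership in \<open>one_cells\<close> supplies this for
  each summand.\<close>

lemma hc_entry_closed:
  assumes AA: "parallel_cells A A'" and BB: "parallel_cells B B'" and src: "src1 A = tgt1 B"
    and q: "q < size1 A' * size1 B'" and p: "p < size1 A * size1 B"
    and X: "X \<in> entry_hom A A' (q div size1 B') (p div size1 B)"
    and Y: "Y \<in> entry_hom B B' (q mod size1 B') (p mod size1 B)"
  shows "hc X Y \<in> entry_hom (cc A B) (cc A' B') q p"
proof -
  have "src1 A = src1 B + ww (summand_word B (p mod size1 B))"
    using one_cell_weight[of B "p mod size1 B"] BB src div_mod_less[OF p]
    by (simp add: parallel_cells_def)
  from hc_closed[OF X[unfolded entry_hom_def this] Y[unfolded entry_hom_def]]
  show ?thesis by (simp add: entry_hom_def nth_comp_one_cell q p algebra_simps)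
qed

lemma hc_zero_entry:
  assumes AA: "parallel_cells A A'" and BB: "parallel_cells B B'" and src: "src1 A = tgt1 B"
    and q: "q < size1 A' * size1 B'" and p: "p < size1 A * size1 B"
  shows "X \<in> entry_hom A A' (q div size1 B') (p div size1 B) \<Longrightarrow>
      hc X (ze B B' (q mod size1 B') (p mod size1 B)) = ze (cc A B) (cc A' B') q p"
    and "Y \<in> entry_hom B B' (q mod size1 B') (p mod size1 B) \<Longrightarrow>
      hc (ze A A' (q div size1 B') (p div size1 B)) Y = ze (cc A B) (cc A' B') q p"
proof -
  have A: "src1 A = src1 B + ww (summand_word B (p mod size1 B))"
    using one_cell_weight[of B "p mod size1 B"] BB src div_mod_less[OF p]
    by (simp add: parallel_cells_def)
  note W = parallel_weight[OF AA div_mod_less(1)[OF q] div_mod_less(1)[OF p]]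
    parallel_weight[OF BB div_mod_less(2)[OF q] div_mod_less(2)[OF p]]
  show "hc X (ze B B' (q mod size1 B') (p mod size1 B)) = ze (cc A B) (cc A' B') q p"
    if "X \<in> entry_hom A A' (q div size1 B') (p div size1 B)"
    using cls_hc_zero(1)[OF that[unfolded entry_hom_def A] W(2),
        of "summand_shift B' (q mod size1 B') - summand_shift B (p mod size1 B)"]
    by (simp add: zero_entry_def nth_comp_one_cell q p algebra_simps)
  show "hc (ze A A' (q div size1 B') (p div size1 B)) Y = ze (cc A B) (cc A' B') q p"
    if "Y \<in> entry_hom B B' (q mod size1 B') (p mod size1 B)"
    using cls_hc_zero(2)[OF that[unfolded entry_hom_def] W(1),
        of "summand_shift A' (q div size1 B') - summand_shift A (p div size1 B)"]
    by (simp add: zero_entry_def nth_comp_one_cell q p algebra_simps flip: A)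
qed

lemma entry_hcomp:
  assumes "f \<in> hom2 U A A'" "g \<in> hom2 U B B'" "q < size1 A' * size1 B'" "p < size1 A * size1 B"
  shows "entry (hcomp f g) q p = hc (entry f (q div size1 B') (p div size1 B))
    (entry g (q mod size1 B') (p mod size1 B))"
  using assms by (simp add: hcomp_two_cell_def entry_matrix_cell hom2_cells size1_comp)

lemma hcomp_closed:
  assumes f: "f \<in> hom2 U A A'" and g: "g \<in> hom2 U B B'" and src: "src1 A = tgt1 B"
  shows "hcomp f g \<in> hom2 U (cc A B) (cc A' B')"
  unfolding hcomp_two_cell_def hom2_cells[OF f] hom2_cells[OF g]
  by (intro matrix_cell_hom2 comp_parallel hom2_cells(1)[OF f] hom2_cells(1)[OF g] src
      hc_entry_closed hom2_entry[OF f] hom2_entry[OF g]) (auto simp: size1_comp div_mod_less)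

text \<open>By \<open>nat_div_mod_mult\<close> both bracketings address the same entries of
  \<open>f\<close>, \<open>g\<close> and \<open>h\<close>, which leaves associativity of the
  classes.\<close>

lemma hcomp_assoc_cells:
  assumes f: "f \<in> hom2 U A A'" and g: "g \<in> hom2 U B B'" and h: "h \<in> hom2 U C C'"
    and src: "src1 A = tgt1 B" "src1 B = tgt1 C"
  shows "hcomp (hcomp f g) h = hcomp f (hcomp g h)"
proof (rule two_cell_eqI)
  note fg = hcomp_closed[OF f g src(1)] and gh = hcomp_closed[OF g h src(2)]
  show "hcomp (hcomp f g) h \<in> hom2 U (cc A (cc B C)) (cc A' (cc B' C'))"
    using hcomp_closed[OF fg h] src by (simp add: comp_one_cell_assoc)
  show "hcomp f (hcomp g h) \<in> hom2 U (cc A (cc B C)) (cc A' (cc B' C'))"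
    using hcomp_closed[OF f gh] src by simp
  fix q p assume "q < size1 (cc A' (cc B' C'))" "p < size1 (cc A (cc B C))"
  then have q: "q < size1 A' * (size1 B' * size1 C')" and p: "p < size1 A * (size1 B * size1 C)"
    by (simp_all add: size1_comp)
  then have q': "q < size1 (cc A' B') * size1 C'" "q < size1 A' * size1 (cc B' C')"
    and p': "p < size1 (cc A B) * size1 C" "p < size1 A * size1 (cc B C)"
    by (simp_all add: size1_comp ac_simps)
  note dq = div_mod_less[OF q'(1)] div_mod_less[OF q'(2)]
    and dp = div_mod_less[OF p'(1)] div_mod_less[OF p'(2)]
  note dq' = div_mod_less[OF dq(1)[unfolded size1_comp]] div_mod_less[OF dq(4)[unfolded size1_comp]]
    and dp' = div_mod_less[OF dp(1)[unfolded size1_comp]] div_mod_less[OF dp(4)[unfolded size1_comp]]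
  have B: "parallel_cells B B'" and C: "parallel_cells C C'" using hom2_cells g h by blast+
  have wC: "src1 B = src1 C + ww (summand_word C (p mod size1 C))"
    using one_cell_weight[of C "p mod size1 C"] C src dp(2) by (simp add: parallel_cells_def)
  have wB: "src1 A = src1 C + ww (summand_word C (p mod size1 C)) +
      ww (summand_word B (p div size1 C mod size1 B))"
    using one_cell_weight[of B "p div size1 C mod size1 B"] B src dp' by (simp add: parallel_cells_def wC)
  have "hc (hc (entry f (q div size1 C' div size1 B') (p div size1 C div size1 B))
       (entry g (q div size1 C' mod size1 B') (p div size1 C mod size1 B)))
       (entry h (q mod size1 C') (p mod size1 C)) =
     hc (entry f (q div size1 C' div size1 B') (p div size1 C div size1 B))
       (hc (entry g (q div size1 C' mod size1 B') (p div size1 C mod size1 B))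
       (entry h (q mod size1 C') (p mod size1 C)))"
    by (rule cls_hc_assoc[OF hom2_entry[OF f, unfolded entry_hom_def wB]
          hom2_entry[OF g, unfolded entry_hom_def wC] hom2_entry[OF h, unfolded entry_hom_def]])
       (use dq dp dq' dp' in auto)
  then show "entry (hcomp (hcomp f g) h) q p = entry (hcomp f (hcomp g h)) q p"
    using entry_hcomp[OF fg h q'(1) p'(1)] entry_hcomp[OF f gh q'(2) p'(2)]
      entry_hcomp[OF f g dq(1)[unfolded size1_comp] dp(1)[unfolded size1_comp]]
      entry_hcomp[OF g h dq(4)[unfolded size1_comp] dp(4)[unfolded size1_comp]]
      nat_div_mod_mult[OF q] nat_div_mod_mult[OF p]
    by (simp add: size1_comp)
qed

lemma id_one_cell_closed: "id_one_cell m \<in> one_cells D"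
  by (simp add: one_cells_def id_one_cell_def)

text \<open>The identity 1-morphism has one summand, the empty word without shift; its identity
  matrix is one by one, and the index digit belonging to it is 0.\<close>

lemma hcomp_id_cells:
  assumes f: "f \<in> hom2 U A B"
  shows "hcomp (idc (id_one_cell (tgt1 A))) f = f"
    and "hcomp f (idc (id_one_cell (src1 A))) = f"
proof -
  have AB: "parallel_cells A B" using hom2_cells[OF f] by simp
  have BA: "tgt1 B = tgt1 A" "src1 B = src1 A" using AB by (auto simp: parallel_cells_def)
  have i: "idc (id_one_cell m) \<in> hom2 U (id_one_cell m) (id_one_cell m)" for m
    by (rule id_two_cell_closed[OF id_one_cell_closed])
  have cA: "cc (id_one_cell (tgt1 A)) A = A" "cc (id_one_cell (tgt1 A)) B = B"
    "cc A (id_one_cell (src1 A)) = A" "cc B (id_one_cell (src1 A)) = B"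
    using comp_one_cell_id[of A] comp_one_cell_id[of B] BA by simp_all
  have E: "entry (idc (id_one_cell m)) 0 0 = cl (Ident m [])" for m
    by (simp add: id_two_cell_selection entry_selection)
  have l: "hcomp (idc (id_one_cell (tgt1 A))) f \<in> hom2 U A B"
    using hcomp_closed[OF i f] by (simp add: cA)
  have r: "hcomp f (idc (id_one_cell (src1 A))) \<in> hom2 U A B"
    using hcomp_closed[OF f i] by (simp add: cA)
  show "hcomp (idc (id_one_cell (tgt1 A))) f = f"
  proof (rule two_cell_eqI[OF l f])
    fix q p assume q: "q < size1 B" and p: "p < size1 A"
    have "tgt1 A = src1 A + ww (summand_word A p)"
      using AB p one_cell_weight[of A p] by (simp add: parallel_cells_def)
    then show "entry (hcomp (idc (id_one_cell (tgt1 A))) f) q p = entry f q p"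
      using entry_hcomp[OF i[of "tgt1 A"] f, of q p] q p E
        cls_hc_id(1)[OF hom2_entry[OF f q p, unfolded entry_hom_def]] by simp
  qed
  show "hcomp f (idc (id_one_cell (src1 A))) = f"
  proof (rule two_cell_eqI[OF r f])
    fix q p assume q: "q < size1 B" and p: "p < size1 A"
    show "entry (hcomp f (idc (id_one_cell (src1 A)))) q p = entry f q p"
      using entry_hcomp[OF f i[of "src1 A"], of q p] q p E
        cls_hc_id(2)[OF hom2_entry[OF f q p, unfolded entry_hom_def]] by simp
  qed
qed

lemma entry_id: "q < size1 A \<Longrightarrow> p < size1 A \<Longrightarrow> entry (idc A) q p =
    (if q = p then cl (Ident (src1 A) (summand_word A p)) else ze A A q p)"
  by (simp add: id_two_cell_selection entry_selection)

lemma hcomp_id2_cells: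
  assumes A: "A \<in> one_cells D" and B: "B \<in> one_cells D" and src: "src1 A = tgt1 B"
  shows "hcomp (idc A) (idc B) = idc (cc A B)"
proof (rule two_cell_eqI)
  note a = id_two_cell_closed[OF A] and b = id_two_cell_closed[OF B]
  show "hcomp (idc A) (idc B) \<in> hom2 U (cc A B) (cc A B)"
    by (rule hcomp_closed[OF a b src])
  show "idc (cc A B) \<in> hom2 U (cc A B) (cc A B)"
    by (rule id_two_cell_closed[OF comp_one_cells[OF A B src]])
  fix q p assume "q < size1 (cc A B)" "p < size1 (cc A B)"
  then have q: "q < size1 A * size1 B" and p: "p < size1 A * size1 B" by (simp_all add: size1_comp)
  note dq = div_mod_less[OF q] and dp = div_mod_less[OF p]
  note AA = parallel_cells_refl[OF A] and BB = parallel_cells_refl[OF B]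
  let ?b = "size1 B"
  have w: "src1 A = src1 B + ww (summand_word B (p mod ?b))"
    using one_cell_weight[OF B dp(2)] src by simp
  have E: "entry (hcomp (idc A) (idc B)) q p =
    hc (entry (idc A) (q div ?b) (p div ?b))
       (entry (idc B) (q mod ?b) (p mod ?b))"
    by (rule entry_hcomp[OF a b q p])
  \<comment> \<open>Off the diagonal the quotients or the remainders differ, so one of the two
    identity matrices contributes a zero.\<close>
  have "q = p \<longleftrightarrow> q div ?b = p div ?b \<and> q mod ?b = p mod ?b" by (metis div_mult_mod_eq)
  then consider "q = p" | "q \<noteq> p" "q div ?b \<noteq> p div ?b" | "q \<noteq> p" "q mod ?b \<noteq> p mod ?b" by blast
  then show "entry (hcomp (idc A) (idc B)) q p =
      entry (idc (cc A B)) q p"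
  proof cases
    case 1
    then show ?thesis unfolding E using q p dq dp cls_hc_Ident[of "src1 B"]
      by (simp add: entry_id size1_comp nth_comp_one_cell w)
  next
    case 2
    then show ?thesis
      using q p dq dp hc_zero_entry(2)[OF AA BB src q p hom2_entry[OF b dq(2) dp(2)]]
      by (simp add: E entry_id size1_comp)
  next
    case 3
    then show ?thesis
      using q p dq dp hc_zero_entry(1)[OF AA BB src q p hom2_entry[OF a dq(1) dp(1)]]
      by (simp add: E entry_id[of "q mod ?b"] entry_id[of q] size1_comp)
  qed
qed

text \<open>The mixed-product rule for Kronecker products: distributivity gives a double sum over
  the two intermediate indices, entrywise interchange rewrites its terms, and \<open>S_prod\<close>
  merges the two indices into the one of the composite.\<close>

lemma interchange_cells:
  assumes f: "f \<in> hom2 U A2 A3" and f': "f' \<in> hom2 U A1 A2"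
    and g: "g \<in> hom2 U B2 B3" and g': "g' \<in> hom2 U B1 B2" and src: "src1 A1 = tgt1 B1"
  shows "hcomp (vcomp f f') (vcomp g g') = vcomp (hcomp f g) (hcomp f' g')"
proof (rule two_cell_eqI)
  note A = hom2_cells(1)[OF f'] hom2_cells(1)[OF f] and B = hom2_cells(1)[OF g'] hom2_cells(1)[OF g]
  have src2: "src1 A2 = tgt1 B2" and sA: "src1 A1 = src1 A2" and sB: "src1 B1 = src1 B2"
    using A B src by (simp_all add: parallel_cells_def)
  note ff = vcomp_closed[OF f f'] and gg = vcomp_closed[OF g g']
  note fg = hcomp_closed[OF f g src2] and fg' = hcomp_closed[OF f' g' src]
  show "hcomp (vcomp f f') (vcomp g g') \<in> hom2 U (cc A1 B1) (cc A3 B3)"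
    by (rule hcomp_closed[OF ff gg src])
  show "vcomp (hcomp f g) (hcomp f' g') \<in> hom2 U (cc A1 B1) (cc A3 B3)"
    by (rule vcomp_closed[OF fg fg'])
  note A13 = parallel_cells_trans[OF A] and B13 = parallel_cells_trans[OF B]
  fix q p assume qp: "q < size1 (cc A3 B3)" "p < size1 (cc A1 B1)"
  then have q: "q < size1 A3 * size1 B3" and p: "p < size1 A1 * size1 B1"
    by (simp_all add: size1_comp)
  note dq = div_mod_less[OF q] and dp = div_mod_less[OF p]
  let ?q = "q div size1 B3" and ?q' = "q mod size1 B3"
  let ?p = "p div size1 B1" and ?p' = "p mod size1 B1"
  let ?f = "entry f" and ?f' = "entry f'" and ?g = "entry g" and ?g' = "entry g'"
  let ?Z = "ze (cc A1 B1) (cc A3 B3) q p"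
  interpret commutative_monoid_on "entry_hom (cc A1 B1) (cc A3 B3) q p" add ?Z
    by (rule entry_monoid[OF comp_parallel[OF A13 B13 src] qp])
  have w1: "src1 A1 = src1 B1 + ww (summand_word B1 ?p')"
    using one_cell_weight[of B1 ?p'] B dp src by (simp add: parallel_cells_def)
  have w2: "src1 A2 = src1 B1 + ww (summand_word B2 s)" if "s < size1 B2" for s
    using one_cell_weight[of B2 s] B that src2 sB by (simp add: parallel_cells_def)
  \<comment> \<open>\<open>cls_interchange\<close> measures both left factors by the weight of the
    intermediate word on the right; it equals the weight of the initial word since \<open>B1\<close>
    and \<open>B2\<close> are parallel.\<close>
  have w12: "ww (summand_word B2 s) = ww (summand_word B1 ?p')" if "s < size1 B2" for s
    using w1 w2[OF that] sA by simp
  have vF: "vc (?f ?q r) (?f' r ?p) \<in> entry_hom A1 A3 ?q ?p" if "r < size1 A2" for r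
    by (rule entry_vc_closed[OF hom2_entry[OF f dq(1) that] hom2_entry[OF f' that dp(1)] sA])
  have vG: "vc (?g ?q' s) (?g' s ?p') \<in> entry_hom B1 B3 ?q' ?p'" if "s < size1 B2" for s
    by (rule entry_vc_closed[OF hom2_entry[OF g dq(2) that] hom2_entry[OF g' that dp(2)] sB])
  let ?G = "entry (vcomp g g') ?q' ?p'"
  have G: "?G \<in> entry_hom B1 B3 ?q' ?p'" by (rule hom2_entry[OF gg dq(2) dp(2)])
  have 1: "hc (entry (vcomp f f') ?q ?p) ?G =
      S (\<lambda>r. hc (vc (?f ?q r) (?f' r ?p)) ?G) (size1 A2)"
    unfolding entry_vcomp[OF f f' dq(1) dp(1)]
  proof (rule commutative_monoid_on.hom_S[OF entry_monoid[OF A13 dq(1) dp(1)],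
        where h = "\<lambda>X. hc X ?G"], goal_cases)
    case 1
    show ?case by (rule hc_zero_entry(2)[OF A13 B13 src q p G])
  next
    case (2 x y)
    then show ?case using G unfolding entry_hom_def w1 by (rule cls_hc_add(1))
  next
    case (3 r)
    then show ?case by (rule vF)
  qed
  have 2: "hc X ?G = S (\<lambda>s. hc X (vc (?g ?q' s) (?g' s ?p'))) (size1 B2)"
    if X: "X \<in> entry_hom A1 A3 ?q ?p" for X
    unfolding entry_vcomp[OF g g' dq(2) dp(2)]
  proof (rule commutative_monoid_on.hom_S[OF entry_monoid[OF B13 dq(2) dp(2)],
        where h = "\<lambda>Y. hc X Y"], goal_cases)
    case 1
    show ?case by (rule hc_zero_entry(1)[OF A13 B13 src q p X])
  next
    case (2 x y)
    show ?case by (rule cls_hc_add(2)[OF X[unfolded entry_hom_def w1] 2[unfolded entry_hom_def]])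
  next
    case (3 s)
    then show ?case by (rule vG)
  qed
  have 3: "hc (vc (?f ?q r) (?f' r ?p)) (vc (?g ?q' s) (?g' s ?p')) =
      vc (hc (?f ?q r) (?g ?q' s)) (hc (?f' r ?p) (?g' s ?p'))"
    if r: "r < size1 A2" and s: "s < size1 B2" for r s
    by (rule cls_interchange[OF hom2_entry[OF f dq(1) r, unfolded entry_hom_def w2[OF s]]
          hom2_entry[OF f' r dp(1), unfolded entry_hom_def w1, folded w12[OF s]]
          hom2_entry[OF g dq(2) s, unfolded entry_hom_def, folded sB]
          hom2_entry[OF g' s dp(2), unfolded entry_hom_def]])
  let ?n = "size1 B2"
  have less: "r * ?n + s < size1 A2 * ?n" if r: "r < size1 A2" and s: "s < ?n" for r s
  proof -
    have "r * ?n + s < Suc r * ?n" using s by simp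
    also have "\<dots> \<le> size1 A2 * ?n" using r by (intro mult_right_mono) auto
    finally show ?thesis .
  qed
  have 4: "vc (entry (hcomp f g) q (r * ?n + s)) (entry (hcomp f' g') (r * ?n + s) p) =
      hc (vc (?f ?q r) (?f' r ?p)) (vc (?g ?q' s) (?g' s ?p'))"
    if r: "r < size1 A2" and s: "s < ?n" for r s
  proof -
    show ?thesis using s mult_add_div[OF s]
      unfolding 3[OF r s] entry_hcomp[OF f g q less[OF r s]] entry_hcomp[OF f' g' less[OF r s] p]
      by simp
  qed
  have "entry (hcomp (vcomp f f') (vcomp g g')) q p = hc (entry (vcomp f f') ?q ?p) ?G"
    by (rule entry_hcomp[OF ff gg q p])
  also have "\<dots> = S (\<lambda>r. S (\<lambda>s. hc (vc (?f ?q r) (?f' r ?p)) (vc (?g ?q' s) (?g' s ?p'))) ?n) (size1 A2)"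
    unfolding 1 by (intro lsum_cong 2 vF)
  also have "\<dots> = S (\<lambda>r. S (\<lambda>s. vc (entry (hcomp f g) q (r * ?n + s))
      (entry (hcomp f' g') (r * ?n + s) p)) ?n) (size1 A2)"
    by (intro lsum_cong 4[symmetric])
  also have "\<dots> = S (\<lambda>u. vc (entry (hcomp f g) q u) (entry (hcomp f' g') u p)) (size1 A2 * ?n)"
  proof (rule S_prod[symmetric])
    fix u assume "u < size1 A2 * ?n"
    then have u: "u < size1 (cc A2 B2)" by (simp add: size1_comp)
    show "vc (entry (hcomp f g) q u) (entry (hcomp f' g') u p) \<in> entry_hom (cc A1 B1) (cc A3 B3) q p"
      by (rule entry_vc_closed[OF hom2_entry[OF fg qp(1) u] hom2_entry[OF fg' u qp(2)]]) (simp add: sB)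
  qed
  also have "\<dots> = entry (vcomp (hcomp f g) (hcomp f' g')) q p"
    using entry_vcomp[OF fg fg' qp] by (simp add: size1_comp)
  finally show "entry (hcomp (vcomp f f') (vcomp g g')) q p =
    entry (vcomp (hcomp f g) (hcomp f' g')) q p" .
qed

text \<open>An entry of a horizontal composite is a single product, so in contrast to
  \<open>vcomp_add_cells\<close> bilinearity on classes applies directly.\<close>

lemma hcomp_add_cells:
  assumes f: "f \<in> hom2 U A A'" and g: "g \<in> hom2 U A A'" and h: "h \<in> hom2 U B B'"
    and src: "src1 A = tgt1 B"
  shows "hcomp (addc f g) h = addc (hcomp f h) (hcomp g h)"
proof (rule two_cell_eqI)
  note fh = hcomp_closed[OF f h src] and gh = hcomp_closed[OF g h src] and fg = add_two_cell_closed[OF f g]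
  show "hcomp (addc f g) h \<in> hom2 U (cc A B) (cc A' B')"
    "addc (hcomp f h) (hcomp g h) \<in> hom2 U (cc A B) (cc A' B')"
    by (rule hcomp_closed[OF fg h src], rule add_two_cell_closed[OF fh gh])
  fix q p assume qp: "q < size1 (cc A' B')" "p < size1 (cc A B)"
  then have q: "q < size1 A' * size1 B'" and p: "p < size1 A * size1 B" by (simp_all add: size1_comp)
  note dq = div_mod_less[OF q] and dp = div_mod_less[OF p]
  have w: "src1 A = src1 B + ww (summand_word B (p mod size1 B))"
    using one_cell_weight[of B "p mod size1 B"] hom2_cells(1)[OF h] dp src
    by (simp add: parallel_cells_def)
  show "entry (hcomp (addc f g) h) q p =
      entry (addc (hcomp f h) (hcomp g h)) q p"
    unfolding entry_hcomp[OF fg h q p] entry_add[OF fh qp] entry_add[OF f dq(1) dp(1)]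
      entry_hcomp[OF f h q p] entry_hcomp[OF g h q p]
    by (rule cls_hc_add(1)[OF hom2_entry[OF f dq(1) dp(1), unfolded entry_hom_def w]
          hom2_entry[OF g dq(1) dp(1), unfolded entry_hom_def w]
          hom2_entry[OF h dq(2) dp(2), unfolded entry_hom_def]])
qed

lemma hcomp_add_right_cells:
  assumes f: "f \<in> hom2 U B B'" and g: "g \<in> hom2 U B B'" and h: "h \<in> hom2 U A A'"
    and src: "src1 A = tgt1 B"
  shows "hcomp h (addc f g) = addc (hcomp h f) (hcomp h g)"
proof (rule two_cell_eqI)
  note fh = hcomp_closed[OF h f src] and gh = hcomp_closed[OF h g src] and fg = add_two_cell_closed[OF f g]
  show "hcomp h (addc f g) \<in> hom2 U (cc A B) (cc A' B')"
    "addc (hcomp h f) (hcomp h g) \<in> hom2 U (cc A B) (cc A' B')"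
    by (rule hcomp_closed[OF h fg src], rule add_two_cell_closed[OF fh gh])
  fix q p assume qp: "q < size1 (cc A' B')" "p < size1 (cc A B)"
  then have q: "q < size1 A' * size1 B'" and p: "p < size1 A * size1 B" by (simp_all add: size1_comp)
  note dq = div_mod_less[OF q] and dp = div_mod_less[OF p]
  have w: "src1 A = src1 B + ww (summand_word B (p mod size1 B))"
    using one_cell_weight[of B "p mod size1 B"] hom2_cells(1)[OF f] dp src
    by (simp add: parallel_cells_def)
  show "entry (hcomp h (addc f g)) q p =
      entry (addc (hcomp h f) (hcomp h g)) q p"
    unfolding entry_hcomp[OF h fg q p] entry_add[OF fh qp] entry_add[OF f dq(2) dp(2)]
      entry_hcomp[OF h f q p] entry_hcomp[OF h g q p]
    by (rule cls_hc_add(2)[OF hom2_entry[OF h dq(1) dp(1), unfolded entry_hom_def w]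
          hom2_entry[OF f dq(2) dp(2), unfolded entry_hom_def]
          hom2_entry[OF g dq(2) dp(2), unfolded entry_hom_def]])
qed

lemma hcomp_smult_cells:
  assumes f: "f \<in> hom2 U A A'" and g: "g \<in> hom2 U B B'" and src: "src1 A = tgt1 B"
  shows "hcomp (smultc a f) g = smultc a (hcomp f g)" (is ?left)
    and "hcomp f (smultc a g) = smultc a (hcomp f g)" (is ?right)
proof -
  note fg = hcomp_closed[OF f g src]
  note afg = smult_two_cell_closed[OF fg, of a]
    and af = smult_two_cell_closed[OF f, of a] and ag = smult_two_cell_closed[OF g, of a]
  have *: "entry (hcomp (smultc a f) g) q p = entry (smultc a (hcomp f g)) q p"
    "entry (hcomp f (smultc a g)) q p = entry (smultc a (hcomp f g)) q p"
    if qp: "q < size1 (cc A' B')" "p < size1 (cc A B)" for q p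
  proof -
    have q: "q < size1 A' * size1 B'" and p: "p < size1 A * size1 B"
      using qp by (simp_all add: size1_comp)
    note dq = div_mod_less[OF q] and dp = div_mod_less[OF p]
    have w: "src1 A = src1 B + ww (summand_word B (p mod size1 B))"
      using one_cell_weight[of B "p mod size1 B"] hom2_cells(1)[OF g] dp src
      by (simp add: parallel_cells_def)
    note mem = hom2_entry[OF f dq(1) dp(1), unfolded entry_hom_def w]
      hom2_entry[OF g dq(2) dp(2), unfolded entry_hom_def]
    show "entry (hcomp (smultc a f) g) q p = entry (smultc a (hcomp f g)) q p"
      unfolding entry_hcomp[OF af g q p] entry_smult[OF fg qp] entry_smult[OF f dq(1) dp(1)]
        entry_hcomp[OF f g q p] by (rule cls_hc_smul(1)[OF mem])
    show "entry (hcomp f (smultc a g)) q p = entry (smultc a (hcomp f g)) q p"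
      unfolding entry_hcomp[OF f ag q p] entry_smult[OF fg qp] entry_smult[OF g dq(2) dp(2)]
        entry_hcomp[OF f g q p] by (rule cls_hc_smul(2)[OF mem])
  qed
  show ?left by (rule two_cell_eqI[OF hcomp_closed[OF af g src] afg *(1)])
  show ?right by (rule two_cell_eqI[OF hcomp_closed[OF f ag src] afg *(2)])
qed

section \<open>The axioms of a strict linear 2-category\<close>

lemma Mor2_hom2: "f \<in> two_cells D t P \<Longrightarrow> f \<in> hom2 U (dom2 f) (cod2 f)"
  by (simp add: hom2_def)

lemma U_strict_two_category: "strict_two_category U"
proof
  fix f assume "f \<in> Mor2 U"
  then show "Dom U f \<in> Mor1 U \<and> Cod U f \<in> Mor1 U \<and>
      Src U (Dom U f) = Src U (Cod U f) \<and> Tgt U (Dom U f) = Tgt U (Cod U f)"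
    using hom2_cells(1)[OF Mor2_hom2[of f]] by (simp add: parallel_cells_def)
next
  fix f g h assume "f \<in> Mor2 U" "g \<in> Mor2 U" "h \<in> Mor2 U"
      "Src U (Dom U f) = Tgt U (Dom U g)" "Src U (Dom U g) = Tgt U (Dom U h)"
  then show "HComp U (HComp U f g) h = HComp U f (HComp U g h)"
    using hcomp_assoc_cells[OF Mor2_hom2[of f] Mor2_hom2[of g] Mor2_hom2[of h]] by simp
next
  fix f assume "f \<in> Mor2 U"
  then show "HComp U (Id2 U (Id1 U (Tgt U (Dom U f)))) f = f"
    "HComp U f (Id2 U (Id1 U (Src U (Dom U f)))) = f"
    using hcomp_id_cells[OF Mor2_hom2[of f]] by simp_all
qed (simp_all add: hom1_iff id_one_cell_closed comp_one_cells comp_one_cell_assoc comp_one_cell_id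
      id_two_cell_closed vcomp_id_cells hcomp_id2_cells,
     auto simp: comp_one_cell_id intro: vcomp_closed vcomp_assoc_cells hcomp_closed interchange_cells)

lemma parallel_hom1: "A \<in> hom1 U x y \<Longrightarrow> B \<in> hom1 U x y \<Longrightarrow> parallel_cells A B"
  by (simp add: hom1_iff parallel_cells_def)

lemma U_linear_two_category: "linear_two_category U"
proof (intro linear_two_category.intro U_strict_two_category linear_two_category_axioms.intro)
  fix f g h :: "('i, 'x, 'k) two_cell" and A B :: "('i, 'x) one_cell" and a b :: 'k
  assume f: "f \<in> hom2 U A B"
  note AB = hom2_cells(1)[OF f]
  note f' = hom2_entry[OF f]
  show "Add2 U f (Zero2 U A B) = f"
    by (simp, rule two_cell_eqI[OF add_two_cell_closed[OF f zero_two_cell_closed[OF AB]] f])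
       (simp add: entry_add[OF f] entry_zero,
        rule commutative_monoid_on.unit[OF entry_monoid[OF AB]], auto intro: f')
  show "Add2 U f (Smult2 U (- 1) f) = Zero2 U A B"
    by (simp, rule two_cell_eqI[OF add_two_cell_closed[OF f smult_two_cell_closed[OF f]]
          zero_two_cell_closed[OF AB]])
       (simp add: entry_add[OF f] entry_smult[OF f] entry_zero zero_entry_def,
        rule cls_add_neg[OF f'[unfolded entry_hom_def]])
  show "Smult2 U (a + b) f = Add2 U (Smult2 U a f) (Smult2 U b f)"
    by (simp, rule two_cell_eqI[OF smult_two_cell_closed[OF f]
          add_two_cell_closed[OF smult_two_cell_closed[OF f] smult_two_cell_closed[OF f]]])
       (simp add: entry_add[OF smult_two_cell_closed[OF f]] entry_smult[OF f],
        rule cls_smul_plus[OF f'[unfolded entry_hom_def]])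
  show "Smult2 U (a * b) f = Smult2 U a (Smult2 U b f)"
    by (simp, rule two_cell_eqI[OF smult_two_cell_closed[OF f]
          smult_two_cell_closed[OF smult_two_cell_closed[OF f]]])
       (simp add: entry_smult[OF smult_two_cell_closed[OF f]] entry_smult[OF f],
        rule cls_smul_times[OF f'[unfolded entry_hom_def]])
  show "Smult2 U 1 f = f"
    by (simp, rule two_cell_eqI[OF smult_two_cell_closed[OF f] f])
       (simp add: entry_smult[OF f], rule cls_smul_one[OF f'[unfolded entry_hom_def]])
  assume g: "g \<in> hom2 U A B"
  note g' = hom2_entry[OF g]
  show "Add2 U f g = Add2 U g f"
    by (simp, rule two_cell_eqI[OF add_two_cell_closed[OF f g] add_two_cell_closed[OF g f]])
       (simp add: entry_add[OF f] entry_add[OF g],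
        rule cls_add_comm[OF f'[unfolded entry_hom_def] g'[unfolded entry_hom_def]])
  show "Smult2 U a (Add2 U f g) = Add2 U (Smult2 U a f) (Smult2 U a g)"
    by (simp, rule two_cell_eqI[OF smult_two_cell_closed[OF add_two_cell_closed[OF f g]]
          add_two_cell_closed[OF smult_two_cell_closed[OF f] smult_two_cell_closed[OF g]]])
       (simp add: entry_smult[OF add_two_cell_closed[OF f g]] entry_add[OF f]
          entry_add[OF smult_two_cell_closed[OF f]] entry_smult[OF f] entry_smult[OF g],
        rule cls_smul_add[OF f'[unfolded entry_hom_def] g'[unfolded entry_hom_def]])
  assume h: "h \<in> hom2 U A B"
  note h' = hom2_entry[OF h]
  show "Add2 U (Add2 U f g) h = Add2 U f (Add2 U g h)"
    by (simp, rule two_cell_eqI[OF add_two_cell_closed[OF add_two_cell_closed[OF f g] h]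
          add_two_cell_closed[OF f add_two_cell_closed[OF g h]]])
       (simp add: entry_add[OF add_two_cell_closed[OF f g]] entry_add[OF f] entry_add[OF g],
        rule cls_add_assoc[OF f'[unfolded entry_hom_def] g'[unfolded entry_hom_def]
          h'[unfolded entry_hom_def]])
next
  fix A B x y assume "A \<in> hom1 U x y" "B \<in> hom1 U x y"
  then show "Zero2 U A B \<in> hom2 U A B" using zero_two_cell_closed[OF parallel_hom1] by simp
qed (simp_all add: add_two_cell_closed smult_two_cell_closed vcomp_add_cells vcomp_add_right_cells
       vcomp_smult_cells hcomp_add_cells hcomp_add_right_cells hcomp_smult_cells)

section \<open>Zero objects and biproducts by selection matrices\<close>

lemma selection_vcomp:
  assumes R: "selects B C R" and R': "selects A B R'"
    and unique: "\<And>q r s. q < size1 C \<Longrightarrow> r < size1 B \<Longrightarrow> s < size1 B \<Longrightarrow> R q r \<Longrightarrow> R q s \<Longrightarrow> r = s"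
  shows "vcomp (selection_cell B C R) (selection_cell A B R') =
    selection_cell A C (\<lambda>q p. \<exists>r<size1 B. R q r \<and> R' r p)" (is "?l = selection_cell A C ?R")
proof -
  note f = selection_closed[OF R']
  have AC: "parallel_cells A C" using R R' parallel_cells_trans by (auto simp: selects_def)
  then have "selects A C ?R" using R R' by (auto simp: selects_def)
  note c = selection_closed[OF this]
  show ?thesis
  proof (rule two_cell_eqI[OF vcomp_closed[OF selection_closed[OF R] f] c])
    fix q p assume q: "q < size1 C" and p: "p < size1 A"
    show "entry ?l q p = entry (selection_cell A C ?R) q p"
    proof (cases "\<exists>r<size1 B. R q r")
      case True
      then obtain r where r: "r < size1 B" "R q r" by blast
      \<comment> \<open>Uniqueness of \<open>r\<close> in row \<open>q\<close> keeps several
        identities from adding up in one entry.\<close>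
      then have "entry ?l q p = entry (selection_cell A B R') r p"
        using unique[OF q] by (intro entry_selection_vcomp(1)[OF R f q p]) blast+
      moreover have "ze A B r p = ze A C q p"
        using R r q by (intro zero_entry_cong) (auto simp: selects_def)
      moreover have "?R q p \<longleftrightarrow> R' r p" using unique[OF q] r by blast
      ultimately show ?thesis using q p r by (simp add: entry_selection)
    next
      case False
      then have "entry ?l q p = ze A C q p" by (intro entry_selection_vcomp(2)[OF R f q p]) blast
      moreover have no: "\<not> ?R q p" using False by blast
      ultimately show ?thesis by (simp only: entry_selection[OF q p] if_not_P[OF no] if_False)
    qed
  qed
qed

lemma selection_cell_cong:
  "(\<And>q p. q < size1 B \<Longrightarrow> p < size1 A \<Longrightarrow> R q p = R' q p) \<Longrightarrow>
     selection_cell A B R = selection_cell A B R'"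
  by (auto simp: selection_cell_def matrix_cell_def fun_eq_iff)

lemma zero_two_cell_selection: "zero_two_cell D t P A B = selection_cell A B (\<lambda>q p. False)"
  by (simp add: zero_two_cell_def selection_cell_def)

text \<open>Disjointness excludes positions where the sum would be twice an identity; elsewhere one
  of the summands is zero.\<close>

lemma selection_add:
  assumes R: "selects A B R" and R': "selects A B R'"
    and disj: "\<And>q p. q < size1 B \<Longrightarrow> p < size1 A \<Longrightarrow> \<not> (R q p \<and> R' q p)"
  shows "addc (selection_cell A B R) (selection_cell A B R') =
    selection_cell A B (\<lambda>q p. R q p \<or> R' q p)"
proof -
  note f = selection_closed[OF R]
    and g = selection_closed[OF R']
  have "selects A B (\<lambda>q p. R q p \<or> R' q p)" using R R' by (auto simp: selects_def)
  note h = selection_closed[OF this]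
  show ?thesis
  proof (rule two_cell_eqI[OF add_two_cell_closed[OF f g] h])
    fix q p assume q: "q < size1 B" and p: "p < size1 A"
    have AB: "parallel_cells A B" using R by (simp add: selects_def)
    interpret commutative_monoid_on "entry_hom A B q p" add "ze A B q p" by (rule entry_monoid[OF AB q p])
    show "entry (addc (selection_cell A B R) (selection_cell A B R')) q p =
        entry (selection_cell A B (\<lambda>q p. R q p \<or> R' q p)) q p"
      using hom2_entry[OF f q p] hom2_entry[OF g q p] disj[OF q p] q p
      by (auto simp: entry_add[OF f q p] entry_selection unit unit_left z_closed)
  qed
qed

lemma U_additive_two_category: "additive_two_category U"
proof (intro additive_two_category.intro U_linear_two_category additive_two_category_axioms.intro)
  fix x y :: 'x
  \<comment> \<open>The empty direct sum: matrices from and to it have no entries.\<close>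
  let ?Z = "OneCell x y [] :: ('i, 'x) one_cell"
  have "?Z \<in> hom1 U x y" by (simp add: hom1_iff one_cells_def)
  moreover have "Id2 U ?Z = Zero2 U ?Z ?Z"
    by (simp add: id_two_cell_selection zero_two_cell_selection, rule selection_cell_cong) simp
  ultimately show "\<exists>Z\<in>hom1 U x y. Id2 U Z = Zero2 U Z Z" by blast
next
  fix A B x y assume "A \<in> hom1 U x y" "B \<in> hom1 U x y"
  then have A: "A \<in> one_cells D" "src1 A = x" "tgt1 A = y" and B: "B \<in> one_cells D" "src1 B = x" "tgt1 B = y"
    by (auto simp: hom1_iff)
  \<comment> \<open>The biproduct concatenates the lists of summands; its structure maps select the
    first \<open>size1 A\<close> positions or the remaining ones.\<close>
  define T where "T = OneCell x y (summands A @ summands B)"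
  have T: "T \<in> one_cells D" "src1 T = x" "tgt1 T = y" "summands T = summands A @ summands B"
    using A B by (auto simp: T_def one_cells_def)
  have T1: "T \<in> hom1 U x y" using T by (simp add: hom1_iff)
  note sel = selects_def parallel_cells_def A B T nth_append
  let ?I = "\<lambda>q p :: nat. q = p" and ?J = "\<lambda>q p :: nat. q = size1 A + p"
    and ?Q = "\<lambda>q p :: nat. p = size1 A + q"
  have i: "selects A T ?I" and j: "selects B T ?J" and p: "selects T A ?I" and q: "selects T B ?Q"
    by (auto simp: sel)
  let ?s = "selection_cell"
  show "\<exists>S\<in>hom1 U x y. \<exists>i\<in>hom2 U A S. \<exists>j\<in>hom2 U B S. \<exists>p\<in>hom2 U S A. \<exists>q\<in>hom2 U S B.
      VComp U p i = Id2 U A \<and> VComp U q j = Id2 U B \<and>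
      VComp U p j = Zero2 U B A \<and> VComp U q i = Zero2 U A B \<and>
      Add2 U (VComp U i p) (VComp U j q) = Id2 U S"
  proof (intro bexI[OF _ T1] bexI[OF _ selection_closed[OF i]] bexI[OF _ selection_closed[OF j]]
        bexI[OF _ selection_closed[OF p]] bexI[OF _ selection_closed[OF q]] conjI)
    show "VComp U (?s T A ?I) (?s A T ?I) = Id2 U A"
      by (simp add: selection_vcomp[OF p i] id_two_cell_selection, rule selection_cell_cong) (auto simp: T)
    show "VComp U (?s T B ?Q) (?s B T ?J) = Id2 U B"
      by (simp add: selection_vcomp[OF q j] id_two_cell_selection, rule selection_cell_cong) (auto simp: T)
    show "VComp U (?s T A ?I) (?s B T ?J) = Zero2 U B A"
      by (simp add: selection_vcomp[OF p j] zero_two_cell_selection, rule selection_cell_cong) (auto simp: T)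
    show "VComp U (?s T B ?Q) (?s A T ?I) = Zero2 U A B"
      by (simp add: selection_vcomp[OF q i] zero_two_cell_selection, rule selection_cell_cong) (auto simp: T)
    \<comment> \<open>The two idempotents are partial identities on complementary blocks of
      positions, so their sum is the full diagonal.\<close>
    have ip: "selects T T (\<lambda>q p. \<exists>r<size1 A. q = r \<and> r = p)"
      and jq: "selects T T (\<lambda>q p. \<exists>r<size1 B. q = size1 A + r \<and> p = size1 A + r)"
      by (auto simp: sel)
    have "VComp U (?s A T ?I) (?s T A ?I) = ?s T T (\<lambda>q p. \<exists>r<size1 A. q = r \<and> r = p)"
      by (simp add: selection_vcomp[OF i p])
    moreover have "VComp U (?s B T ?J) (?s T B ?Q) =
        ?s T T (\<lambda>q p. \<exists>r<size1 B. q = size1 A + r \<and> p = size1 A + r)"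
      by (simp add: selection_vcomp[OF j q])
    moreover have "Add2 U (?s T T (\<lambda>q p. \<exists>r<size1 A. q = r \<and> r = p))
        (?s T T (\<lambda>q p. \<exists>r<size1 B. q = size1 A + r \<and> p = size1 A + r)) =
      ?s T T (\<lambda>q p. (\<exists>r<size1 A. q = r \<and> r = p) \<or> (\<exists>r<size1 B. q = size1 A + r \<and> p = size1 A + r))"
      using selection_add[OF ip jq] by auto
    moreover have "\<dots> = Id2 U T"
      unfolding U_Qbeta_simps id_two_cell_selection
    proof (rule selection_cell_cong)
      fix q p assume "q < size1 T"
      then have "q < size1 A \<or> (\<exists>r<size1 B. q = size1 A + r)"
        by (simp add: T) presburger
      then show "((\<exists>r<size1 A. q = r \<and> r = p) \<or>
          (\<exists>r<size1 B. q = size1 A + r \<and> p = size1 A + r)) = (q = p)" by auto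
    qed
    ultimately show "Add2 U (VComp U (?s A T ?I) (?s T A ?I)) (VComp U (?s B T ?J) (?s T B ?Q)) = Id2 U T"
      by simp
  qed
qed

section \<open>Grading shifts\<close>

lemma shift_one_cells: "A \<in> one_cells D \<Longrightarrow> shift_one_cell n A \<in> one_cells D"
  by (fastforce simp: one_cells_def shift_one_cell_def)

lemma shift_parallel: "parallel_cells A B \<Longrightarrow> parallel_cells (shift_one_cell n A) (shift_one_cell n B)"
  by (simp add: parallel_cells_def shift_one_cells)

text \<open>Degrees of entries depend only on differences of shifts, which is why
  \<open>shift_two_cell\<close> can keep the matrix unchanged.\<close>

lemma shift_entry_hom: "q < size1 B \<Longrightarrow> p < size1 A \<Longrightarrow>
    entry_hom (shift_one_cell n A) (shift_one_cell n B) q p = entry_hom A B q p"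
  by (simp add: entry_hom_def nth_shift_one_cell)

lemma shift_zero_entry: "q < size1 B \<Longrightarrow> p < size1 A \<Longrightarrow>
    ze (shift_one_cell n A) (shift_one_cell n B) q p = ze A B q p"
  by (simp add: zero_entry_def nth_shift_one_cell)

lemma shift_two_cell_closed:
  assumes "f \<in> hom2 U A B"
  shows "shift_two_cell n f \<in> hom2 U (shift_one_cell n A) (shift_one_cell n B)"
  using hom2_cells[OF assms] hom2_entry[OF assms] hom2_entry_outside[OF assms]
  by (simp add: hom2_iff shift_parallel shift_entry_hom)

lemma U_graded_additive_two_category: "graded_additive_two_category U"
proof (intro graded_additive_two_category.intro U_additive_two_category
    graded_additive_two_category_axioms.intro)
  fix A n assume "A \<in> Mor1 U"
  then show "Shift2 U n (Id2 U A) = Id2 U (Shift1 U n A)"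
    using shift_two_cell_closed[OF id_two_cell_closed[of A]] id_two_cell_closed[OF shift_one_cells[of A n]]
    by (auto intro!: two_cell_eqI simp: entry_id nth_shift_one_cell shift_zero_entry)
next
  fix f A B A' g n assume f: "f \<in> hom2 U B A'" and g: "g \<in> hom2 U A B"
  have "vcomp (shift_two_cell n f) (shift_two_cell n g) =
      shift_two_cell n (vcomp f g)"
    by (rule two_cell_eqI[OF vcomp_closed[OF shift_two_cell_closed[OF f] shift_two_cell_closed[OF g]]
          shift_two_cell_closed[OF vcomp_closed[OF f g]]])
       (simp add: entry_vcomp[OF f g] shift_zero_entry
          entry_vcomp[OF shift_two_cell_closed[OF f] shift_two_cell_closed[OF g]])
  then show "Shift2 U n (VComp U f g) = VComp U (Shift2 U n f) (Shift2 U n g)" by simp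
next
  fix f A B g n assume f: "f \<in> hom2 U A B" and g: "g \<in> hom2 U A B"
  show "Shift2 U n (Add2 U f g) = Add2 U (Shift2 U n f) (Shift2 U n g)"
    by (simp, rule two_cell_eqI[OF shift_two_cell_closed[OF add_two_cell_closed[OF f g]]
          add_two_cell_closed[OF shift_two_cell_closed[OF f] shift_two_cell_closed[OF g]]])
       (simp add: entry_add[OF f] entry_add[OF shift_two_cell_closed[OF f]])
next
  fix f A B n a assume f: "f \<in> hom2 U A B"
  show "Shift2 U n (Smult2 U a f) = Smult2 U a (Shift2 U n f)"
    by (simp, rule two_cell_eqI[OF shift_two_cell_closed[OF smult_two_cell_closed[OF f]]
          smult_two_cell_closed[OF shift_two_cell_closed[OF f]]])
       (simp add: entry_smult[OF f] entry_smult[OF shift_two_cell_closed[OF f]])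
next
  fix f g n assume "f \<in> Mor2 U" "g \<in> Mor2 U" "Src U (Dom U f) = Tgt U (Dom U g)"
  then have f: "f \<in> hom2 U (dom2 f) (cod2 f)" and g: "g \<in> hom2 U (dom2 g) (cod2 g)"
    and src: "src1 (dom2 f) = tgt1 (dom2 g)" by (auto simp: Mor2_hom2)
  note f' = shift_two_cell_closed[OF f, of n] and g' = shift_two_cell_closed[OF g, of n]
  note fg = shift_two_cell_closed[OF hcomp_closed[OF f g src], of n]
  have "hcomp (shift_two_cell n f) g = shift_two_cell n (hcomp f g)"
    by (rule two_cell_eqI[OF hcomp_closed[OF f' g, simplified comp_one_cell_shift] fg])
       (use src in \<open>simp_all add: entry_hcomp[OF f g] entry_hcomp[OF f' g] size1_comp\<close>)
  moreover have "hcomp f (shift_two_cell n g) = shift_two_cell n (hcomp f g)"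
    by (rule two_cell_eqI[OF hcomp_closed[OF f g', simplified comp_one_cell_shift] fg])
       (use src in \<open>simp_all add: entry_hcomp[OF f g] entry_hcomp[OF f g'] size1_comp\<close>)
  ultimately show "HComp U (Shift2 U n f) g = Shift2 U n (HComp U f g) \<and>
      HComp U f (Shift2 U n g) = Shift2 U n (HComp U f g)" by simp
qed (simp_all add: hom1_iff shift_one_cells shift_one_cell_0 shift_one_cell_plus
      shift_two_cell_closed comp_one_cell_shift two_cell_expand)

end


section \<open>Rescaling the generators\<close>

text \<open>The scalars sit on the generators, so rescaling commutes with every way of forming
  expressions; the structural axioms of the congruence are then preserved for any scalars.\<close>

primrec rescale :: "(('i, 'x) generator \<Rightarrow> 'k) \<Rightarrow> ('i, 'x, 'k) tm \<Rightarrow> ('i, 'x, 'k) tm" where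
  "rescale s (Ident m W) = Ident m W"
| "rescale s (Gen g) = s g \<cdot>\<^sub>v Gen g"
| "rescale s (f \<circ>\<^sub>v g) = rescale s f \<circ>\<^sub>v rescale s g"
| "rescale s (HC f g) = HC (rescale s f) (rescale s g)"
| "rescale s (Zer m W V d) = Zer m W V d"
| "rescale s (f +\<^sub>v g) = rescale s f +\<^sub>v rescale s g"
| "rescale s (a \<cdot>\<^sub>v f) = a \<cdot>\<^sub>v rescale s f"

lemma rescale_type [simp]:
  "tm_src (rescale s f) = tm_src f" "tm_dom (rescale s f) = tm_dom f"
  "tm_cod (rescale s f) = tm_cod f" "tm_deg D (rescale s f) = tm_deg D f"
  by (induction f) auto

lemma rescale_wf [simp]:
  "tm_tgt D (rescale s f) = tm_tgt D f" "parallel D (rescale s f) (rescale s g) = parallel D f g"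
  "wf_tm D (rescale s f) = wf_tm D f"
proof -
  show "tm_tgt D (rescale s f) = tm_tgt D f" for f by (simp add: tm_tgt_def)
  show "parallel D (rescale s f) (rescale s g) = parallel D f g" for f g by (simp add: parallel_def)
  then show "wf_tm D (rescale s f) = wf_tm D f"
    by (induction f) (auto simp: tm_tgt_def)
qed

lemma rescale_has_type [simp]: "has_type D (rescale s f) m W V d = has_type D f m W V d"
  by (simp add: has_type_def)

lemma rescale_defined [simp]:
  "rescale s (whisker D W f V) = whisker D W (rescale s f) V"
  "rescale s (zer D f) = zer D f"
  "zer D (rescale s f) = zer D f"
  "rescale s (sum_tm z fs) = sum_tm (rescale s z) (map (rescale s) fs)"
  by (simp_all add: whisker_def zer_def sum_tm_def) (induction fs, auto)

text \<open>
  The scalar by which \<^const>\<open>rescale\<close> multiplies an expression all of whose summands are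
  multiplied by the same scalar.
\<close>

primrec factor :: "(('i, 'x) generator \<Rightarrow> 'k::field) \<Rightarrow> ('i, 'x, 'k) tm \<Rightarrow> 'k" where
  "factor s (Ident m W) = 1"
| "factor s (Gen g) = s g"
| "factor s (f \<circ>\<^sub>v g) = factor s f * factor s g"
| "factor s (HC f g) = factor s f * factor s g"
| "factor s (Zer m W V d) = 1"
| "factor s (f +\<^sub>v g) = factor s f"
| "factor s (a \<cdot>\<^sub>v f) = factor s f"

text \<open>\<open>factor\<close> reads only the first summand of a sum; this condition makes the
  result valid for the whole expression. The factor 1 of a formal zero is a convention, since zero
  is a multiple of itself by any scalar.\<close>

primrec homogeneous :: "(('i, 'x) generator \<Rightarrow> 'k::field) \<Rightarrow> ('i, 'x, 'k) tm \<Rightarrow> bool" where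
  "homogeneous s (Ident m W) \<longleftrightarrow> True"
| "homogeneous s (Gen g) \<longleftrightarrow> True"
| "homogeneous s (f \<circ>\<^sub>v g) \<longleftrightarrow> homogeneous s f \<and> homogeneous s g"
| "homogeneous s (HC f g) \<longleftrightarrow> homogeneous s f \<and> homogeneous s g"
| "homogeneous s (Zer m W V d) \<longleftrightarrow> True"
| "homogeneous s (f +\<^sub>v g) \<longleftrightarrow> homogeneous s f \<and> homogeneous s g \<and> factor s f = factor s g"
| "homogeneous s (a \<cdot>\<^sub>v f) \<longleftrightarrow> homogeneous s f"

lemma factor_whisker [simp]:
  "factor s (whisker D W f V) = factor s f" "homogeneous s (whisker D W f V) = homogeneous s f"
  "factor s (zer D f) = 1" "homogeneous s (zer D f)"
  by (simp_all add: whisker_def zer_def)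

lemma factor_dots:
  assumes "\<And>m. s (Dot i m) = 1"
  shows "factor s (dots i m n) = 1" "homogeneous s (dots i m n)"
  by (induction n) (simp_all add: assms)

section \<open>Expressions that rescaling turns into scalar multiples\<close>

context
  fixes D :: "('i, 'x::ab_group_add) cartan_data"
    and t :: "'i \<Rightarrow> 'i \<Rightarrow> 'k::field"
    and Q :: "('i, 'x, 'k) bubble_params"
    and s :: "('i, 'x) generator \<Rightarrow> 'k"
begin

private abbreviation (input) eqv_target (infix \<open>\<approx>\<close> 50) where "f \<approx> g \<equiv> eqv D t Q f g"

text \<open>The two expressions may differ: a fake bubble contains the parameters of the source, and
  its image is a multiple of the fake bubble built from those of the target. \<open>factor\<close>
  alone cannot express this.\<close>

definition scales :: "('i, 'x, 'k) tm \<Rightarrow> 'k \<Rightarrow> ('i, 'x, 'k) tm \<Rightarrow> bool" where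
  "scales f a g \<longleftrightarrow> rescale s f \<approx> a \<cdot>\<^sub>v g"

lemma scales_wf: "scales f a g \<Longrightarrow> wf_tm D f \<and> wf_tm D g \<and> parallel D f g"
  unfolding scales_def using eqv_wf_parallel[of D t Q "rescale s f" "a \<cdot>\<^sub>v g"]
  by (simp add: parallel_def)

lemma smul_smul_eqv: "wf_tm D f \<Longrightarrow> a * b = c \<Longrightarrow> a \<cdot>\<^sub>v b \<cdot>\<^sub>v f \<approx> c \<cdot>\<^sub>v f"
  using eqv.sym[OF eqv.smul_times] by metis

lemma scales_vc:
  assumes f: "scales f a f'" and g: "scales g b g'" and wf: "wf_tm D (f' \<circ>\<^sub>v g')"
  shows "scales (f \<circ>\<^sub>v g) (a * b) (f' \<circ>\<^sub>v g')"
proof -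
  have "rescale s f \<circ>\<^sub>v rescale s g \<approx> (a \<cdot>\<^sub>v f') \<circ>\<^sub>v (b \<cdot>\<^sub>v g')"
    using scales_wf[OF f] scales_wf[OF g] wf
    by (intro eqv.cong_vc f[unfolded scales_def] g[unfolded scales_def]) (auto simp: parallel_def)
  also have "(a \<cdot>\<^sub>v f') \<circ>\<^sub>v (b \<cdot>\<^sub>v g') \<approx> a \<cdot>\<^sub>v (f' \<circ>\<^sub>v (b \<cdot>\<^sub>v g'))"
    using wf by (intro eqv.vc_smul_left) simp
  also have "a \<cdot>\<^sub>v (f' \<circ>\<^sub>v (b \<cdot>\<^sub>v g')) \<approx> a \<cdot>\<^sub>v b \<cdot>\<^sub>v (f' \<circ>\<^sub>v g')"
    by (intro eqv.cong_smul eqv.vc_smul_right wf)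
  also have "a \<cdot>\<^sub>v b \<cdot>\<^sub>v (f' \<circ>\<^sub>v g') \<approx> (a * b) \<cdot>\<^sub>v (f' \<circ>\<^sub>v g')" using wf by (intro smul_smul_eqv) auto
  finally show ?thesis by (simp add: scales_def)
qed

lemma scales_hc:
  assumes f: "scales f a f'" and g: "scales g b g'" and wf: "wf_tm D (HC f' g')"
  shows "scales (HC f g) (a * b) (HC f' g')"
proof -
  have "HC (rescale s f) (rescale s g) \<approx> HC (a \<cdot>\<^sub>v f') (b \<cdot>\<^sub>v g')"
    using scales_wf[OF f] scales_wf[OF g] wf
    by (intro eqv.cong_hc f[unfolded scales_def] g[unfolded scales_def])
       (auto simp: parallel_def tm_tgt_def)
  also have "HC (a \<cdot>\<^sub>v f') (b \<cdot>\<^sub>v g') \<approx> a \<cdot>\<^sub>v (HC f' (b \<cdot>\<^sub>v g'))"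
    using wf by (intro eqv.hc_smul_left) (simp add: tm_tgt_def)
  also have "a \<cdot>\<^sub>v (HC f' (b \<cdot>\<^sub>v g')) \<approx> a \<cdot>\<^sub>v b \<cdot>\<^sub>v (HC f' g')"
    by (intro eqv.cong_smul eqv.hc_smul_right wf)
  also have "a \<cdot>\<^sub>v b \<cdot>\<^sub>v (HC f' g') \<approx> (a * b) \<cdot>\<^sub>v (HC f' g')" using wf by (intro smul_smul_eqv) auto
  finally show ?thesis by (simp add: scales_def)
qed

lemma scales_add:
  assumes f: "scales f a f'" and g: "scales g a g'" and wf: "wf_tm D (f' +\<^sub>v g')"
  shows "scales (f +\<^sub>v g) a (f' +\<^sub>v g')"
proof -
  have "rescale s f +\<^sub>v rescale s g \<approx> a \<cdot>\<^sub>v f' +\<^sub>v a \<cdot>\<^sub>v g'"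
    using scales_wf[OF f] scales_wf[OF g] wf
    by (intro eqv.cong_add f[unfolded scales_def] g[unfolded scales_def]) (auto simp: parallel_def)
  also have "a \<cdot>\<^sub>v f' +\<^sub>v a \<cdot>\<^sub>v g' \<approx> a \<cdot>\<^sub>v (f' +\<^sub>v g')" by (intro eqv.sym[OF eqv.smul_add] wf)
  finally show ?thesis by (simp add: scales_def)
qed

text \<open>The explicit coefficient may change from \<open>b\<close> to \<open>d\<close>; in this
  way parameters of the source occurring as coefficients are traded for those of the target.\<close>

lemma scales_smul:
  assumes f: "scales f a g" and eq: "b * a = c * d"
  shows "scales (b \<cdot>\<^sub>v f) c (d \<cdot>\<^sub>v g)"
proof -
  note g = scales_wf[OF f]
  have "b \<cdot>\<^sub>v rescale s f \<approx> b \<cdot>\<^sub>v a \<cdot>\<^sub>v g" by (intro eqv.cong_smul f[unfolded scales_def])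
  also have "b \<cdot>\<^sub>v a \<cdot>\<^sub>v g \<approx> (b * a) \<cdot>\<^sub>v g" using g by (intro smul_smul_eqv) auto
  also have "(b * a) \<cdot>\<^sub>v g \<approx> c \<cdot>\<^sub>v d \<cdot>\<^sub>v g" unfolding eq using g by (intro eqv.smul_times) auto
  finally show ?thesis by (simp add: scales_def)
qed

lemma scales_Zer: "word_weight D W = word_weight D V \<Longrightarrow> scales (Zer m W V d) a (Zer m W V d)"
  using eqv.sym[OF smul_zer_eqv[of D "Zer m W V d" t Q a]] by (simp add: scales_def zer_def)

lemma scales_factor: "wf_tm D f \<Longrightarrow> homogeneous s f \<Longrightarrow> scales f (factor s f) f"
proof (induction f)
  case (Ident m W)
  then show ?case by (simp add: scales_def eqv.sym[OF eqv.smul_one])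
next
  case (Gen g)
  then show ?case by (simp add: scales_def eqv.refl)
next
  case (Zer m W V d)
  then show ?case using scales_Zer[of W V] by simp
next
  case (Add f g)
  then show ?case by (auto intro!: scales_add)
next
  case (Smul a f)
  then show ?case by (auto intro!: scales_smul simp: mult.commute)
next
  case (VC f g)
  then show ?case by (auto intro!: scales_vc)
next
  case (HC f g)
  then show ?case by (auto intro!: scales_hc)
qed

lemma scales_sum:
  assumes "scales z a z'" "\<And>x. x \<in> set xs \<Longrightarrow> scales (e x) a (e' x)"
    "wf_tm D (sum_tm z' (map e' xs))"
  shows "scales (sum_tm z (map e xs)) a (sum_tm z' (map e' xs))"
  using assms(2,3)
proof (induction xs)
  case Nil
  then show ?case using assms(1) by (simp add: sum_tm_def)
next
  case (Cons x xs)
  then have "scales (e x) a (e' x)" "scales (sum_tm z (map e xs)) a (sum_tm z' (map e' xs))"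
    by (auto simp: sum_tm_def)
  then show ?case using scales_add[of "e x" a "e' x" "sum_tm z (map e xs)" "sum_tm z' (map e' xs)"] Cons.prems
    by (simp add: sum_tm_def)
qed

text \<open>The transfer principle for relations: both sides become the same multiple of the two
  sides of an equality already known for \<open>Q\<close>.\<close>

lemma scales_eqv:
  assumes "scales f a f'" "f' \<approx> g'" "scales g a g'"
  shows "rescale s f \<approx> rescale s g"
proof -
  have "rescale s f \<approx> a \<cdot>\<^sub>v f'" using assms(1) by (simp add: scales_def)
  also have "a \<cdot>\<^sub>v f' \<approx> a \<cdot>\<^sub>v g'" by (rule eqv.cong_smul[OF assms(2)])
  also have "a \<cdot>\<^sub>v g' \<approx> rescale s g" using assms(3) by (auto simp: scales_def intro: eqv.sym)
  finally show ?thesis .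
qed

lemma homogeneous_eqv:
  "f \<approx> g \<Longrightarrow> homogeneous s f \<Longrightarrow> homogeneous s g \<Longrightarrow> factor s f = factor s g \<Longrightarrow>
     rescale s f \<approx> rescale s g"
  using scales_eqv[of f "factor s f" f g g] scales_factor eqv_wf_parallel[of D t Q f g] by metis

text \<open>\<open>zer D f\<close> has factor 1 by convention, so \<open>homogeneous_eqv\<close>
  need not match; zero is scaled by \<open>factor s f\<close> instead.\<close>

lemma homogeneous_zer_eqv:
  assumes "f \<approx> zer D f" "homogeneous s f"
  shows "rescale s f \<approx> rescale s (zer D f)"
proof (rule scales_eqv[OF scales_factor assms(1)])
  have "wf_tm D (zer D f)" using eqv_wf_parallel[OF assms(1)] by simp
  then show "scales (zer D f) (factor s f) (zer D f)" unfolding zer_def by (intro scales_Zer) simp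
qed (use assms eqv_wf_parallel[OF assms(1)] in auto)

end

text \<open>\<open>P\<close> belongs to the source and \<open>Q\<close> to the target. A degree zero
  bubble of the source, with value taken from \<open>P\<close>, is sent to the scalars of its cap
  and cup times the bubble of the target, with value taken from \<open>Q\<close>.\<close>

definition rescaling :: "('i, 'x::ab_group_add) cartan_data \<Rightarrow> ('i, 'x, 'k::field) bubble_params \<Rightarrow>
    ('i, 'x, 'k) bubble_params \<Rightarrow> (('i, 'x) generator \<Rightarrow> 'k) \<Rightarrow> bool" where
  "rescaling D P Q s \<longleftrightarrow>
     (\<forall>i m. s (Dot i m) = 1) \<and> (\<forall>i j m. s (Crossing i j m) = 1) \<and>
     (\<forall>i m. s (Cap i (m + simple_root D i)) * s (Cup i m) = 1) \<and>
     (\<forall>i m. s (Cap' i m) * s (Cup' i (m + simple_root D i)) = 1) \<and>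
     (\<forall>i m. s (Cap i m) * s (Cup' i m) * cplus Q i m = cplus P i m) \<and>
     (\<forall>i m. s (Cap' i m) * s (Cup i m) * cminus Q i m = cminus P i m)"

section \<open>Ratios of bubble values and the scalars occurring in the relations\<close>

locale rescaling_datum =
  fixes D :: "('i, 'x::ab_group_add) cartan_data"
    and t :: "'i \<Rightarrow> 'i \<Rightarrow> 'k::field"
    and P Q :: "('i, 'x, 'k) bubble_params"
    and s :: "('i, 'x) generator \<Rightarrow> 'k"
  assumes D: "simply_laced_datum D"
    and P: "compatible D t P" and Q: "compatible D t Q"
    and s: "rescaling D P Q s"
begin

abbreviation eqv_Q (infix \<open>\<approx>\<close> 50) where "f \<approx> g \<equiv> eqv D t Q f g"
abbreviation "sc \<equiv> scales D t Q s"

text \<open>The scalars acquired by the clockwise and the counterclockwise \<open>i\<close>-bubbles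
  in weight \<open>m\<close>. By the last two conditions on \<open>s\<close> they are ratios of
  values for \<open>P\<close> and \<open>Q\<close>, so their dependence on the weight is governed by
  compatibility.\<close>

definition rp where "rp i m = s (Cap i m) * s (Cup' i m)"
definition rm where "rm i m = s (Cap' i m) * s (Cup i m)"

lemma s_dot [simp]: "s (Dot i m) = 1" and s_crossing [simp]: "s (Crossing i j m) = 1"
  and cap_cup: "s (Cap i (m + rt D i)) * s (Cup i m) = 1"
  and cap'_cup': "s (Cap' i m) * s (Cup' i (m + rt D i)) = 1"
  and rp: "rp i m * cplus Q i m = cplus P i m"
  and rm: "rm i m * cminus Q i m = cminus P i m"
  using s by (simp_all add: rescaling_def rp_def rm_def)

lemma cap_cup': "s (Cap i m) * s (Cup i (m - rt D i)) = 1"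
  and cap'_cup: "s (Cap' i (m - rt D i)) * s (Cup' i m) = 1"
  using cap_cup[of i "m - rt D i"] cap'_cup'[of i "m - rt D i"] by simp_all

lemma nonzero: "s (Cap i m) \<noteq> 0" "s (Cup' i m) \<noteq> 0" "s (Cap' i m) \<noteq> 0" "s (Cup i m) \<noteq> 0"
  "cplus Q i m \<noteq> 0" "cminus Q i m \<noteq> 0" "cplus P i m \<noteq> 0" "cminus P i m \<noteq> 0"
  and nonzero_beta: "beta P i \<noteq> 0" "beta Q i \<noteq> 0"
  using cap_cup'[of i m] cap'_cup[of i m] cap_cup[of i m] cap'_cup'[of i m] P Q
  by (auto simp: compatible_def)

text \<open>Divide the equations \<open>cplus * cminus = - 1 / beta\<close> for the two sets of
  parameters.\<close>

lemma rp_rm: "beta P i * (rp i m * rm i m) = beta Q i"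
proof -
  have "cplus P i m * cminus P i m = - 1 / beta P i" "cplus Q i m * cminus Q i m = - 1 / beta Q i"
    using P Q by (auto simp: compatible_def)
  then have "(rp i m * rm i m) * (- 1 / beta Q i) = - 1 / beta P i"
    using rp[of i m] rm[of i m] by (metis (no_types, opaque_lifting) mult.assoc mult.left_commute)
  then show ?thesis using nonzero_beta[of i] by (simp add: field_simps)
qed

text \<open>A step by \<open>\<alpha>\<^sub>i\<close> changes the values for \<open>P\<close> and
  for \<open>Q\<close> by the same off-diagonal scalar \<open>t j i\<close>, which cancels in the
  ratio.\<close>

lemma rp_shift:
  assumes "i \<noteq> j"
  shows "rp j (m - rt D i) = rp j m"
proof -
  have "cplus P j m = full_scalars t P j i * cplus P j (m - rt D i)"
    "cplus Q j m = full_scalars t Q j i * cplus Q j (m - rt D i)"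
    using P Q by (auto simp: compatible_def dest: spec[of _ "m - rt D i"]) (metis diff_add_cancel)+
  with assms have "cplus P j m = t j i * cplus P j (m - rt D i)"
    "cplus Q j m = t j i * cplus Q j (m - rt D i)"
    by (auto simp: full_scalars_def)
  then have "rp j (m - rt D i) * cplus Q j m = rp j m * cplus Q j m"
    using rp[of j m] rp[of j "m - rt D i"] by (metis mult.left_commute)
  then show ?thesis using nonzero by simp
qed

lemma rm_shift:
  assumes "i \<noteq> j"
  shows "rm j (m - rt D i) = rm j m"
proof -
  have "cminus P j (m - rt D i) = t j i * cminus P j m" "cminus Q j (m - rt D i) = t j i * cminus Q j m"
    using P Q assms by (auto simp: compatible_def full_scalars_def)
  then have "rm j (m - rt D i) * cminus Q j (m - rt D i) = rm j m * cminus Q j (m - rt D i)"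
    using rm[of j m] rm[of j "m - rt D i"] by (metis mult.left_commute)
  then show ?thesis using nonzero by simp
qed

text \<open>For equal indices the scalar of the step is minus \<open>beta\<close>, which may differ
  between \<open>P\<close> and \<open>Q\<close>; the ratio picks up the quotient of the two.\<close>

lemma rm_shift_self: "beta Q i * rm i (m - rt D i) = beta P i * rm i m"
proof -
  have "cminus P i (m - rt D i) = - beta P i * cminus P i m"
    "cminus Q i (m - rt D i) = - beta Q i * cminus Q i m"
    using P Q by (auto simp: compatible_def full_scalars_def)
  then have "(beta Q i * rm i (m - rt D i)) * cminus Q i m = (beta P i * rm i m) * cminus Q i m"
    using rm[of i m] rm[of i "m - rt D i"] by (simp add: algebra_simps)
  then show ?thesis using nonzero[of i m] by simp
qed

text \<open>These are the cups and caps of \<open>sigma D i j m\<close> and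
  \<open>sigma' D j i m\<close>, all of colour \<open>j\<close>. Their product is
  \<open>rp j m\<close> times \<open>rm j\<close> at
  \<open>m - \<alpha>\<^sub>j + \<alpha>\<^sub>i\<close>. The shift by
  \<open>\<alpha>\<^sub>i\<close> does not change \<open>rm j\<close>, and the step by
  \<open>\<alpha>\<^sub>j\<close> contributes \<open>beta P j / beta Q j\<close>, the inverse of
  \<open>rp j m * rm j m\<close>.\<close>

lemma cap'_cup_sideways:
  assumes "i \<noteq> j"
  shows "s (Cap j m) * s (Cup' j m) * (s (Cap' j (m - rt D j + rt D i)) * s (Cup j (m - rt D j + rt D i))) = 1"
proof -
  have "rm j (m - rt D j + rt D i) = rm j (m - rt D j)"
    using rm_shift[OF assms, of "m - rt D j + rt D i"] by simp
  then have "beta Q j * (rp j m * rm j (m - rt D j + rt D i)) = beta P j * (rp j m * rm j m)"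
    using rm_shift_self[of j m] by (simp add: mult.left_commute[of _ "rp j m"])
  then have "rp j m * rm j (m - rt D j + rt D i) = 1"
    using rp_rm[of j m] nonzero_beta[of j] by simp
  then show ?thesis by (simp add: rp_def rm_def)
qed

text \<open>The two sides are the scalars of the two rotations of the crossing. Eliminating \<eta>
  and \<epsilon>' through zigzags reduces them to \<open>rp j m * rp i (m - \<alpha>\<^sub>j) = rp j
  (m - \<alpha>\<^sub>i) * rp i m\<close>, which is trivial for equal indices and otherwise
  invariance under a step of the other colour.\<close>

lemma crossing_factors:
  "s (Cap j m) * (s (Cap i (m - rt D j)) * (s (Cup i (m - rt D i)) * s (Cup j (m - rt D i - rt D j)))) =
   s (Cap' i (m - rt D i - rt D j)) * (s (Cap' j (m - rt D j)) * (s (Cup' j (m - rt D i)) * s (Cup' i m)))"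
proof -
  have "s (Cap i m) * s (Cup i (m - rt D i)) = 1"
    "s (Cap j (m - rt D i)) * s (Cup j (m - rt D i - rt D j)) = 1"
    "s (Cap' i (m - rt D j - rt D i)) * s (Cup' i (m - rt D j)) = 1"
    "s (Cap' j (m - rt D j)) * s (Cup' j m) = 1"
    by (rule cap_cup' cap'_cup)+
  moreover have "m - rt D j - rt D i = m - rt D i - rt D j" by simp
  ultimately have cups: "s (Cup i (m - rt D i)) = 1 / s (Cap i m)"
    "s (Cup j (m - rt D i - rt D j)) = 1 / s (Cap j (m - rt D i))"
    "s (Cap' i (m - rt D i - rt D j)) = 1 / s (Cup' i (m - rt D j))"
    "s (Cap' j (m - rt D j)) = 1 / s (Cup' j m)"
    using nonzero by (simp_all add: field_simps)
  have "rp j m * rp i (m - rt D j) = rp j (m - rt D i) * rp i m"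
    using rp_shift[of i j m] rp_shift[of j i m] by (cases "i = j") auto
  then show ?thesis unfolding cups using nonzero by (simp add: rp_def field_simps)
qed

section \<open>Compatibility of rescaling with the defining relations\<close>

lemma relation_Q: "relation D t Q f g \<Longrightarrow> f \<approx> g"
  using relation_wf[OF D] by (blast intro: eqv.rel)

text \<open>Dots carry the scalar 1, so the number of dots does not affect the scalar of a
  bubble.\<close>

lemma factor_real_bubble:
  "factor s (cw_real D i m n) = rp i m" "homogeneous s (cw_real D i m n)"
  "factor s (ccw_real D i m n) = rm i m" "homogeneous s (ccw_real D i m n)"
  by (simp_all add: cw_real_def ccw_real_def rp_def rm_def factor_dots)

lemma scales_real_bubble: "sc (cw_real D i m n) (rp i m) (cw_real D i m n)"
  "sc (ccw_real D i m n) (rm i m) (ccw_real D i m n)"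
  using scales_factor[of D "cw_real D i m n" s t Q] scales_factor[of D "ccw_real D i m n" s t Q]
  by (simp_all add: factor_real_bubble)

lemma scales_Ident: "sc (Ident m W) 1 (Ident m W)"
  using scales_factor[of D "Ident m W" s t Q] by simp

text \<open>Each summand pairs a smaller fake bubble, scaled by \<open>rp\<close>, with a real one,
  scaled by \<open>rm\<close>; the change of coefficient from \<open>- 1 / cminus P\<close> to
  \<open>- 1 / cminus Q\<close> absorbs \<open>rm\<close>. The bound on the coroot makes the numbers
  of dots on the real bubbles nonnegative, so that \<open>nat\<close> does not truncate and the
  degrees match.\<close>

lemma scales_cw_fake: "coroot D i m \<le> 0 \<Longrightarrow> sc (cw_fake D P i m j) (rp i m) (cw_fake D Q i m j)"
proof (induction j rule: less_induct)
  case (less j)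
  show ?case
  proof (cases "j = 0")
    case True
    then show ?thesis using scales_smul[OF scales_Ident, of "cplus P i m" "rp i m" "cplus Q i m" m "[]"]
      by (simp add: cw_fake.simps[of D _ i m 0] rp)
  next
    case False
    let ?e = "\<lambda>R y. cw_fake D R i m (j - y) \<circ>\<^sub>v ccw_real D i m (nat (- coroot D i m - 1 + int y))"
    have eq: "cw_fake D R i m j = (- 1 / cminus R i m) \<cdot>\<^sub>v
        sum_tm (Zer m [] [] (2 * int j)) (map (?e R) [1..<Suc j])" for R
      using False by (subst cw_fake.simps) simp
    have wf: "wf_tm D (cw_fake D Q i m k)" for k
      using has_type_cw_fake[OF less.prems] by (auto simp: has_type_def)
    have "sc (sum_tm (Zer m [] [] (2 * int j)) (map (?e P) [1..<Suc j])) (rp i m * rm i m)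
        (sum_tm (Zer m [] [] (2 * int j)) (map (?e Q) [1..<Suc j]))"
    proof (rule scales_sum)
      show "wf_tm D (sum_tm (Zer m [] [] (2 * int j)) (map (?e Q) [1..<Suc j]))"
        using wf[of j] unfolding eq[of Q] by simp
      fix y assume "y \<in> set [1..<Suc j]"
      then have "sc (cw_fake D P i m (j - y)) (rp i m) (cw_fake D Q i m (j - y))"
        using less.prems by (intro less.IH) auto
      then show "sc (?e P y) (rp i m * rm i m) (?e Q y)"
        using has_type_cw_fake[OF less.prems, of Q "j - y"]
        by (intro scales_vc scales_real_bubble) (auto simp: has_type_def)
    qed (simp add: scales_Zer)
    then show ?thesis unfolding eq
      by (rule scales_smul) (use rm[of i m] nonzero[of i m] in \<open>simp add: field_simps\<close>)
  qed
qed

lemma scales_ccw_fake: "coroot D i m \<ge> 0 \<Longrightarrow> sc (ccw_fake D P i m j) (rm i m) (ccw_fake D Q i m j)"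
proof (induction j rule: less_induct)
  case (less j)
  show ?case
  proof (cases "j = 0")
    case True
    then show ?thesis using scales_smul[OF scales_Ident, of "cminus P i m" "rm i m" "cminus Q i m" m "[]"]
      by (simp add: ccw_fake.simps[of D _ i m 0] rm)
  next
    case False
    let ?e = "\<lambda>R y. cw_real D i m (nat (coroot D i m - 1 + int y)) \<circ>\<^sub>v ccw_fake D R i m (j - y)"
    have eq: "ccw_fake D R i m j = (- 1 / cplus R i m) \<cdot>\<^sub>v
        sum_tm (Zer m [] [] (2 * int j)) (map (?e R) [1..<Suc j])" for R
      using False by (subst ccw_fake.simps) simp
    have wf: "wf_tm D (ccw_fake D Q i m k)" for k
      using has_type_ccw_fake[OF less.prems] by (auto simp: has_type_def)
    have "sc (sum_tm (Zer m [] [] (2 * int j)) (map (?e P) [1..<Suc j])) (rp i m * rm i m)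
        (sum_tm (Zer m [] [] (2 * int j)) (map (?e Q) [1..<Suc j]))"
    proof (rule scales_sum)
      show "wf_tm D (sum_tm (Zer m [] [] (2 * int j)) (map (?e Q) [1..<Suc j]))"
        using wf[of j] unfolding eq[of Q] by simp
      fix y assume "y \<in> set [1..<Suc j]"
      then have "sc (ccw_fake D P i m (j - y)) (rm i m) (ccw_fake D Q i m (j - y))"
        using less.prems by (intro less.IH) auto
      then show "sc (?e P y) (rp i m * rm i m) (?e Q y)"
        using has_type_ccw_fake[OF less.prems, of Q "j - y"]
        by (intro scales_vc scales_real_bubble) (auto simp: has_type_def)
    qed (simp add: scales_Zer)
    then show ?thesis unfolding eq
      by (rule scales_smul) (use rp[of i m] nonzero[of i m] in \<open>simp add: field_simps\<close>)
  qed
qed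

text \<open>A fake bubble is used only for a negative number of dots, which yields the sign of the
  coroot that the recursion requires.\<close>

lemma scales_bubble: "sc (cw D P i m j) (rp i m) (cw D Q i m j)"
  "sc (ccw D P i m j) (rm i m) (ccw D Q i m j)"
  using scales_cw_fake[of i m j] scales_ccw_fake[of i m j]
  by (auto simp: cw_def ccw_def Let_def scales_real_bubble)

text \<open>For equal indices the opposite shifts by \<open>\<alpha>\<^sub>i\<close> cancel, so all
  four cups and caps sit in weight \<open>m\<close> and give one ratio of each orientation, in
  contrast to \<open>cap'_cup_sideways\<close>.\<close>

lemma factor_sigma_same:
  "factor s (sigma D i i m) * factor s (sigma' D i i m) = rp i m * rm i m"
  "homogeneous s (sigma D i j m)" "homogeneous s (sigma' D i j m)"
  by (simp_all add: sigma_def sigma'_def rp_def rm_def)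

text \<open>Relations without bubble parameters are the same expressions for \<open>P\<close> and
  \<open>Q\<close> and need a common factor on both sides. The others go through
  \<open>scales\<close>, which trades the parameters.\<close>

lemma relation_rescale: "relation D t P f g \<Longrightarrow> rescale s f \<approx> rescale s g"
proof (induction rule: relation.induct)
  case (biadj_E_left m i)
  show ?case by (rule homogeneous_eqv[OF relation_Q[OF relation.biadj_E_left]]) (simp_all add: cap_cup)
next
  case (biadj_E_right i m)
  show ?case by (rule homogeneous_eqv[OF relation_Q[OF relation.biadj_E_right]]) (simp_all add: cap'_cup')
next
  case (biadj_F_left i m)
  show ?case by (rule homogeneous_eqv[OF relation_Q[OF relation.biadj_F_left]]) (simp_all add: cap_cup)
next
  case (biadj_F_right m i)
  show ?case by (rule homogeneous_eqv[OF relation_Q[OF relation.biadj_F_right]]) (simp_all add: cap'_cup')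
next
  case (cyclic_dot m i)
  show ?case
    by (rule homogeneous_eqv[OF relation_Q[OF relation.cyclic_dot]]) (simp_all add: cap_cup cap'_cup')
next
  case (cyclic_crossing j i m)
  show ?case
    by (rule homogeneous_eqv[OF relation_Q[OF relation.cyclic_crossing]])
       (simp_all add: crossing_factors)
next
  case (klr_quadratic_same i m)
  show ?case by (rule homogeneous_eqv[OF relation_Q[OF relation.klr_quadratic_same]]) simp_all
next
  case (klr_quadratic_orthogonal i j m)
  then show ?case
    by (intro homogeneous_eqv[OF relation_Q[OF relation.klr_quadratic_orthogonal]]) simp_all
next
  case (klr_quadratic_adjacent i j m)
  then show ?case
    by (intro homogeneous_eqv[OF relation_Q[OF relation.klr_quadratic_adjacent]]) simp_all
next
  case (nilhecke_left i m)
  show ?case by (rule homogeneous_eqv[OF relation_Q[OF relation.nilhecke_left]]) simp_all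
next
  case (nilhecke_right i m)
  show ?case by (rule homogeneous_eqv[OF relation_Q[OF relation.nilhecke_right]]) simp_all
next
  case (dot_slide_left i j m)
  then show ?case by (intro homogeneous_eqv[OF relation_Q[OF relation.dot_slide_left]]) simp_all
next
  case (dot_slide_right i j m)
  then show ?case by (intro homogeneous_eqv[OF relation_Q[OF relation.dot_slide_right]]) simp_all
next
  case (klr_cubic lhs j k m i)
  show ?case
    by (rule homogeneous_eqv[OF relation_Q[OF relation.klr_cubic[OF klr_cubic]]])
       (simp_all add: klr_cubic)
next
  case (mixed_FE i j m)
  then show ?case using cap'_cup_sideways[OF mixed_FE, of m]
    by (intro homogeneous_eqv[OF relation_Q[OF relation.mixed_FE]])
       (simp_all add: sigma_def sigma'_def algebra_simps)
next
  case (mixed_EF i j m)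
  then show ?case using cap'_cup_sideways[OF mixed_EF, of m]
    by (intro homogeneous_eqv[OF relation_Q[OF relation.mixed_EF]])
       (simp_all add: sigma_def sigma'_def algebra_simps)
next
  case (cw_bubble_zero m i \<mu>)
  then show ?case
    by (intro homogeneous_zer_eqv relation_Q relation.cw_bubble_zero factor_real_bubble)
next
  case (ccw_bubble_zero m i \<mu>)
  then show ?case
    by (intro homogeneous_zer_eqv relation_Q relation.ccw_bubble_zero factor_real_bubble)
next
  case (cw_bubble_degree_zero m i \<mu>)
  show ?case
    by (rule scales_eqv[OF scales_real_bubble(1)
          relation_Q[OF relation.cw_bubble_degree_zero[OF cw_bubble_degree_zero]]
          scales_smul[OF scales_Ident]]) (simp add: rp)
next
  case (ccw_bubble_degree_zero m i \<mu>)
  show ?case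
    by (rule scales_eqv[OF scales_real_bubble(2)
          relation_Q[OF relation.ccw_bubble_degree_zero[OF ccw_bubble_degree_zero]]
          scales_smul[OF scales_Ident]]) (simp add: rm)
next
  case (sl2_EF m i)
  \<comment> \<open>The parameters \<open>R\<close> stay an argument because the bubble in the
    middle can be fake and then contains them.\<close>
  let ?e = "\<lambda>R (f1, f2, f3). whisker D [] (dots i (m - rt D i) f3) [\<F> i] \<circ>\<^sub>v cup' i m \<circ>\<^sub>v
           ccw D R i m f2 \<circ>\<^sub>v cap i m \<circ>\<^sub>v whisker D [] (dots i (m - rt D i) f1) [\<F> i]"
  let ?z = "Zer m [\<E> i, \<F> i] [\<E> i, \<F> i] 0"
  let ?S = "\<lambda>R. sum_tm ?z (map (?e R) (triples (coroot D i m)))"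
  let ?X = "sigma' D i i m \<circ>\<^sub>v sigma D i i m"
  let ?rhs = "\<lambda>R. beta R i \<cdot>\<^sub>v ?X -\<^sub>v beta R i \<cdot>\<^sub>v ?S R"
  have rel: "Ident m [\<E> i, \<F> i] \<approx> ?rhs Q" by (rule relation_Q[OF relation.sl2_EF])
  then have wf: "wf_tm D (?rhs Q)" using eqv_wf_parallel by blast
  then have wfS: "wf_tm D (?S Q)" by (simp only: wf_tm.simps)
  have X: "sc ?X (rp i m * rm i m) ?X"
    using scales_factor[of D ?X s t Q] wf factor_sigma_same(1)[of i m]
    by (simp add: factor_sigma_same mult.commute)
  have "sc (?e P x) (rp i m * rm i m) (?e Q x)" if "x \<in> set (triples (coroot D i m))" for x
  proof (cases x)
    case (fields f1 f2 f3)
    have dots: "sc (whisker D [] (dots i (m - rt D i) n) [\<F> i]) 1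
        (whisker D [] (dots i (m - rt D i) n) [\<F> i])" for n
      using scales_factor[of D "whisker D [] (dots i (m - rt D i) n) [\<F> i]" s t Q]
      by (simp add: factor_dots)
    have gen: "sc (Gen g) (s g) (Gen g)" for g using scales_factor[of D "Gen g" s t Q] by simp
    \<comment> \<open>The outer cup and cap give \<open>rp\<close>, the bubble between them gives
      \<open>rm\<close>: the factor of the sideways crossings again, for every distribution of the
      dots.\<close>
    have "sc (?e P (f1, f2, f3)) (1 * (s (Cup' i m) * (rm i m * (s (Cap i m) * 1)))) (?e Q (f1, f2, f3))"
      using has_type_ccw[of D Q i m f2] unfolding prod.case
      by (intro scales_vc dots gen scales_bubble) (simp_all add: has_type_def)
    then show ?thesis by (simp add: fields rp_def ac_simps)
  qed
  then have S: "sc (?S P) (rp i m * rm i m) (?S Q)"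
    \<comment> \<open>A starting zero admits any factor, in particular that of the other
      summands.\<close>
    by (rule scales_sum[OF scales_Zer[OF HOL.refl] _ wfS])
  have "sc (?rhs P) 1 (?rhs Q)"
    \<comment> \<open>By \<open>rp_rm\<close> the coefficient \<open>beta P i\<close> times the
      common factor is \<open>beta Q i\<close>; the total factor is 1, as the identity on the left
      requires.\<close>
    by (intro scales_add wf scales_smul[where a = 1] scales_smul[OF X] scales_smul[OF S]) (simp_all add: rp_rm)
  from scales_eqv[OF scales_Ident rel this] show ?case by simp
next
  case (sl2_FE m i)
  let ?e = "\<lambda>R (f1, f2, f3). whisker D [\<F> i] (dots i m f3) [] \<circ>\<^sub>v cup i m \<circ>\<^sub>v
           cw D R i m f2 \<circ>\<^sub>v cap' i m \<circ>\<^sub>v whisker D [\<F> i] (dots i m f1) []"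
  let ?z = "Zer m [\<F> i, \<E> i] [\<F> i, \<E> i] 0"
  let ?S = "\<lambda>R. sum_tm ?z (map (?e R) (triples (- coroot D i m)))"
  let ?X = "sigma D i i m \<circ>\<^sub>v sigma' D i i m"
  let ?rhs = "\<lambda>R. beta R i \<cdot>\<^sub>v ?X -\<^sub>v beta R i \<cdot>\<^sub>v ?S R"
  have rel: "Ident m [\<F> i, \<E> i] \<approx> ?rhs Q" by (rule relation_Q[OF relation.sl2_FE])
  then have wf: "wf_tm D (?rhs Q)" using eqv_wf_parallel by blast
  then have wfS: "wf_tm D (?S Q)" by (simp only: wf_tm.simps)
  have X: "sc ?X (rp i m * rm i m) ?X"
    using scales_factor[of D ?X s t Q] wf factor_sigma_same(1)[of i m]
    by (simp add: factor_sigma_same)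
  have "sc (?e P x) (rp i m * rm i m) (?e Q x)" if "x \<in> set (triples (- coroot D i m))" for x
  proof (cases x)
    case (fields f1 f2 f3)
    have dots: "sc (whisker D [\<F> i] (dots i m n) []) 1 (whisker D [\<F> i] (dots i m n) [])" for n
      using scales_factor[of D "whisker D [\<F> i] (dots i m n) []" s t Q]
      by (simp add: factor_dots)
    have gen: "sc (Gen g) (s g) (Gen g)" for g using scales_factor[of D "Gen g" s t Q] by simp
    \<comment> \<open>The roles are reversed: the outer cup and cap give \<open>rm\<close>, the
      clockwise bubble gives \<open>rp\<close>.\<close>
    have "sc (?e P (f1, f2, f3)) (1 * (s (Cup i m) * (rp i m * (s (Cap' i m) * 1)))) (?e Q (f1, f2, f3))"
      using has_type_cw[of D Q i m f2] unfolding prod.case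
      by (intro scales_vc dots gen scales_bubble) (simp_all add: has_type_def)
    then show ?thesis by (simp add: fields rm_def ac_simps)
  qed
  then have S: "sc (?S P) (rp i m * rm i m) (?S Q)"
    by (rule scales_sum[OF scales_Zer[OF HOL.refl] _ wfS])
  have "sc (?rhs P) 1 (?rhs Q)"
    by (intro scales_add wf scales_smul[where a = 1] scales_smul[OF X] scales_smul[OF S]) (simp_all add: rp_rm)
  from scales_eqv[OF scales_Ident rel this] show ?case by simp
qed

end


section \<open>The isomorphism\<close>

definition rescale_cls :: "('i, 'x::ab_group_add) cartan_data \<Rightarrow> ('i \<Rightarrow> 'i \<Rightarrow> 'k::field) \<Rightarrow>
    ('i, 'x, 'k) bubble_params \<Rightarrow> (('i, 'x) generator \<Rightarrow> 'k) \<Rightarrow>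
    ('i, 'x, 'k) tm set \<Rightarrow> ('i, 'x, 'k) tm set" where
  "rescale_cls D t Q s X = (\<Union>f\<in>X. cls D t Q (rescale s f))"

definition rescale_cell :: "('i, 'x::ab_group_add) cartan_data \<Rightarrow> ('i \<Rightarrow> 'i \<Rightarrow> 'k::field) \<Rightarrow>
    ('i, 'x, 'k) bubble_params \<Rightarrow> (('i, 'x) generator \<Rightarrow> 'k) \<Rightarrow>
    ('i, 'x, 'k) two_cell \<Rightarrow> ('i, 'x, 'k) two_cell" where
  "rescale_cell D t Q s M =
     TwoCell (dom2 M) (cod2 M) (\<lambda>q p. rescale_cls D t Q s (entry M q p))"

lemma rescale_cell_sel [simp]:
  "dom2 (rescale_cell D t Q s M) = dom2 M" "cod2 (rescale_cell D t Q s M) = cod2 M"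
  "entry (rescale_cell D t Q s M) q p = rescale_cls D t Q s (entry M q p)"
  by (simp_all add: rescale_cell_def)

text \<open>The scalars cancel only up to the congruence, not as expressions, so the inverse map
  exists on classes.\<close>

lemma rescale_inverse_eqv:
  assumes "\<And>g. s' g * s g = 1"
  shows "wf_tm D f \<Longrightarrow> eqv D t P (rescale s' (rescale s f)) f"
proof (induction f)
  case (Gen g)
  have "eqv D t P (s g \<cdot>\<^sub>v s' g \<cdot>\<^sub>v Gen g) (1 \<cdot>\<^sub>v Gen g)"
    by (rule smul_smul_eqv) (use assms[of g] in \<open>simp_all add: mult.commute\<close>)
  also have "eqv D t P (1 \<cdot>\<^sub>v Gen g) (Gen g)" by (rule eqv.smul_one) simp
  finally show ?case by simp
qed (auto intro: eqv.refl eqv.cong_vc eqv.cong_hc eqv.cong_add eqv.cong_smul)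

context rescaling_datum
begin

text \<open>Each structural rule is carried to an instance of itself because rescaling commutes with
  the formation of expressions; the choice of scalars enters only in the case
  \<open>rel\<close>.\<close>

lemma eqv_rescale: "eqv D t P f g \<Longrightarrow> rescale s f \<approx> rescale s g"
proof (induction rule: eqv.induct)
  case (rel f g)
  then show ?case by (intro relation_rescale)
next
  case (trans f g h)
  then show ?case by (blast intro: eqv.trans)
next
  case (sym f g)
  then show ?case by (blast intro: eqv.sym)
next
  case (vc_id_left f)
  then show ?case using eqv.vc_id_left[of D "rescale s f" t Q] by simp
next
  case (vc_id_right f)
  then show ?case using eqv.vc_id_right[of D "rescale s f" t Q] by simp
next
  case (hc_id_left f)
  then show ?case using eqv.hc_id_left[of D "rescale s f" t Q] by simp
next
  case (hc_id_right f)
  then show ?case using eqv.hc_id_right[of D "rescale s f" t Q] by simp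
next
  case (add_zero f)
  then show ?case using eqv.add_zero[of D "rescale s f" t Q] by simp
next
  case (add_neg f)
  then show ?case using eqv.add_neg[of D "rescale s f" t Q] by simp
next
  case (vc_assoc f g h)
  then show ?case by (simp, intro eqv.vc_assoc) simp
next
  case (hc_assoc f g h)
  then show ?case by (simp, intro eqv.hc_assoc) (simp add: tm_tgt_def)
next
  case (add_assoc f g h)
  then show ?case by (simp, intro eqv.add_assoc) (simp add: parallel_def)
next
  case (hc_add_right f g h)
  then show ?case by (simp, intro eqv.hc_add_right) (simp add: tm_tgt_def)
next
  case (interchange f f' g g')
  then show ?case by (simp, intro eqv.interchange) (simp add: tm_tgt_def)
qed (simp_all add: eqv.refl eqv.hc_id eqv.cong_smul eqv.cong_vc eqv.cong_hc eqv.cong_add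
       eqv.add_comm eqv.smul_add eqv.smul_plus eqv.smul_times eqv.smul_one
       eqv.vc_add_left eqv.vc_add_right eqv.vc_smul_left eqv.vc_smul_right
       eqv.hc_add_left eqv.hc_smul_left eqv.hc_smul_right)

section \<open>The rescaling 2-functor\<close>

abbreviation "HP \<equiv> graded_hom D t P"
abbreviation "HQ \<equiv> graded_hom D t Q"
abbreviation "UP \<equiv> U_Qbeta D t P"
abbreviation "UQ \<equiv> U_Qbeta D t Q"
abbreviation "R \<equiv> rescale_cls D t Q s"
abbreviation "F \<equiv> rescale_cell D t Q s"

lemma rescale_cls_cls: "wf_tm D f \<Longrightarrow> R (cls D t P f) = cls D t Q (rescale s f)"
proof -
  assume f: "wf_tm D f"
  have "cls D t Q (rescale s f') = cls D t Q (rescale s f)" if "f' \<in> cls D t P f" for f'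
    using cls_eqI[OF eqv_rescale[OF mem_clsD[OF that]]] by simp
  then show ?thesis unfolding rescale_cls_def using mem_cls_self[OF f, of t P] by blast
qed

lemma rescale_cls_closed: "X \<in> HP m W V d \<Longrightarrow> R X \<in> HQ m W V d"
  by (elim graded_homE) (auto simp: has_type_wf rescale_cls_cls intro!: cls_in_graded_hom)

lemma rescale_cls_vc: "X \<in> HP m V U d \<Longrightarrow> Y \<in> HP m W V e \<Longrightarrow>
    R (cls_vc D t P X Y) = cls_vc D t Q (R X) (R Y)"
  by (elim graded_homE) (simp add: has_type_def cls_ops rescale_cls_cls)

lemma rescale_cls_hc: "X \<in> HP (m + word_weight D W) W' V' d \<Longrightarrow> Y \<in> HP m W V e \<Longrightarrow>
    R (cls_hc D t P X Y) = cls_hc D t Q (R X) (R Y)"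
  by (elim graded_homE) (auto simp: has_type_def cls_ops rescale_cls_cls tm_tgt_def)

lemma rescale_cls_add: "X \<in> HP m W V d \<Longrightarrow> Y \<in> HP m W V d \<Longrightarrow>
    R (cls_add D t P X Y) = cls_add D t Q (R X) (R Y)"
  by (elim graded_homE) (simp add: has_type_def parallel_def cls_ops rescale_cls_cls)

lemma rescale_cls_smul: "X \<in> HP m W V d \<Longrightarrow> R (cls_smul D t P a X) = cls_smul D t Q a (R X)"
  by (elim graded_homE) (simp add: has_type_def cls_ops rescale_cls_cls)

lemma rescale_zero_entry: "parallel_cells D A B \<Longrightarrow> q < size1 B \<Longrightarrow> p < size1 A \<Longrightarrow>
    R (zero_entry D t P A B q p) = zero_entry D t Q A B q p"
  using parallel_weight[of D A B q p] by (simp add: zero_entry_def rescale_cls_cls)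

lemma rescale_cell_closed:
  assumes f: "f \<in> hom2 UP A B"
  shows "F f \<in> hom2 UQ A B"
proof -
  have "R (entry f q p) \<in> (if q < size1 B \<and> p < size1 A then entry_hom D t Q A B q p else {{}})" for q p
  proof (cases "q < size1 B \<and> p < size1 A")
    case True
    then show ?thesis using hom2_entry[OF f, of q p]
      by (simp add: entry_hom_def rescale_cls_closed)
  next
    case False
    \<comment> \<open>A union over no representatives is empty, so entries out of range keep their
      default value.\<close>
    then show ?thesis unfolding hom2_entry_outside[OF f False] by (auto simp: rescale_cls_def)
  qed
  then show ?thesis using hom2_cells[OF f] by (auto simp only: hom2_iff rescale_cell_sel)
qed

text \<open>The laws reduce to those of \<open>rescale_cls\<close> on entries; for vertical
  composition \<open>hom_S\<close> carries it through the sum over the intermediate index.\<close>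

lemma rescale_cell_functor: "graded_additive_two_functor UP UQ id id F"
proof (intro graded_additive_two_functor.intro U_graded_additive_two_category
    graded_additive_two_functor_axioms.intro)
  fix f A B assume "f \<in> hom2 UP A B"
  then show "F f \<in> hom2 UQ (id A) (id B)" by (simp add: rescale_cell_closed)
next
  fix A assume "A \<in> Mor1 UP"
  then have A: "A \<in> one_cells D" by simp
  show "F (Id2 UP A) = Id2 UQ (id A)"
    by (simp, rule two_cell_eqI[OF rescale_cell_closed[OF id_two_cell_closed[OF A]] id_two_cell_closed[OF A]])
       (simp add: entry_id rescale_zero_entry parallel_cells_refl A rescale_cls_cls)
next
  fix f A B A' g assume f: "f \<in> hom2 UP B A'" and g: "g \<in> hom2 UP A B"
  note fg = vcomp_closed[OF f g]
  note cells = hom2_cells(1)[OF g] hom2_cells(1)[OF f]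
  have src: "src1 A = src1 B" using cells by (simp add: parallel_cells_def)
  note AA = parallel_cells_trans[OF cells]
  show "F (VComp UP f g) = VComp UQ (F f) (F g)"
    unfolding U_Qbeta_simps
  proof (rule two_cell_eqI[OF rescale_cell_closed[OF fg]
        vcomp_closed[OF rescale_cell_closed[OF f] rescale_cell_closed[OF g]]])
    fix q p assume q: "q < size1 A'" and p: "p < size1 A"
    note mem = hom2_entry[OF f q, unfolded entry_hom_def] hom2_entry[OF g _ p, unfolded entry_hom_def src]
    have "R (entry (vcomp_two_cell D t P f g) q p) =
      lsum (cls_add D t Q) (zero_entry D t Q A A' q p)
        (\<lambda>r. R (cls_vc D t P (entry f q r) (entry g r p))) (size1 B)"
      unfolding entry_vcomp[OF f g q p]
    proof (rule commutative_monoid_on.hom_S[OF entry_monoid[OF AA q p]], goal_cases)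
      case 1
      show ?case by (rule rescale_zero_entry[OF AA q p])
    next
      case (2 x y)
      then show ?case unfolding entry_hom_def by (rule rescale_cls_add)
    next
      case (3 r)
      show ?case by (rule entry_vc_closed[OF hom2_entry[OF f q 3] hom2_entry[OF g 3 p] src])
    qed
    also have "\<dots> = lsum (cls_add D t Q) (zero_entry D t Q A A' q p)
        (\<lambda>r. cls_vc D t Q (R (entry f q r)) (R (entry g r p))) (size1 B)"
      by (intro lsum_cong rescale_cls_vc[OF mem])
    also have "\<dots> = entry (vcomp_two_cell D t Q (F f) (F g)) q p"
      using entry_vcomp[OF rescale_cell_closed[OF f] rescale_cell_closed[OF g] q p] by simp
    finally show "entry (F (vcomp_two_cell D t P f g)) q p = entry (vcomp_two_cell D t Q (F f) (F g)) q p"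
      by simp
  qed
next
  fix f g assume "f \<in> Mor2 UP" "g \<in> Mor2 UP" "Src UP (Dom UP f) = Tgt UP (Dom UP g)"
  then have f: "f \<in> hom2 UP (dom2 f) (cod2 f)" and g: "g \<in> hom2 UP (dom2 g) (cod2 g)"
    and src: "src1 (dom2 f) = tgt1 (dom2 g)" by (auto simp: Mor2_hom2)
  note f' = rescale_cell_closed[OF f] and g' = rescale_cell_closed[OF g]
  show "F (HComp UP f g) = HComp UQ (F f) (F g)"
    unfolding U_Qbeta_simps
  proof (rule two_cell_eqI[OF rescale_cell_closed[OF hcomp_closed[OF f g src]] hcomp_closed[OF f' g' src]])
    fix q p assume "q < size1 (comp_one_cell (cod2 f) (cod2 g))" "p < size1 (comp_one_cell (dom2 f) (dom2 g))"
    then have q: "q < size1 (cod2 f) * size1 (cod2 g)" and p: "p < size1 (dom2 f) * size1 (dom2 g)"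
      by (simp_all add: size1_comp)
    note dq = div_mod_less[OF q] and dp = div_mod_less[OF p]
    have w: "src1 (dom2 f) = src1 (dom2 g) + word_weight D (summand_word (dom2 g) (p mod size1 (dom2 g)))"
      using one_cell_weight[of "dom2 g" D "p mod size1 (dom2 g)"] hom2_cells(1)[OF g] dp src
      by (simp add: parallel_cells_def)
    show "entry (F (hcomp_two_cell D t P f g)) q p = entry (hcomp_two_cell D t Q (F f) (F g)) q p"
      unfolding rescale_cell_sel entry_hcomp[OF f g q p] entry_hcomp[OF f' g' q p]
      by (rule rescale_cls_hc[OF hom2_entry[OF f dq(1) dp(1), unfolded entry_hom_def w]
            hom2_entry[OF g dq(2) dp(2), unfolded entry_hom_def]])
  qed
next
  fix f g A B assume f: "f \<in> hom2 UP A B" and g: "g \<in> hom2 UP A B"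
  show "F (Add2 UP f g) = Add2 UQ (F f) (F g)"
    unfolding U_Qbeta_simps
    by (rule two_cell_eqI[OF rescale_cell_closed[OF add_two_cell_closed[OF f g]]
          add_two_cell_closed[OF rescale_cell_closed[OF f] rescale_cell_closed[OF g]]])
       (simp add: entry_add[OF f] entry_add[OF rescale_cell_closed[OF f]],
        rule rescale_cls_add[OF hom2_entry[OF f, unfolded entry_hom_def]
          hom2_entry[OF g, unfolded entry_hom_def]])
next
  fix f A B a assume f: "f \<in> hom2 UP A B"
  show "F (Smult2 UP a f) = Smult2 UQ a (F f)"
    unfolding U_Qbeta_simps
    by (rule two_cell_eqI[OF rescale_cell_closed[OF smult_two_cell_closed[OF f]]
          smult_two_cell_closed[OF rescale_cell_closed[OF f]]])
       (simp add: entry_smult[OF f] entry_smult[OF rescale_cell_closed[OF f]],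
        rule rescale_cls_smul[OF hom2_entry[OF f, unfolded entry_hom_def]])
qed (simp_all add: hom1_iff two_cell_expand fun_eq_iff)

section \<open>The inverse 2-functor\<close>

lemma rescaling_inverse: "rescaling D Q P (\<lambda>g. inverse (s g))"
proof -
  have "inverse (s (Cap i m)) * inverse (s (Cup' i m)) * cplus P i m = cplus Q i m"
    "inverse (s (Cap' i m)) * inverse (s (Cup i m)) * cminus P i m = cminus Q i m" for i m
    using rp[of i m] rm[of i m] nonzero[of i m] by (simp_all add: rp_def rm_def field_simps)
  then show ?thesis using cap_cup cap'_cup'
    by (simp add: rescaling_def flip: inverse_mult_distrib)
qed

lemma s_nonzero: "s g \<noteq> 0"
  by (cases g) (simp_all add: nonzero)

lemma rescale_cell_isomorphism:
  "graded_additive_two_isomorphism UP UQ id id F"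
proof -
  \<comment> \<open>A second instance with \<open>P\<close> and \<open>Q\<close> exchanged makes
    \<open>inv.F\<close> a well-defined map in the opposite direction.\<close>
  interpret inv: rescaling_datum D t Q P "\<lambda>g. inverse (s g)"
    by unfold_locales (rule D Q P rescaling_inverse)+
  have cls: "inv.R (R X) = X" if "X \<in> HP m W V d" for X m W V d
    using that
    by (elim graded_homE)
       (auto simp: has_type_wf rescale_cls_cls inv.rescale_cls_cls s_nonzero
         intro!: cls_eqI rescale_inverse_eqv)
  have cls': "R (inv.R X) = X" if "X \<in> HQ m W V d" for X m W V d
    using that
    by (elim graded_homE)
       (auto simp: has_type_wf rescale_cls_cls inv.rescale_cls_cls s_nonzero
         intro!: cls_eqI rescale_inverse_eqv)
  have FF: "F f \<in> two_cells D t Q" "inv.F (F f) = f" if f: "f \<in> two_cells D t P" for f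
  proof -
    note f' = rescale_cell_closed[OF Mor2_hom2[OF f]]
    show "F f \<in> two_cells D t Q" using f' by (simp add: hom2_def)
    show "inv.F (F f) = f"
      by (rule two_cell_eqI[OF inv.rescale_cell_closed[OF f'] Mor2_hom2[OF f]])
         (simp, rule cls[OF hom2_entry[OF Mor2_hom2[OF f], unfolded entry_hom_def]])
  qed
  have FF': "inv.F f \<in> two_cells D t P" "F (inv.F f) = f" if f: "f \<in> two_cells D t Q" for f
  proof -
    note f' = inv.rescale_cell_closed[OF Mor2_hom2[OF f]]
    show "inv.F f \<in> two_cells D t P" using f' by (simp add: hom2_def)
    show "F (inv.F f) = f"
      by (rule two_cell_eqI[OF rescale_cell_closed[OF f'] Mor2_hom2[OF f]])
         (simp, rule cls'[OF hom2_entry[OF Mor2_hom2[OF f], unfolded entry_hom_def]])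
  qed
  have "bij_betw F (two_cells D t P) (two_cells D t Q)"
    by (rule bij_betw_byWitness[where f' = inv.F]) (auto simp: FF FF')
  then show ?thesis
    by (intro graded_additive_two_isomorphism.intro graded_additive_two_isomorphism_axioms.intro
        rescale_cell_functor) simp_all
qed

lemma rescale_gen_cell: "F (gen_cell D t P g) = Smult2 UQ (s g) (gen_cell D t Q g)"
  by (auto simp: two_cell_expand gen_cell_def Let_def smult_two_cell_def entry_matrix_cell fun_eq_iff
      rescale_cls_cls cls_smul_cls) (auto simp: rescale_cls_def)

end

section \<open>The scalars of the theorem\<close>

lemma smult_one_gen_cell: "Smult2 (U_Qbeta D t Q) 1 (gen_cell D t Q g) = gen_cell D t Q g"
proof -
  have "cls_smul D t Q 1 (cls D t Q (Gen g)) = cls D t Q (Gen g)"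
    by (simp add: cls_smul_cls, rule cls_eqI, rule eqv.smul_one) simp
  then show ?thesis
    by (simp add: two_cell_expand gen_cell_def Let_def smult_two_cell_def entry_matrix_cell fun_eq_iff)
qed

text \<open>The clockwise ratio \<open>c / cplus\<close> keeps \<open>c\<close> on the cap and puts
  \<open>1 / cplus\<close> on the cap or the cup according to the residue; the counterclockwise
  ratio keeps \<open>inverse c\<close> on the cup and moves \<open>1 / cminus\<close> likewise. In a
  zigzag the denominators are then either both absent or \<open>cplus\<close> and
  \<open>cminus\<close> in neighbouring weights.\<close>

definition cyclic_scalar :: "('i, 'x::ab_group_add) cartan_data \<Rightarrow> ('i, 'x, 'k::field) bubble_params \<Rightarrow>
    ('i \<Rightarrow> 'x \<Rightarrow> 'k) \<Rightarrow> ('i, 'x) generator \<Rightarrow> 'k" where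
  "cyclic_scalar D P c g = (case g of
     Dot i m \<Rightarrow> 1
   | Crossing i j m \<Rightarrow> 1
   | Cap i m \<Rightarrow> if coroot D i m mod 4 \<in> {0, 1} then c i m / cplus P i m else c i m
   | Cap' i m \<Rightarrow> if coroot D i m mod 4 \<in> {0, 1} then 1 / cminus P i m else 1
   | Cup' i m \<Rightarrow> if coroot D i m mod 4 \<in> {2, 3} then 1 / cplus P i m else 1
   | Cup i m \<Rightarrow> if coroot D i m mod 4 \<in> {2, 3} then inverse (c i m) / cminus P i m
       else inverse (c i m))"

lemma rescaling_cyclic:
  assumes D: "simply_laced_datum D" and P: "compatible D t P" and c: "compatible D t (cyclic_params c)"
  shows "rescaling D (cyclic_params c) P (cyclic_scalar D P c)"
proof -
  have nz: "c i m \<noteq> 0" "cplus P i m \<noteq> 0" "cminus P i m \<noteq> 0" for i m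
    using P c by (auto simp: compatible_def cyclic_params_def)
  \<comment> \<open>In the cyclic case the diagonal scalar is 1. For \<open>P\<close> the step
    contributes - \<open>beta\<close>, the inverse of \<open>cplus * cminus\<close>, so the
    denominators of a zigzag cancel.\<close>
  have shift: "c i (m + simple_root D i) = c i m"
    "cplus P i (m + simple_root D i) * cminus P i m = 1" for i m
  proof -
    show "c i (m + simple_root D i) = c i m"
      using c by (simp add: compatible_def cyclic_params_def full_scalars_def)
    have "cplus P i (m + simple_root D i) = - beta P i * cplus P i m"
      "cplus P i m * cminus P i m = - 1 / beta P i" "beta P i \<noteq> 0"
      using P by (auto simp: compatible_def full_scalars_def)
    then show "cplus P i (m + simple_root D i) * cminus P i m = 1" by (simp add: mult.assoc)
  qed
  have h: "coroot D i (m + simple_root D i) = coroot D i m + 2" for i m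
    by (simp add: coroot_add[OF D] coroot_simple_root[OF D] cartan_diag[OF D])
  \<comment> \<open>All conditions are reduced to \<open>coroot D i m mod 4 \<in> {0, 1}\<close>, so
    a single case split decides every scalar.\<close>
  have mod4: "(coroot D i m + 2) mod 4 \<in> {0, 1} \<longleftrightarrow> coroot D i m mod 4 \<in> {2, 3}"
    "(coroot D i m + 2) mod 4 \<in> {2, 3} \<longleftrightarrow> coroot D i m mod 4 \<in> {0, 1}"
    "coroot D i m mod 4 \<in> {2, 3} \<longleftrightarrow> coroot D i m mod 4 \<notin> {0, 1}" for i m
    by (simp_all, presburger+)
  show ?thesis
    unfolding rescaling_def cyclic_scalar_def generator.case h mod4
    using nz shift by (auto simp: cyclic_params_def field_simps)
qed

theorem theorem3p1:
  fixes D :: "('i, 'x::ab_group_add) cartan_data"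
    and t :: "'i \<Rightarrow> 'i \<Rightarrow> 'k::field"
    and P :: "('i, 'x, 'k) bubble_params"
    and c :: "'i \<Rightarrow> 'x \<Rightarrow> 'k"
  assumes "simply_laced_datum D"
    and "choice_of_scalars D t"
    and "compatible D t P"
    and "compatible D t (cyclic_params c)"
  shows "\<exists>F. graded_additive_two_isomorphism (U_cyc D t c) (U_Qbeta D t P) id id F \<and>
    (\<forall>i j \<mu>.
      F (gen_cell D t (cyclic_params c) (Dot i \<mu>)) = gen_cell D t P (Dot i \<mu>) \<and>
      F (gen_cell D t (cyclic_params c) (Crossing i j \<mu>)) = gen_cell D t P (Crossing i j \<mu>) \<and>
      F (gen_cell D t (cyclic_params c) (Cap i \<mu>)) =
        Smult2 (U_Qbeta D t P)
          (if coroot D i \<mu> mod 4 \<in> {0, 1} then c i \<mu> / cplus P i \<mu> else c i \<mu>)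
          (gen_cell D t P (Cap i \<mu>)) \<and>
      F (gen_cell D t (cyclic_params c) (Cap' i \<mu>)) =
        Smult2 (U_Qbeta D t P)
          (if coroot D i \<mu> mod 4 \<in> {0, 1} then 1 / cminus P i \<mu> else 1)
          (gen_cell D t P (Cap' i \<mu>)) \<and>
      F (gen_cell D t (cyclic_params c) (Cup' i \<mu>)) =
        Smult2 (U_Qbeta D t P)
          (if coroot D i \<mu> mod 4 \<in> {2, 3} then 1 / cplus P i \<mu> else 1)
          (gen_cell D t P (Cup' i \<mu>)) \<and>
      F (gen_cell D t (cyclic_params c) (Cup i \<mu>)) =
        Smult2 (U_Qbeta D t P)
          (if coroot D i \<mu> mod 4 \<in> {2, 3} then inverse (c i \<mu>) / cminus P i \<mu>
           else inverse (c i \<mu>))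
          (gen_cell D t P (Cup i \<mu>)))"
proof -
  interpret rescaling_datum D t "cyclic_params c" P "cyclic_scalar D P c"
    using assms rescaling_cyclic by unfold_locales
  have gen: "F (gen_cell D t (cyclic_params c) g) =
      Smult2 (U_Qbeta D t P) (cyclic_scalar D P c g) (gen_cell D t P g)" for g
    by (rule rescale_gen_cell)
  \<comment> \<open>With these scalars equal to 1, \<open>smult_one_gen_cell\<close> removes the
    multiple, since dots and crossings are stated without one.\<close>
  have "cyclic_scalar D P c (Dot i \<mu>) = 1" "cyclic_scalar D P c (Crossing i j \<mu>) = 1" for i j \<mu>
    by (simp_all add: cyclic_scalar_def)
  then show ?thesis
    using rescale_cell_isomorphism unfolding U_cyc_def
    by (intro exI[of _ F] conjI allI)
       (simp_all only: gen smult_one_gen_cell, simp_all only: cyclic_scalar_def generator.case)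
qed

end
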